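(* Let $G$ be a Lie group with Lie algebra $\mathfrak g$. The Poisson reduction by $G$ of Tulczyjew's symplectic space ${}^{1}TT^*G=(G\circledS\mathfrak g_1^* )\circledS(\mathfrak g_2\circledS\mathfrak g_3^* )\ni(g,\mu,\xi,\nu)$ is $(\mathfrak g_1^*\times\mathfrak g_2)\circledS\mathfrak g_3^*\ni(\mu,\xi,\nu)$ with the following Poisson bracket: the functions that do not depend on $g$ are closed under the Poisson bracket of ${}^{1}TT^*G$, and for two such functions $E,F$ $$\{E,F\}(\mu,\xi,\nu)=\Big\langle\frac{\delta F}{\delta\xi},\frac{\delta E}{\delta\mu}\Big\rangle-\Big\langle\frac{\delta E}{\delta\xi},\frac{\delta F}{\delta\mu}\Big\rangle+\Big\langle\nu,\Big[\frac{\delta E}{\delta\nu},\frac{\delta F}{\delta\nu}\Big]\Big\rangle.$$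
   Context: Conventions. $G$ is a (finite-dimensional) Lie group with identity $e$, $\mathfrak g=T_eG$, $\mathfrak g^*$ its dual, $\mathfrak g^{**}=\mathfrak g$. $R_g$ is right translation. $Ad_g$ is the tangent map at $e$ of $h\mapsto g^{-1}hg$; the Lie bracket is $[\xi,\eta]=ad_\xi\eta=\frac{d}{dt}|_{t=0}Ad_{\exp(t\xi)}\eta$ (the bracket of right invariant vector fields). $\langle ad^*_\xi\mu,\eta\rangle=\langle\mu,[\xi,\eta]\rangle$. Partial derivatives: $\delta E/\delta\mu,\delta E/\delta\nu\in\mathfrak g$, $\delta E/\delta\xi\in\mathfrak g^*$. As a manifold ${}^{1}TT^*G=G\times\mathfrak g^*\times\mathfrak g\times\mathfrak g^*$ (subscripts on copies are only labels). For $(\xi_2,\nu_2,\xi_3,\nu_3)\in\mathfrak g\times\mathfrak g^*\times\mathfrak g\times\mathfrak g^*$ let $$X_{(\xi_2,\nu_2,\xi_3,\nu_3)}(g,\mu,\xi,\nu)=(T_eR_g\xi_2,\ \nu_2+ad^*_{\xi_2}\mu,\ \xi_3+[\xi,\xi_2],\ \nu_3+ad^*_{\xi_2}\nu-ad^*_\xi\nu_2).$$ The symplectic form is determined by $$\Omega(X_{(\xi_2,\nu_2,\xi_3,\nu_3)},X_{(\bar\xi_2,\bar\nu_2,\bar\xi_3,\bar\nu_3)})=\langle\nu_3,\bar\xi_2\rangle+\langle\nu_2,\bar\xi_3\rangle-\langle\bar\nu_2,\xi_3\rangle-\langle\bar\nu_3,\xi_2\rangle+\langle\nu,[\xi_2,\bar\xi_2]\rangle+\langle\mu,[\xi_3,\bar\xi_2]+[\xi_2,\bar\xi_3]+[\xi,[\xi_2,\bar\xi_2]]\rangle.$$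 Hamiltonian vector fields satisfy $i_{X_E}\Omega=-dE$ and $\{E,F\}=\Omega(X_E,X_F)=-\langle dE,X_F\rangle$. *)

theory Defs
  imports "HOL-Analysis.Analysis"
begin

section \<open>Smooth manifolds\<close>

text \<open>Differentiability of class \<open>C\<close>-\<open>n\<close> on an open subset of a finite-dimensional normed space,
  through directional derivatives (so that the codomain stays the same in the recursion).\<close>

primrec higher_differentiable_on ::
    "'a::real_normed_vector set \<Rightarrow> ('a \<Rightarrow> 'b::real_normed_vector) \<Rightarrow> nat \<Rightarrow> bool" where
  "higher_differentiable_on S f 0 \<longleftrightarrow> continuous_on S f"
| "higher_differentiable_on S f (Suc n) \<longleftrightarrow>
     (\<forall>x\<in>S. f differentiable (at x)) \<and>
     (\<forall>v. higher_differentiable_on S (\<lambda>x. frechet_derivative f (at x) v) n)"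

definition smooth_on :: "'a::real_normed_vector set \<Rightarrow> ('a \<Rightarrow> 'b::real_normed_vector) \<Rightarrow> bool" where
  "smooth_on S f \<longleftrightarrow> (\<forall>n. higher_differentiable_on S f n)"

text \<open>A chart is a domain together with a coordinate map. A smooth structure on a type is given by
  a smooth atlas in which a chart \<open>ch p\<close> around each point \<open>p\<close> has been singled out, so the atlas is
  \<open>range ch\<close>. The tangent space at \<open>p\<close> is the model vector space, a vector being represented by its
  coordinates in the chart \<open>ch p\<close>.\<close>

type_synonym ('m, 'a) chart = "'m set \<times> ('m \<Rightarrow> 'a)"

definition chart_inv :: "('m, 'a) chart \<Rightarrow> 'a \<Rightarrow> 'm" where
  "chart_inv c = inv_into (fst c) (snd c)"

text \<open>The model space is an arbitrary finite-dimensional normed space rather than a type of class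
  \<open>euclidean_space\<close>, because the latter excludes dimension 0. Completeness, required by the class
  \<open>banach\<close>, is automatic in finite dimension.\<close>

definition smooth_manifold ::
    "('m::{t2_space, second_countable_topology} \<Rightarrow> ('m, 'a::banach) chart) \<Rightarrow> bool" where
  "smooth_manifold ch \<longleftrightarrow>
     (\<exists>B::'a set. finite B \<and> span B = UNIV) \<and>
     (\<forall>p. p \<in> fst (ch p) \<and> open (fst (ch p)) \<and> open (snd (ch p) ` fst (ch p)) \<and>
          homeomorphism (fst (ch p)) (snd (ch p) ` fst (ch p)) (snd (ch p)) (chart_inv (ch p))) \<and>
     (\<forall>p q. smooth_on (snd (ch p) ` (fst (ch p) \<inter> fst (ch q))) (snd (ch q) \<circ> chart_inv (ch p)))"

definition prod_charts ::
    "('m \<Rightarrow> ('m, 'a) chart) \<Rightarrow> ('n \<Rightarrow> ('n, 'b) chart) \<Rightarrow> 'm \<times> 'n \<Rightarrow> ('m \<times> 'n, 'a \<times> 'b) chart" where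
  "prod_charts ch ch' = (\<lambda>(p, q). (fst (ch p) \<times> fst (ch' q), map_prod (snd (ch p)) (snd (ch' q))))"

definition vector_charts :: "'v \<Rightarrow> ('v, 'v) chart" where
  "vector_charts = (\<lambda>_. (UNIV, id))"

definition smooth_map ::
    "('m::topological_space \<Rightarrow> ('m, 'a::real_normed_vector) chart) \<Rightarrow>
     ('n::topological_space \<Rightarrow> ('n, 'b::real_normed_vector) chart) \<Rightarrow> ('m \<Rightarrow> 'n) \<Rightarrow> bool" where
  "smooth_map ch ch' f \<longleftrightarrow>
     continuous_on UNIV f \<and>
     (\<forall>p q. smooth_on (snd (ch p) ` (fst (ch p) \<inter> f -` fst (ch' q)))
                      (snd (ch' q) \<circ> f \<circ> chart_inv (ch p)))"

definition smooth_fun ::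
    "('m::topological_space \<Rightarrow> ('m, 'a::real_normed_vector) chart) \<Rightarrow> ('m \<Rightarrow> real) \<Rightarrow> bool" where
  "smooth_fun ch E \<longleftrightarrow> smooth_map ch vector_charts E"

definition tangent_map ::
    "('m \<Rightarrow> ('m, 'a::real_normed_vector) chart) \<Rightarrow> ('n \<Rightarrow> ('n, 'b::real_normed_vector) chart) \<Rightarrow>
     ('m \<Rightarrow> 'n) \<Rightarrow> 'm \<Rightarrow> 'a \<Rightarrow> 'b" where
  "tangent_map ch ch' f p =
     frechet_derivative (snd (ch' (f p)) \<circ> f \<circ> chart_inv (ch p)) (at (snd (ch p) p))"


section \<open>Poisson brackets and Poisson reduction\<close>

definition poisson_structure ::
    "('m::topological_space \<Rightarrow> ('m, 'a::real_normed_vector) chart) \<Rightarrow>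
     (('m \<Rightarrow> real) \<Rightarrow> ('m \<Rightarrow> real) \<Rightarrow> ('m \<Rightarrow> real)) \<Rightarrow> bool" where
  "poisson_structure ch br \<longleftrightarrow>
     (\<forall>E F. smooth_fun ch E \<and> smooth_fun ch F \<longrightarrow>
        smooth_fun ch (br E F) \<and> (\<forall>p. br E F p = - br F E p)) \<and>
     (\<forall>E F H. smooth_fun ch E \<and> smooth_fun ch F \<and> smooth_fun ch H \<longrightarrow>
        (\<forall>c p. br (\<lambda>q. c * E q + F q) H p = c * br E H p + br F H p) \<and>
        (\<forall>p. br (\<lambda>q. E q * F q) H p = E p * br F H p + br E H p * F p) \<and>
        (\<forall>p. br E (br F H) p + br F (br H E) p + br H (br E F) p = 0))"

text \<open>\<open>(Q, brQ)\<close> is the Poisson reduction of \<open>(P, brP)\<close> by a right action \<open>act\<close> of a Lie group: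
  the group acts smoothly by Poisson maps, \<open>\<pi>\<close> identifies \<open>Q\<close> (with its smooth structure) with the
  orbit space, and \<open>brQ\<close> is the Poisson bracket on \<open>Q\<close> for which \<open>\<pi>\<close> is a Poisson map.\<close>

definition poisson_reduction ::
    "('g \<Rightarrow> 'g \<Rightarrow> 'g) \<Rightarrow> 'g \<Rightarrow>
     ('g::topological_space \<Rightarrow> ('g, 'a::real_normed_vector) chart) \<Rightarrow>
     ('p::topological_space \<Rightarrow> ('p, 'b::real_normed_vector) chart) \<Rightarrow>
     (('p \<Rightarrow> real) \<Rightarrow> ('p \<Rightarrow> real) \<Rightarrow> ('p \<Rightarrow> real)) \<Rightarrow>
     ('p \<Rightarrow> 'g \<Rightarrow> 'p) \<Rightarrow>
     ('q::topological_space \<Rightarrow> ('q, 'c::real_normed_vector) chart) \<Rightarrow>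
     (('q \<Rightarrow> real) \<Rightarrow> ('q \<Rightarrow> real) \<Rightarrow> ('q \<Rightarrow> real)) \<Rightarrow>
     ('p \<Rightarrow> 'q) \<Rightarrow> bool" where
  "poisson_reduction gmult gunit chG chP brP act chQ brQ \<pi> \<longleftrightarrow>
     smooth_map (prod_charts chP chG) chP (\<lambda>(p, h). act p h) \<and>
     (\<forall>p. act p gunit = p) \<and>
     (\<forall>p h k. act (act p h) k = act p (gmult h k)) \<and>
     (\<forall>E F h p. smooth_fun chP E \<and> smooth_fun chP F \<longrightarrow>
        brP (\<lambda>q. E (act q h)) (\<lambda>q. F (act q h)) p = brP E F (act p h)) \<and>
     surj \<pi> \<and>
     (\<forall>p q. \<pi> p = \<pi> q \<longleftrightarrow> (\<exists>h. q = act p h)) \<and>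
     (\<forall>E. smooth_fun chQ E \<longleftrightarrow> smooth_fun chP (E \<circ> \<pi>)) \<and>
     poisson_structure chQ brQ \<and>
     (\<forall>E F. smooth_fun chQ E \<and> smooth_fun chQ F \<longrightarrow> brP (E \<circ> \<pi>) (F \<circ> \<pi>) = brQ E F \<circ> \<pi>)"


section \<open>Partial derivatives on \<open>\<gg>\<^sup>* \<times> \<gg> \<times> \<gg>\<^sup>*\<close>\<close>

type_synonym 'a dual = "'a \<Rightarrow>\<^sub>L real"
type_synonym 'a reduced = "'a dual \<times> 'a \<times> 'a dual"
type_synonym ('g, 'a) tulczyjew = "'g \<times> 'a reduced"

text \<open>The derivatives with respect to the two dual variables are elements of the bidual, read as
  vectors through \<open>\<gg>\<^sup>*\<^sup>* = \<gg>\<close>.\<close>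

definition d_mu :: "('a::real_normed_vector reduced \<Rightarrow> real) \<Rightarrow> 'a reduced \<Rightarrow> 'a" where
  "d_mu E = (\<lambda>(\<mu>, \<xi>, \<nu>). THE a. \<forall>\<sigma>. frechet_derivative (\<lambda>m. E (m, \<xi>, \<nu>)) (at \<mu>) \<sigma> = blinfun_apply \<sigma> a)"

definition d_xi :: "('a::real_normed_vector reduced \<Rightarrow> real) \<Rightarrow> 'a reduced \<Rightarrow> 'a dual" where
  "d_xi E = (\<lambda>(\<mu>, \<xi>, \<nu>). Blinfun (frechet_derivative (\<lambda>x. E (\<mu>, x, \<nu>)) (at \<xi>)))"

definition d_nu :: "('a::real_normed_vector reduced \<Rightarrow> real) \<Rightarrow> 'a reduced \<Rightarrow> 'a" where
  "d_nu E = (\<lambda>(\<mu>, \<xi>, \<nu>). THE a. \<forall>\<sigma>. frechet_derivative (\<lambda>n. E (\<mu>, \<xi>, n)) (at \<nu>) \<sigma> = blinfun_apply \<sigma> a)"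


section \<open>Lie groups and Tulczyjew's symplectic space\<close>

locale lie_group = group gmult gunit ginv
  for gmult :: "'g::{t2_space, second_countable_topology} \<Rightarrow> 'g \<Rightarrow> 'g" (infixl \<open>\<cdot>\<close> 70)
    and gunit :: 'g and ginv :: "'g \<Rightarrow> 'g" +
  fixes ch :: "'g \<Rightarrow> ('g, 'a::banach) chart"
  assumes manifold: "smooth_manifold ch"
    and smooth_mult: "smooth_map (prod_charts ch ch) ch (\<lambda>(g, h). g \<cdot> h)"
    and smooth_ginv: "smooth_map ch ch ginv"
begin

text \<open>The Lie algebra \<open>\<gg>\<close>, the tangent space at \<open>gunit\<close>, is the model space \<^typ>\<open>'a\<close>. In the next
  definition the conjugation is by the inverse, which makes \<open>lie_bracket\<close> the bracket of right
  invariant vector fields.\<close>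

definition Ad :: "'g \<Rightarrow> 'a \<Rightarrow> 'a" where
  "Ad g = tangent_map ch ch (\<lambda>h. ginv g \<cdot> h \<cdot> g) gunit"

definition one_parameter_subgroup :: "'a \<Rightarrow> (real \<Rightarrow> 'g) \<Rightarrow> bool" where
  "one_parameter_subgroup \<xi> \<gamma> \<longleftrightarrow>
     smooth_map vector_charts ch \<gamma> \<and> (\<forall>s t. \<gamma> (s + t) = \<gamma> s \<cdot> \<gamma> t) \<and>
     tangent_map vector_charts ch \<gamma> 0 1 = \<xi>"

definition lie_exp :: "'a \<Rightarrow> 'g" where
  "lie_exp \<xi> = (THE \<gamma>. one_parameter_subgroup \<xi> \<gamma>) 1"

definition lie_bracket :: "'a \<Rightarrow> 'a \<Rightarrow> 'a" where
  "lie_bracket \<xi> \<eta> = vector_derivative (\<lambda>t. Ad (lie_exp (t *\<^sub>R \<xi>)) \<eta>) (at 0)"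

definition ad_star :: "'a \<Rightarrow> 'a dual \<Rightarrow> 'a dual" where
  "ad_star \<xi> \<mu> = Blinfun (\<lambda>\<eta>. blinfun_apply \<mu> (lie_bracket \<xi> \<eta>))"

definition TR :: "'g \<Rightarrow> 'a \<Rightarrow> 'a" where
  "TR g = tangent_map ch ch (\<lambda>h. h \<cdot> g) gunit"

definition tulczyjew_charts :: "('g, 'a) tulczyjew \<Rightarrow> (('g, 'a) tulczyjew, 'a \<times> 'a reduced) chart" where
  "tulczyjew_charts = prod_charts ch vector_charts"

text \<open>The value at a point of the vector field \<open>X\<close> attached to \<open>(\<xi>2, \<nu>2, \<xi>3, \<nu>3)\<close>.\<close>

fun vfield :: "'a \<times> 'a dual \<times> 'a \<times> 'a dual \<Rightarrow> ('g, 'a) tulczyjew \<Rightarrow> 'a \<times> 'a reduced" where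
  "vfield (\<xi>2, \<nu>2, \<xi>3, \<nu>3) (g, \<mu>, \<xi>, \<nu>) =
     (TR g \<xi>2, \<nu>2 + ad_star \<xi>2 \<mu>, \<xi>3 + lie_bracket \<xi> \<xi>2, \<nu>3 + ad_star \<xi>2 \<nu> - ad_star \<xi> \<nu>2)"

fun Omega_coeff ::
    "('g, 'a) tulczyjew \<Rightarrow> 'a \<times> 'a dual \<times> 'a \<times> 'a dual \<Rightarrow> 'a \<times> 'a dual \<times> 'a \<times> 'a dual \<Rightarrow> real" where
  "Omega_coeff (g, \<mu>, \<xi>, \<nu>) (\<xi>2, \<nu>2, \<xi>3, \<nu>3) (\<xi>2', \<nu>2', \<xi>3', \<nu>3') =
     blinfun_apply \<nu>3 \<xi>2' + blinfun_apply \<nu>2 \<xi>3' - blinfun_apply \<nu>2' \<xi>3 - blinfun_apply \<nu>3' \<xi>2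
     + blinfun_apply \<nu> (lie_bracket \<xi>2 \<xi>2')
     + blinfun_apply \<mu> (lie_bracket \<xi>3 \<xi>2' + lie_bracket \<xi>2 \<xi>3' + lie_bracket \<xi> (lie_bracket \<xi>2 \<xi>2'))"

text \<open>Every tangent vector at \<open>p\<close> is \<open>vfield a p\<close> for exactly one \<open>a\<close>.\<close>

definition Omega :: "('g, 'a) tulczyjew \<Rightarrow> 'a \<times> 'a reduced \<Rightarrow> 'a \<times> 'a reduced \<Rightarrow> real" where
  "Omega p u v =
     Omega_coeff p (the_inv (\<lambda>a. vfield a p) u) (the_inv (\<lambda>a. vfield a p) v)"

definition hamiltonian_vf :: "(('g, 'a) tulczyjew \<Rightarrow> real) \<Rightarrow> ('g, 'a) tulczyjew \<Rightarrow> 'a \<times> 'a reduced" where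
  "hamiltonian_vf E p =
     (THE u. \<forall>v. Omega p u v = - tangent_map tulczyjew_charts vector_charts E p v)"

definition poisson_bracket ::
    "(('g, 'a) tulczyjew \<Rightarrow> real) \<Rightarrow> (('g, 'a) tulczyjew \<Rightarrow> real) \<Rightarrow> ('g, 'a) tulczyjew \<Rightarrow> real" where
  "poisson_bracket E F p = Omega p (hamiltonian_vf E p) (hamiltonian_vf F p)"

text \<open>Right translation of the factor \<open>G\<close>; its invariant functions are those not depending on \<open>g\<close>.\<close>

fun right_action :: "('g, 'a) tulczyjew \<Rightarrow> 'g \<Rightarrow> ('g, 'a) tulczyjew" where
  "right_action (g, w) h = (g \<cdot> h, w)"

definition reduced_bracket ::
    "('a reduced \<Rightarrow> real) \<Rightarrow> ('a reduced \<Rightarrow> real) \<Rightarrow> 'a reduced \<Rightarrow> real" where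
  "reduced_bracket E F = (\<lambda>(\<mu>, \<xi>, \<nu>).
     blinfun_apply (d_xi F (\<mu>, \<xi>, \<nu>)) (d_mu E (\<mu>, \<xi>, \<nu>))
     - blinfun_apply (d_xi E (\<mu>, \<xi>, \<nu>)) (d_mu F (\<mu>, \<xi>, \<nu>))
     + blinfun_apply \<nu> (lie_bracket (d_nu E (\<mu>, \<xi>, \<nu>)) (d_nu F (\<mu>, \<xi>, \<nu>))))"

end

end

(*
In the frame of the vector fields X the form Omega is visibly nondegenerate, and i_X Omega = -dE
can be solved in closed form; this uses only that the Lie bracket is bilinear and alternating and
satisfies the Jacobi identity. Substituting two solutions gives, for
arbitrary E and F on the unreduced space,
  {E, F} = <d_g F, dE/dnu> - <d_g E, dF/dnu> + reduced bracket of E(g, .) and F(g, .),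
where d_g is the derivative along right invariant fields. This is equivariant under right
translation, and the first two terms vanish for functions that do not depend on g.

The bracket is defined through the exponential map, so one-parameter subgroups must exist and be
unique: they are the integral curves of left invariant fields. Ad(exp(t xi)) fixes xi, which makes
the bracket alternating; Ad(g) preserves the bracket, and differentiating this along
g = exp(t zeta) is the Jacobi identity.

For the reduced bracket, {E, F} = dF(P E), and the derivative of {F, H} in the direction v is
D^2 H(v, P F) - D^2 F(v, P H) + <v_nu, [dF/dnu, dH/dnu]>. In the cyclic sum the second derivatives
cancel by symmetry and the remaining terms by the Jacobi identity of the Lie algebra.
*)
theory Submission
  imports Defs
begin

subsection \<open>Finite-dimensional normed spaces\<close>

text \<open>The model space is an arbitrary finite-dimensional Banach space, and the coordinate
  spaces of the phase space are built from it by duals and products. The analysis therefore rests on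
  one device: a finite resolution of the identity, x = sum c_i(x) e_i with continuous functionals
  c_i. It reduces the chain rule, the bidual and the smoothness of pairings and brackets to finite
  sums of scalar functions.

  \<open>lie_exp\<close> and \<open>hamiltonian_vf\<close> are definite descriptions, so existence
  and uniqueness must precede every computation with them. For the exponential the differential
  equation is posed in the single chart at the unit and solved for short times only; the passage to
  all times is algebraic, by repeated squaring.

  Although the bracket is defined along the curve exp(t xi), only the velocity of this curve at 0
  matters: the bracket is the mixed second derivative of conjugation at the unit. This gives
  linearity in the first variable, hence boundedness and the product rule behind the Jacobi
  identity.\<close>

lemma independent_coefficients_bounded:
  fixes B :: "'a::real_normed_vector set"
  assumes "finite B" "independent B"
  shows "\<exists>C. \<forall>u. \<forall>b\<in>B. \<bar>u b\<bar> \<le> C * norm (\<Sum>b\<in>B. u b *\<^sub>R b)"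
  using assms
proof (induction B rule: finite_induct)
  case empty
  show ?case by simp
next
  case (insert a B)
  have indB: "independent B" and aB: "a \<notin> span B"
    using insert by (simp_all add: independent_insert)
  obtain C where C: "\<And>u b. b \<in> B \<Longrightarrow> \<bar>u b\<bar> \<le> C * norm (\<Sum>b\<in>B. u b *\<^sub>R b)"
    using insert.IH[OF indB] by blast
  \<comment> \<open>A positive distance from \<open>a\<close> amounts to closedness of the span:
    combinations converging to \<open>a\<close> have Cauchy coefficients by the induction
    hypothesis, and the limits of these would write \<open>a\<close> in terms of
    \<open>B\<close>.\<close>
  have "\<exists>d>0. \<forall>y\<in>span B. d \<le> norm (a - y)"
  proof (rule ccontr)
    assume "\<not> ?thesis"
    then have "\<forall>n::nat. \<exists>y\<in>span B. norm (a - y) < 1 / Suc n"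
      by (metis not_less of_nat_0_less_iff zero_less_Suc zero_less_divide_1_iff)
    then have "\<forall>n::nat. \<exists>u. norm (a - (\<Sum>b\<in>B. u b *\<^sub>R b)) < 1 / Suc n"
      unfolding span_finite[OF insert.hyps(1)] by auto
    then obtain u where u: "\<And>n::nat. norm (a - (\<Sum>b\<in>B. u n b *\<^sub>R b)) < 1 / Suc n"
      by metis
    define y where "y n = (\<Sum>b\<in>B. u n b *\<^sub>R b)" for n
    have "(\<lambda>n. a - y n) \<longlonglongrightarrow> 0"
    proof (rule Lim_null_comparison[OF _ LIMSEQ_inverse_real_of_nat])
      show "\<forall>\<^sub>F n in sequentially. norm (a - y n) \<le> inverse (real (Suc n))"
        by (rule always_eventually) (use less_imp_le[OF u] in \<open>simp add: y_def inverse_eq_divide\<close>)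
    qed
    from tendsto_diff[OF tendsto_const[of a] this] have ylim: "y \<longlonglongrightarrow> a" by simp
    then have Cy: "Cauchy y" by (rule LIMSEQ_imp_Cauchy)
    have conv: "convergent (\<lambda>n. u n b)" if b: "b \<in> B" for b
    proof (rule Cauchy_convergent, rule metric_CauchyI)
      fix e :: real assume e: "0 < e"
      \<comment> \<open>The sign of \<open>C\<close> is unknown; \<open>K\<close> is a positive
        majorant by which \<open>e\<close> can be divided.\<close>
      define K where "K = \<bar>C\<bar> + 1"
      have K: "K > 0" unfolding K_def by simp
      then obtain M where M: "\<And>m n. m \<ge> M \<Longrightarrow> n \<ge> M \<Longrightarrow> dist (y m) (y n) < e / K"
        using metric_CauchyD[OF Cy, of "e / K"] e by auto
      have "dist (u m b) (u n b) < e" if "m \<ge> M" "n \<ge> M" for m n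
      proof -
        have "\<bar>u m b - u n b\<bar> \<le> C * norm (\<Sum>b\<in>B. (u m b - u n b) *\<^sub>R b)"
          using C[OF b, of "\<lambda>b. u m b - u n b"] .
        also have "(\<Sum>b\<in>B. (u m b - u n b) *\<^sub>R b) = y m - y n"
          by (simp add: y_def sum_subtractf scaleR_diff_left)
        also have "C * norm (y m - y n) \<le> K * norm (y m - y n)"
          unfolding K_def by (intro mult_right_mono) auto
        also have "\<dots> < K * (e / K)"
          using M[OF that] K by (intro mult_strict_left_mono) (auto simp: dist_norm)
        finally show ?thesis using K by (simp add: dist_real_def)
      qed
      then show "\<exists>M. \<forall>m\<ge>M. \<forall>n\<ge>M. dist (u m b) (u n b) < e" by blast
    qed
    then obtain l where l: "\<And>b. b \<in> B \<Longrightarrow> (\<lambda>n. u n b) \<longlonglongrightarrow> l b"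
      unfolding convergent_def by metis
    have "y \<longlonglongrightarrow> (\<Sum>b\<in>B. l b *\<^sub>R b)"
      unfolding y_def by (intro tendsto_sum tendsto_scaleR l tendsto_const)
    with ylim have "a = (\<Sum>b\<in>B. l b *\<^sub>R b)" by (rule LIMSEQ_unique)
    moreover have "(\<Sum>b\<in>B. l b *\<^sub>R b) \<in> span B"
      by (intro span_sum span_scale span_base)
    ultimately show False using aB by simp
  qed
  then obtain d where d: "d > 0" "\<And>y. y \<in> span B \<Longrightarrow> d \<le> norm (a - y)" by blast
  \<comment> \<open>The factor \<open>1 / d\<close> controls the coefficient of \<open>a\<close>,
    since \<open>v\<close> divided by that coefficient is \<open>a\<close> minus an element of the
    span. \<open>K\<close> controls the others: removing the component along \<open>a\<close> costs
    a factor \<open>1 + norm a / d\<close>, and the induction hypothesis costs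
    \<open>\<bar>C\<bar>\<close>.\<close>
  define K where "K = \<bar>C\<bar> * (1 + norm a / d)"
  have *: "\<bar>u b\<bar> \<le> max (1 / d) K * norm (\<Sum>b\<in>insert a B. u b *\<^sub>R b)" if b: "b \<in> insert a B" for u b
  proof -
    define w where "w = (\<Sum>b\<in>B. u b *\<^sub>R b)"
    define v where "v = (\<Sum>b\<in>insert a B. u b *\<^sub>R b)"
    have v: "v = u a *\<^sub>R a + w" unfolding v_def w_def using insert.hyps by simp
    have wB: "w \<in> span B" unfolding w_def by (intro span_sum span_scale span_base)
    have ua: "\<bar>u a\<bar> \<le> (1 / d) * norm v"
    proof (cases "u a = 0")
      case False
      have "d \<le> norm (a - (- (1 / u a)) *\<^sub>R w)" by (intro d span_scale wB)
      also have "a - (- (1 / u a)) *\<^sub>R w = (1 / u a) *\<^sub>R v"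
        using False by (simp add: v scaleR_add_right)
      also have "norm \<dots> = norm v / \<bar>u a\<bar>" by simp
      finally show ?thesis using False d(1) by (simp add: field_simps)
    qed (use d(1) in simp)
    have "w = v - u a *\<^sub>R a" by (simp add: v)
    then have "norm w \<le> norm v + \<bar>u a\<bar> * norm a"
      using norm_triangle_ineq4[of v "u a *\<^sub>R a"] by simp
    also have "\<dots> \<le> norm v + (1 / d) * norm v * norm a"
      using ua by (intro add_left_mono mult_right_mono) auto
    finally have nw: "norm w \<le> (1 + norm a / d) * norm v" by (simp add: algebra_simps)
    show ?thesis
    proof (cases "b = a")
      case True
      then show ?thesis using ua mult_right_mono[OF max.cobounded1[of "1 / d" K], of "norm v"]
        by (simp add: v_def)
    next
      case False
      then have "\<bar>u b\<bar> \<le> C * norm w" using b C[of b u] by (simp add: w_def)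
      also have "\<dots> \<le> \<bar>C\<bar> * norm w" by (intro mult_right_mono) auto
      also have "\<dots> \<le> \<bar>C\<bar> * ((1 + norm a / d) * norm v)" using nw by (intro mult_left_mono) auto
      also have "\<dots> = K * norm v" by (simp add: K_def)
      also have "\<dots> \<le> max (1 / d) K * norm v" by (intro mult_right_mono) auto
      finally show ?thesis by (simp add: v_def)
    qed
  qed
  then show ?case by blast
qed

text \<open>A resolution of the identity by continuous functionals. Products are obtained by
  concatenating two such families, duals by exchanging vectors and functionals.\<close>

definition finite_dimensional :: "'a::real_normed_vector itself \<Rightarrow> bool" where
  "finite_dimensional _ \<longleftrightarrow>
     (\<exists>(n::nat) (e :: nat \<Rightarrow> 'a) (c :: nat \<Rightarrow> 'a \<Rightarrow>\<^sub>L real). \<forall>x. x = (\<Sum>i<n. c i x *\<^sub>R e i))"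

lemma finite_dimensionalI:
  assumes "\<And>x::'a::real_normed_vector. x = (\<Sum>i<n::nat. blinfun_apply (c i) x *\<^sub>R e i)"
  shows "finite_dimensional TYPE('a)"
  using assms unfolding finite_dimensional_def by blast

lemma finite_dimensionalE:
  assumes "finite_dimensional TYPE('a)"
  obtains n :: nat and e :: "nat \<Rightarrow> 'a::real_normed_vector"
    and c :: "nat \<Rightarrow> 'a \<Rightarrow>\<^sub>L real"
    where "\<And>x. (\<Sum>i<n. blinfun_apply (c i) x *\<^sub>R e i) = x"
  using assms unfolding finite_dimensional_def by metis

text \<open>Coordinates with respect to a maximal independent subset are continuous by the
  coefficient bound. This links the spanning set in \<open>smooth_manifold\<close> to the
  functionals used everywhere else.\<close>

lemma finite_dimensional_span:
  assumes "finite B" "span B = (UNIV :: 'a::real_normed_vector set)"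
  shows "finite_dimensional TYPE('a)"
proof -
  obtain A where A: "A \<subseteq> B" "independent A" "B \<subseteq> span A"
    using maximal_independent_subset[of B] by blast
  have finA: "finite A" using A(1) assms(1) finite_subset by blast
  have spA: "span A = UNIV"
    using A(3) assms(2) by (metis UNIV_I span_minimal subspace_span subset_antisym top_greatest)
  obtain C where C: "\<And>u b. b \<in> A \<Longrightarrow> \<bar>u b\<bar> \<le> C * norm (\<Sum>b\<in>A. u b *\<^sub>R b)"
    using independent_coefficients_bounded[OF finA A(2)] by blast
  have rep: "(\<Sum>b\<in>A. representation A x b *\<^sub>R b) = x" for x
    by (rule sum_representation_eq) (use A(2) spA finA in auto)
  have bl: "bounded_linear (\<lambda>x. representation A x b)" if "b \<in> A" for b
  proof (rule bounded_linear_intro[where K = C])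
    show "norm (representation A x b) \<le> norm x * C" for x
      using C[OF that, of "representation A x"] by (simp add: rep mult.commute)
  qed (use A(2) spA in \<open>auto simp: representation_add representation_scale\<close>)
  obtain h where h: "bij_betw h {..<card A} A"
    using ex_bij_betw_nat_finite[OF finA] by (metis atLeast0LessThan)
  show ?thesis
  proof (rule finite_dimensionalI)
    fix x
    have "x = (\<Sum>i<card A. representation A x (h i) *\<^sub>R h i)"
      using sum.reindex_bij_betw[OF h, of "\<lambda>b. representation A x b *\<^sub>R b"] rep[of x] by simp
    also have "\<dots> = (\<Sum>i<card A. blinfun_apply (Blinfun (\<lambda>x. representation A x (h i))) x *\<^sub>R h i)"
      using h by (intro sum.cong refl) (auto simp: bounded_linear_Blinfun_apply bl bij_betwE)
    finally show "x = \<dots>" .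
  qed
qed

lemma finite_dimensional_real: "finite_dimensional TYPE(real)"
  by (rule finite_dimensionalI[where n = 1 and c = "\<lambda>_. id_blinfun" and e = "\<lambda>_. 1"]) simp

lemma finite_dimensional_prod:
  assumes "finite_dimensional TYPE('a)" and "finite_dimensional TYPE('b)"
  shows "finite_dimensional TYPE('a::real_normed_vector \<times> 'b::real_normed_vector)"
proof -
  obtain n :: nat and e and c :: "nat \<Rightarrow> 'a \<Rightarrow>\<^sub>L real"
    where a: "\<And>x. (\<Sum>i<n. c i x *\<^sub>R e i) = x"
    by (rule finite_dimensionalE[OF assms(1)]) blast
  obtain m :: nat and e' and c' :: "nat \<Rightarrow> 'b \<Rightarrow>\<^sub>L real"
    where b: "\<And>x. (\<Sum>i<m. c' i x *\<^sub>R e' i) = x"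
    by (rule finite_dimensionalE[OF assms(2)]) blast
  show ?thesis
  proof (rule finite_dimensionalI)
    fix x :: "'a \<times> 'b"
    let ?c = "\<lambda>i. if i < n then c i o\<^sub>L fst_blinfun else c' (i - n) o\<^sub>L snd_blinfun"
    let ?e = "\<lambda>i. if i < n then (e i, 0) else (0, e' (i - n))"
    have split: "(\<Sum>i<n + k. f i) = (\<Sum>i<n. f i) + (\<Sum>i<k. f (n + i))"
      for k and f :: "nat \<Rightarrow> 'a \<times> 'b"
      by (induction k) (auto simp: add.assoc)
    have "(\<Sum>i<n+m. ?c i x *\<^sub>R ?e i)
        = (\<Sum>i<n. c i (fst x) *\<^sub>R (e i, 0)) + (\<Sum>i<m. c' i (snd x) *\<^sub>R (0, e' i))"
      unfolding split by (simp add: fst_blinfun.rep_eq snd_blinfun.rep_eq)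
    also have "\<dots> = x"
      by (rule prod_eqI) (simp_all add: fst_sum snd_sum a b)
    finally show "x = (\<Sum>i<n+m. ?c i x *\<^sub>R ?e i)" ..
  qed
qed

text \<open>The roles are exchanged: the \<open>c i\<close> become the vectors, and evaluation at
  \<open>e i\<close> gives the coordinates.\<close>

lemma finite_dimensional_dual:
  assumes "finite_dimensional TYPE('a)"
  shows "finite_dimensional TYPE('a::real_normed_vector \<Rightarrow>\<^sub>L real)"
proof -
  obtain n :: nat and e and c :: "nat \<Rightarrow> 'a \<Rightarrow>\<^sub>L real"
    where a: "\<And>x. (\<Sum>i<n. c i x *\<^sub>R e i) = x"
    by (rule finite_dimensionalE[OF assms(1)]) blast
  have bl: "bounded_linear (\<lambda>s::'a \<Rightarrow>\<^sub>L real. s (e i))" for i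
    by (rule blinfun.bounded_linear_left)
  show ?thesis
  proof (rule finite_dimensionalI)
    fix s :: "'a \<Rightarrow>\<^sub>L real"
    show "s = (\<Sum>i<n. Blinfun (\<lambda>s. blinfun_apply s (e i)) s *\<^sub>R c i)"
    proof (rule blinfun_eqI)
      fix x
      have "s x = s (\<Sum>i<n. c i x *\<^sub>R e i)" by (simp add: a)
      also have "\<dots> = (\<Sum>i<n. Blinfun (\<lambda>s. blinfun_apply s (e i)) s *\<^sub>R c i) x"
        by (simp add: blinfun.sum_right blinfun.sum_left blinfun.scaleR_left blinfun.scaleR_right
            bounded_linear_Blinfun_apply[OF bl] mult.commute)
      finally show "s x = (\<Sum>i<n. Blinfun (\<lambda>s. blinfun_apply s (e i)) s *\<^sub>R c i) x" .
    qed
  qed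
qed

lemma finite_dimensional_bounded_linear:
  fixes l :: "'a::real_normed_vector \<Rightarrow> 'b::real_normed_vector"
  assumes fd: "finite_dimensional TYPE('a)" and l: "linear l"
  shows "bounded_linear l"
proof -
  obtain n :: nat and e and c :: "nat \<Rightarrow> 'a \<Rightarrow>\<^sub>L real"
    where ec: "\<And>x. (\<Sum>i<n. c i x *\<^sub>R e i) = x"
    by (rule finite_dimensionalE[OF fd]) blast
  have "l x = (\<Sum>i<n. c i x *\<^sub>R l (e i))" for x
    using linear_sum[OF l, of "\<lambda>i. c i x *\<^sub>R e i" "{..<n}"] by (simp add: ec linear_cmul[OF l])
  then have "l = (\<lambda>x. \<Sum>i<n. c i x *\<^sub>R l (e i))" by (rule ext)
  moreover have "bounded_linear (\<lambda>x. \<Sum>i<n. c i x *\<^sub>R l (e i))"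
    by (intro bounded_linear_sum bounded_linear_scaleR_const blinfun.bounded_linear_right)
  ultimately show ?thesis by simp
qed

text \<open>Expanding the first argument leaves finitely many linear maps \<open>b (e i)\<close>,
  each bounded. It is meant for the Lie bracket, which is first known to be linear in each variable
  only.\<close>

lemma finite_dimensional_bounded_bilinear:
  fixes b :: "'a::real_normed_vector \<Rightarrow> 'b::real_normed_vector \<Rightarrow> 'c::real_normed_vector"
  assumes fda: "finite_dimensional TYPE('a)" and fdb: "finite_dimensional TYPE('b)"
    and l: "\<And>y. linear (\<lambda>x. b x y)" and r: "\<And>x. linear (b x)"
  shows "bounded_bilinear b"
proof -
  obtain n :: nat and e and c :: "nat \<Rightarrow> 'a \<Rightarrow>\<^sub>L real"
    where ec: "\<And>x. (\<Sum>i<n. c i x *\<^sub>R e i) = x"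
    by (rule finite_dimensionalE[OF fda]) blast
  have exp: "b x y = (\<Sum>i<n. c i x *\<^sub>R b (e i) y)" for x y
    using linear_sum[OF l[of y], of "\<lambda>i. c i x *\<^sub>R e i" "{..<n}"] by (simp add: ec linear_cmul[OF l])
  have "\<exists>K. \<forall>y. norm (b x y) \<le> norm y * K" for x
    using bounded_linear.bounded[OF finite_dimensional_bounded_linear[OF fdb r]] .
  then have "\<forall>x. \<exists>K. \<forall>y. norm (b x y) \<le> norm y * K" by (rule allI)
  from choice[OF this] obtain K where K: "\<forall>x y. norm (b x y) \<le> norm y * K x" ..
  show ?thesis
  proof
    show "\<exists>M. \<forall>x y. norm (b x y) \<le> norm x * norm y * M"
    proof (intro exI allI)
      fix x y
      have "norm (\<Sum>i<n. c i x *\<^sub>R b (e i) y) \<le> (\<Sum>i<n. norm x * norm y * (norm (c i) * \<bar>K (e i)\<bar>))"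
      proof (rule sum_norm_le)
        fix i
        have 1: "norm y * K (e i) \<le> norm y * \<bar>K (e i)\<bar>" by (intro mult_left_mono) auto
        have "\<bar>c i x\<bar> * norm (b (e i) y) \<le> (norm (c i) * norm x) * (norm y * \<bar>K (e i)\<bar>)"
          using norm_blinfun[of "c i" x] order_trans[OF K[rule_format] 1] by (intro mult_mono) auto
        then show "norm (c i x *\<^sub>R b (e i) y) \<le> norm x * norm y * (norm (c i) * \<bar>K (e i)\<bar>)"
          by (simp add: mult_ac)
      qed
      then show "norm (b x y) \<le> norm x * norm y * (\<Sum>i<n. norm (c i) * \<bar>K (e i)\<bar>)"
        by (simp add: sum_distrib_left exp[of x y])
    qed
  qed (simp_all only: linear_add[OF l] linear_add[OF r] linear_cmul[OF l] linear_cmul[OF r])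
qed

subsection \<open>Calculus of smooth functions\<close>

text \<open>On an open set the derivatives at its points are determined by the values on the set, so
  the equality passes to every order.\<close>

lemma higher_differentiable_on_cong:
  assumes "open S" "\<And>x. x \<in> S \<Longrightarrow> f x = g x" "higher_differentiable_on S f n"
  shows "higher_differentiable_on S g n"
  using assms(2,3)
proof (induction n arbitrary: f g)
  case 0
  show ?case
    using continuous_on_eq[OF 0(2)[unfolded higher_differentiable_on.simps(1)] 0(1)] by simp
next
  case (Suc n)
  have df: "f differentiable at x" if "x \<in> S" for x
    using Suc.prems(2) that unfolding higher_differentiable_on.simps by blast
  have dg: "(g has_derivative frechet_derivative f (at x)) (at x)" if "x \<in> S" for x
    by (rule has_derivative_transform_within_open[OF df[OF that, unfolded frechet_derivative_works]
          assms(1) that Suc.prems(1)])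
  have eq: "frechet_derivative f (at x) v = frechet_derivative g (at x) v" if "x \<in> S" for x v
    by (simp only: frechet_derivative_at[OF dg[OF that], symmetric])
  have "higher_differentiable_on S (\<lambda>x. frechet_derivative f (at x) v) n" for v
    using Suc.prems(2) by simp
  then have "higher_differentiable_on S (\<lambda>x. frechet_derivative g (at x) v) n" for v
    by (rule Suc.IH[of "\<lambda>x. frechet_derivative f (at x) v", rotated]) (rule eq)
  with dg show ?case
    unfolding higher_differentiable_on.simps differentiable_def by blast
qed

lemma higher_differentiable_on_SucD:
  "higher_differentiable_on S f (Suc n) \<Longrightarrow> higher_differentiable_on S f n"
proof (induction n arbitrary: f)
  case 0
  then have "f differentiable at x" if "x \<in> S" for x
    using that unfolding higher_differentiable_on.simps by blast
  then show ?case
    by (simp add: continuous_at_imp_continuous_on differentiable_imp_continuous_within)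
next
  case (Suc n)
  show ?case
    using Suc.prems unfolding higher_differentiable_on.simps(2)[of S f n]
      higher_differentiable_on.simps(2)[of S f "Suc n"]
    by (blast intro: Suc.IH)
qed

lemma higher_differentiable_on_subset:
  "higher_differentiable_on T f n \<Longrightarrow> S \<subseteq> T \<Longrightarrow> higher_differentiable_on S f n"
  by (induction n arbitrary: f) (auto intro: continuous_on_subset)

lemma higher_differentiable_on_local:
  assumes "\<And>x. x \<in> S \<Longrightarrow> \<exists>U. open U \<and> x \<in> U \<and> higher_differentiable_on U f n"
  shows "higher_differentiable_on S f n"
  using assms
proof (induction n arbitrary: f)
  case 0
  have "continuous (at x) f" if "x \<in> S" for x
    using 0[OF that] continuous_on_eq_continuous_at by auto
  then show ?case by (auto intro!: continuous_at_imp_continuous_on)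
next
  case (Suc n)
  show ?case unfolding higher_differentiable_on.simps
  proof (intro conjI allI ballI)
    show "f differentiable at x" if "x \<in> S" for x
      using Suc.prems[OF that] by auto
    show "higher_differentiable_on S (\<lambda>x. frechet_derivative f (at x) v) n" for v
      by (rule Suc.IH) (use Suc.prems in fastforce)
  qed
qed

lemma higher_differentiable_on_const: "higher_differentiable_on S (\<lambda>_. c) n"
  by (induction n arbitrary: c) auto

lemma higher_differentiable_on_add:
  assumes "open S" "higher_differentiable_on S f n" "higher_differentiable_on S g n"
  shows "higher_differentiable_on S (\<lambda>x. f x + g x) n"
  using assms(2,3)
proof (induction n arbitrary: f g)
  case 0
  then show ?case by (auto intro: continuous_intros)
next
  case (Suc n)
  have eq: "frechet_derivative f (at x) v + frechet_derivative g (at x) v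
      = frechet_derivative (\<lambda>x. f x + g x) (at x) v" if "x \<in> S" for x v
    using Suc.prems that
    by (subst frechet_derivative_at[OF has_derivative_add, symmetric])
       (auto simp: frechet_derivative_works)
  show ?case unfolding higher_differentiable_on.simps
  proof (intro conjI allI ballI)
    show "(\<lambda>x. f x + g x) differentiable at x" if "x \<in> S" for x
      using Suc.prems that by (auto intro!: differentiable_add)
    show "higher_differentiable_on S (\<lambda>x. frechet_derivative (\<lambda>x. f x + g x) (at x) v) n" for v
      by (rule higher_differentiable_on_cong[OF assms(1) eq Suc.IH]) (use Suc.prems in simp_all)
  qed
qed

lemma higher_differentiable_on_sum:
  assumes "open S" "\<And>i. i \<in> I \<Longrightarrow> higher_differentiable_on S (f i) n"
  shows "higher_differentiable_on S (\<lambda>x. \<Sum>i\<in>I. f i x) n"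
  using assms(2)
  by (induction I rule: infinite_finite_induct)
     (auto intro: higher_differentiable_on_const higher_differentiable_on_add[OF assms(1)])

lemma higher_differentiable_on_bounded_linear:
  assumes "open S" "bounded_linear l" "higher_differentiable_on S f n"
  shows "higher_differentiable_on S (\<lambda>x. l (f x)) n"
  using assms(3)
proof (induction n arbitrary: f)
  case 0
  then show ?case
    by (auto intro: bounded_linear.continuous_on[OF assms(2)])
next
  case (Suc n)
  have d: "((\<lambda>x. l (f x)) has_derivative (\<lambda>v. l (frechet_derivative f (at x) v))) (at x)"
    if "x \<in> S" for x
    using Suc.prems that
    by (intro bounded_linear.has_derivative[OF assms(2)]) (auto simp: frechet_derivative_works)
  show ?case unfolding higher_differentiable_on.simps
  proof (intro conjI allI ballI)
    show "(\<lambda>x. l (f x)) differentiable at x" if "x \<in> S" for x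
      using d[OF that] by (auto simp: differentiable_def)
    show "higher_differentiable_on S (\<lambda>x. frechet_derivative (\<lambda>x. l (f x)) (at x) v) n" for v
      by (rule higher_differentiable_on_cong[OF assms(1) _ Suc.IH])
         (use Suc.prems frechet_derivative_at[OF d, symmetric] in auto)
  qed
qed

lemma higher_differentiable_on_ident: "higher_differentiable_on S (\<lambda>x. x) n"
  by (cases n) (auto intro: higher_differentiable_on_const)

lemma higher_differentiable_on_scaleR:
  fixes f :: "'a::real_normed_vector \<Rightarrow> real" and g :: "'a \<Rightarrow> 'b::real_normed_vector"
  assumes "open S" "higher_differentiable_on S f n" "higher_differentiable_on S g n"
  shows "higher_differentiable_on S (\<lambda>x. f x *\<^sub>R g x) n"
  using assms(2,3)
proof (induction n arbitrary: f g)
  case 0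
  then show ?case by (auto intro: continuous_intros)
next
  case (Suc n)
  have d: "((\<lambda>x. f x *\<^sub>R g x) has_derivative
      (\<lambda>v. f x *\<^sub>R frechet_derivative g (at x) v + frechet_derivative f (at x) v *\<^sub>R g x)) (at x)"
    if "x \<in> S" for x
    using Suc.prems that
    by (intro has_derivative_scaleR) (auto simp: frechet_derivative_works)
  note IH = Suc.IH and hd = Suc.prems Suc.prems[THEN higher_differentiable_on_SucD]
  show ?case unfolding higher_differentiable_on.simps
  proof (intro conjI allI ballI)
    show "(\<lambda>x. f x *\<^sub>R g x) differentiable at x" if "x \<in> S" for x
      using d[OF that] by (auto simp: differentiable_def)
    show "higher_differentiable_on S (\<lambda>x. frechet_derivative (\<lambda>x. f x *\<^sub>R g x) (at x) v) n" for v
    proof -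
      have "higher_differentiable_on S (\<lambda>x. f x *\<^sub>R frechet_derivative g (at x) v
          + frechet_derivative f (at x) v *\<^sub>R g x) n"
        using hd by (intro higher_differentiable_on_add[OF assms(1)] IH) auto
      then show ?thesis
        by (rule higher_differentiable_on_cong[OF assms(1), rotated])
           (simp add: frechet_derivative_at[OF d, symmetric])
    qed
  qed
qed

text \<open>The derivative of a composite is a function of two variables; finite dimension of the middle
  space turns it into a finite sum of products of functions of one variable.\<close>

lemma higher_differentiable_on_compose:
  fixes f :: "'a::real_normed_vector \<Rightarrow> 'b::real_normed_vector"
    and g :: "'b \<Rightarrow> 'c::real_normed_vector"
  assumes fd: "finite_dimensional TYPE('b)" and "open S"
    and "higher_differentiable_on S f n" "higher_differentiable_on T g n" "f ` S \<subseteq> T"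
  shows "higher_differentiable_on S (\<lambda>x. g (f x)) n"
  using assms(3-)
proof (induction n arbitrary: g)
  case 0
  then show ?case by (auto intro: continuous_on_compose2)
next
  case (Suc n)
  obtain m :: nat and e and c :: "nat \<Rightarrow> 'b \<Rightarrow>\<^sub>L real"
    where ec: "\<And>x. (\<Sum>i<m. c i x *\<^sub>R e i) = x"
    by (rule finite_dimensionalE[OF fd]) blast
  have df: "(f has_derivative frechet_derivative f (at x)) (at x)" if "x \<in> S" for x
    using Suc.prems that by (auto simp: frechet_derivative_works)
  have dg: "(g has_derivative frechet_derivative g (at (f x))) (at (f x))" if "x \<in> S" for x
    using Suc.prems that by (auto simp: frechet_derivative_works)
  have d: "((\<lambda>x. g (f x)) has_derivative
      (\<lambda>v. frechet_derivative g (at (f x)) (frechet_derivative f (at x) v))) (at x)"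
    if "x \<in> S" for x
    using diff_chain_at[OF df dg, OF that that] by (simp add: o_def)
  have eq: "(\<Sum>i<m. c i (frechet_derivative f (at x) v) *\<^sub>R frechet_derivative g (at (f x)) (e i))
     = frechet_derivative (\<lambda>x. g (f x)) (at x) v" if "x \<in> S" for x v
  proof -
    have lin: "linear (frechet_derivative g (at (f x)))"
      using dg[OF that] by (rule has_derivative_linear)
    have "frechet_derivative (\<lambda>x. g (f x)) (at x) v
      = frechet_derivative g (at (f x)) (\<Sum>i<m. c i (frechet_derivative f (at x) v) *\<^sub>R e i)"
      by (simp add: ec frechet_derivative_at[OF d[OF that], symmetric])
    also have "\<dots> = (\<Sum>i<m. c i (frechet_derivative f (at x) v) *\<^sub>R frechet_derivative g (at (f x)) (e i))"
      by (simp add: linear_sum[OF lin] linear_cmul[OF lin])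
    finally show ?thesis ..
  qed
  show ?case unfolding higher_differentiable_on.simps
  proof (intro conjI allI ballI)
    show "(\<lambda>x. g (f x)) differentiable at x" if "x \<in> S" for x
      using d[OF that] by (auto simp: differentiable_def)
    show "higher_differentiable_on S (\<lambda>x. frechet_derivative (\<lambda>x. g (f x)) (at x) v) n" for v
    proof -
      have "higher_differentiable_on S (\<lambda>x. frechet_derivative g (at (f x)) (e i)) n" for i
        using Suc.prems higher_differentiable_on_SucD[OF Suc.prems(1)] by (intro Suc.IH) auto
      then have "higher_differentiable_on S (\<lambda>x. \<Sum>i<m. c i (frechet_derivative f (at x) v) *\<^sub>R
          frechet_derivative g (at (f x)) (e i)) n"
        using Suc.prems(1)
        by (intro higher_differentiable_on_sum higher_differentiable_on_scaleR assms(2)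
            higher_differentiable_on_bounded_linear[OF assms(2) blinfun.bounded_linear_right]) auto
      then show ?thesis
        by (rule higher_differentiable_on_cong[OF assms(2), rotated]) (rule eq)
    qed
  qed
qed

section \<open>Closure properties of the class of smooth functions\<close>

lemma smooth_on_cong:
  "smooth_on S f \<Longrightarrow> open S \<Longrightarrow> (\<And>x. x \<in> S \<Longrightarrow> f x = g x) \<Longrightarrow> smooth_on S g"
  unfolding smooth_on_def by (blast intro: higher_differentiable_on_cong)

lemma smooth_on_subset: "smooth_on T f \<Longrightarrow> S \<subseteq> T \<Longrightarrow> smooth_on S f"
  unfolding smooth_on_def by (blast intro: higher_differentiable_on_subset)

lemma smooth_on_local:
  "(\<And>x. x \<in> S \<Longrightarrow> \<exists>U. open U \<and> x \<in> U \<and> smooth_on U f) \<Longrightarrow> smooth_on S f"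
  unfolding smooth_on_def by (rule allI, rule higher_differentiable_on_local) blast

lemma smooth_on_continuous: "smooth_on S f \<Longrightarrow> continuous_on S f"
  unfolding smooth_on_def by (metis higher_differentiable_on.simps(1))

lemma smooth_on_has_derivative:
  "smooth_on S f \<Longrightarrow> x \<in> S \<Longrightarrow> (f has_derivative frechet_derivative f (at x)) (at x)"
  unfolding smooth_on_def frechet_derivative_works[symmetric]
  by (metis higher_differentiable_on.simps(2))

lemma smooth_on_frechet_derivative:
  "smooth_on S f \<Longrightarrow> smooth_on S (\<lambda>x. frechet_derivative f (at x) v)"
  unfolding smooth_on_def by (metis higher_differentiable_on.simps(2))

lemma smooth_on_const: "smooth_on S (\<lambda>_. c)"
  by (simp add: smooth_on_def higher_differentiable_on_const)

lemma smooth_on_ident: "smooth_on S (\<lambda>x. x)"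
  by (simp add: smooth_on_def higher_differentiable_on_ident)

lemma smooth_on_add:
  "open S \<Longrightarrow> smooth_on S f \<Longrightarrow> smooth_on S g \<Longrightarrow> smooth_on S (\<lambda>x. f x + g x)"
  by (simp add: smooth_on_def higher_differentiable_on_add)

lemma smooth_on_sum:
  "open S \<Longrightarrow> (\<And>i. i \<in> I \<Longrightarrow> smooth_on S (f i)) \<Longrightarrow> smooth_on S (\<lambda>x. \<Sum>i\<in>I. f i x)"
  by (simp add: smooth_on_def higher_differentiable_on_sum)

lemma smooth_on_bounded_linear:
  "open S \<Longrightarrow> bounded_linear l \<Longrightarrow> smooth_on S f \<Longrightarrow> smooth_on S (\<lambda>x. l (f x))"
  by (simp add: smooth_on_def higher_differentiable_on_bounded_linear)

lemma smooth_on_scaleR: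
  "open S \<Longrightarrow> smooth_on S f \<Longrightarrow> smooth_on S g \<Longrightarrow> smooth_on S (\<lambda>x. f x *\<^sub>R g x)"
  by (simp add: smooth_on_def higher_differentiable_on_scaleR)

lemma smooth_on_mult:
  fixes f g :: "'a::real_normed_vector \<Rightarrow> real"
  shows "open S \<Longrightarrow> smooth_on S f \<Longrightarrow> smooth_on S g \<Longrightarrow> smooth_on S (\<lambda>x. f x * g x)"
  using smooth_on_scaleR[of S f g] by simp

lemma smooth_on_minus: "open S \<Longrightarrow> smooth_on S f \<Longrightarrow> smooth_on S (\<lambda>x. - f x)"
  using smooth_on_bounded_linear[OF _ bounded_linear_minus[OF bounded_linear_ident]] .

lemma smooth_on_diff:
  "open S \<Longrightarrow> smooth_on S f \<Longrightarrow> smooth_on S g \<Longrightarrow> smooth_on S (\<lambda>x. f x - g x)"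
  using smooth_on_add[OF _ _ smooth_on_minus, of S f g] by simp

lemma smooth_on_compose:
  fixes f :: "'a::real_normed_vector \<Rightarrow> 'b::real_normed_vector"
  assumes "finite_dimensional TYPE('b)" "open S" "smooth_on S f" "smooth_on T g" "f ` S \<subseteq> T"
  shows "smooth_on S (\<lambda>x. g (f x))"
  using higher_differentiable_on_compose[OF assms(1,2) _ _ assms(5)] assms(3,4)
  unfolding smooth_on_def by blast

lemma smooth_on_Pair:
  assumes "open S" "smooth_on S f" "smooth_on S g"
  shows "smooth_on S (\<lambda>x. (f x, g x))"
proof -
  have "smooth_on S (\<lambda>x. (f x, 0) + (0, g x))"
    by (rule smooth_on_add[OF assms(1)
          smooth_on_bounded_linear[OF assms(1) _ assms(2), of "\<lambda>y. (y, 0)"]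
          smooth_on_bounded_linear[OF assms(1) _ assms(3), of "\<lambda>y. (0, y)"]])
       (intro bounded_linear_Pair bounded_linear_ident bounded_linear_zero)+
  then show ?thesis by simp
qed

text \<open>Smoothness speaks of directional derivatives, so the operator norm of the derivative is
  dominated by the continuous function \<open>K\<close>, a finite sum over the directions
  \<open>e i\<close>. Near \<open>x0\<close> this is at most \<open>K x0 + 1\<close>, and the mean
  value inequality on a ball applies.\<close>

lemma smooth_on_locally_lipschitz:
  fixes f :: "'a::real_normed_vector \<Rightarrow> 'b::real_normed_vector"
  assumes fd: "finite_dimensional TYPE('a)" and S: "open S" "x0 \<in> S" and f: "smooth_on S f"
  obtains r L where "r > 0" "L \<ge> 0" "cball x0 r \<subseteq> S"
    "\<And>x y. x \<in> cball x0 r \<Longrightarrow> y \<in> cball x0 r \<Longrightarrow> norm (f x - f y) \<le> L * norm (x - y)"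
proof -
  obtain n :: nat and e and c :: "nat \<Rightarrow> 'a \<Rightarrow>\<^sub>L real"
    where ec: "\<And>x. (\<Sum>i<n. c i x *\<^sub>R e i) = x"
    by (rule finite_dimensionalE[OF fd]) blast
  define K where "K x = (\<Sum>i<n. norm (c i) * norm (frechet_derivative f (at x) (e i)))" for x
  have "continuous_on S K"
    unfolding K_def
    by (intro continuous_on_sum continuous_on_mult continuous_on_norm continuous_on_const
        smooth_on_continuous smooth_on_frechet_derivative f)
  then have "isCont K x0" using S by (simp add: continuous_on_eq_continuous_at)
  then obtain d where d: "d > 0" "\<And>x. dist x x0 < d \<Longrightarrow> dist (K x) (K x0) < 1"
    unfolding continuous_at_eps_delta by (metis zero_less_one)
  obtain d' where d': "d' > 0" "cball x0 d' \<subseteq> S" using S open_contains_cball by blast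
  define r where "r = min (d / 2) d'"
  define L where "L = K x0 + 1"
  have r: "r > 0" "cball x0 r \<subseteq> S" using d d' by (auto simp: r_def)
  have L0: "L \<ge> 0"
    unfolding L_def K_def by (intro add_nonneg_nonneg sum_nonneg mult_nonneg_nonneg) auto
  have KL: "K x \<le> L" if "x \<in> cball x0 r" for x
    using d(2)[of x] that d(1) by (auto simp: L_def r_def dist_commute dist_real_def)
  have on: "onorm (frechet_derivative f (at x)) \<le> L" if x: "x \<in> cball x0 r" for x
  proof (rule onorm_bound[OF L0])
    fix v
    have lin: "linear (frechet_derivative f (at x))"
      using smooth_on_has_derivative[OF f] x r has_derivative_linear by blast
    have "norm (frechet_derivative f (at x) v) = norm (frechet_derivative f (at x) (\<Sum>i<n. c i v *\<^sub>R e i))"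
      by (simp add: ec)
    also have "\<dots> = norm (\<Sum>i<n. c i v *\<^sub>R frechet_derivative f (at x) (e i))"
      by (simp add: linear_sum[OF lin] linear_cmul[OF lin])
    also have "\<dots> \<le> (\<Sum>i<n. norm (c i) * norm (frechet_derivative f (at x) (e i)) * norm v)"
    proof (rule sum_norm_le)
      fix i
      have "\<bar>c i v\<bar> \<le> norm (c i) * norm v" using norm_blinfun[of "c i" v] by simp
      from mult_right_mono[OF this, of "norm (frechet_derivative f (at x) (e i))"]
      show "norm (c i v *\<^sub>R frechet_derivative f (at x) (e i))
        \<le> norm (c i) * norm (frechet_derivative f (at x) (e i)) * norm v"
        by (simp add: mult.assoc mult.commute[of "norm v"])
    qed
    also have "\<dots> = K x * norm v" by (simp add: K_def sum_distrib_right)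
    also have "\<dots> \<le> L * norm v" by (intro mult_right_mono KL x norm_ge_zero)
    finally show "norm (frechet_derivative f (at x) v) \<le> L * norm v" .
  qed
  have "norm (f x - f y) \<le> L * norm (x - y)" if "x \<in> cball x0 r" "y \<in> cball x0 r" for x y
  proof (rule differentiable_bound[OF convex_cball _ on that])
    show "(f has_derivative frechet_derivative f (at z)) (at z within cball x0 r)"
      if "z \<in> cball x0 r" for z
      using smooth_on_has_derivative[OF f] that r has_derivative_at_withinI by blast
  qed
  then show ?thesis using that r L0 by blast
qed

section \<open>Second differences and symmetry of the second derivative\<close>

lemma has_real_derivative_along_line:
  fixes E :: "'a::real_normed_vector \<Rightarrow> real"
  assumes "smooth_on UNIV E"
  shows "((\<lambda>s. E (q + s *\<^sub>R u)) has_real_derivative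
      frechet_derivative E (at (q + s *\<^sub>R u)) u) (at s)"
proof -
  have "((\<lambda>s. E (q + s *\<^sub>R u)) has_derivative
      (\<lambda>h. frechet_derivative E (at (q + s *\<^sub>R u)) (h *\<^sub>R u))) (at s)"
    by (rule has_derivative_compose[OF _ smooth_on_has_derivative[OF assms UNIV_I],
          of "\<lambda>s. q + s *\<^sub>R u" "\<lambda>h. h *\<^sub>R u"]) (auto intro!: derivative_eq_intros)
  also have "(\<lambda>h. frechet_derivative E (at (q + s *\<^sub>R u)) (h *\<^sub>R u))
      = (*) (frechet_derivative E (at (q + s *\<^sub>R u)) u)"
    using has_derivative_linear[OF smooth_on_has_derivative[OF assms UNIV_I]]
    by (auto simp: linear_cmul)
  finally show ?thesis unfolding has_field_derivative_def .
qed

text \<open>The mean value theorem is applied twice, along \<open>u\<close> to the difference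
  \<open>?g\<close> and then along \<open>v\<close> to the derivative in direction \<open>u\<close>.
  The point is that the second difference on the left is symmetric in \<open>u\<close> and
  \<open>v\<close>, while the right side is not visibly so.\<close>

lemma second_difference_mean_value:
  fixes E :: "'a::real_normed_vector \<Rightarrow> real"
  assumes E: "smooth_on UNIV E" and h: "h > 0"
  shows "\<exists>z. norm (z - p) \<le> h * (norm u + norm v) \<and>
    E (p + h *\<^sub>R u + h *\<^sub>R v) - E (p + h *\<^sub>R u) - E (p + h *\<^sub>R v) + E p
      = h * (h * frechet_derivative (\<lambda>x. frechet_derivative E (at x) u) (at z) v)"
proof -
  let ?D = "\<lambda>x. frechet_derivative E (at x) u"
  have D: "smooth_on UNIV ?D" by (rule smooth_on_frechet_derivative[OF E])
  let ?g = "\<lambda>s. E (p + h *\<^sub>R v + s *\<^sub>R u) - E (p + s *\<^sub>R u)"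
  have "\<exists>a. 0 < a \<and> a < h \<and> ?g h - ?g 0 = (h - 0) * (?D (p + h *\<^sub>R v + a *\<^sub>R u) - ?D (p + a *\<^sub>R u))"
    by (intro MVT2[OF h] DERIV_diff has_real_derivative_along_line E)
  then obtain a where a: "0 < a" "a < h"
    and ga: "?g h - ?g 0 = h * (?D (p + h *\<^sub>R v + a *\<^sub>R u) - ?D (p + a *\<^sub>R u))" by auto
  have "\<exists>b. 0 < b \<and> b < h \<and> ?D (p + a *\<^sub>R u + h *\<^sub>R v) - ?D (p + a *\<^sub>R u + 0 *\<^sub>R v)
      = (h - 0) * frechet_derivative ?D (at (p + a *\<^sub>R u + b *\<^sub>R v)) v"
    by (intro MVT2[OF h] has_real_derivative_along_line D)
  then obtain b where b: "0 < b" "b < h"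
    and gb: "?D (p + a *\<^sub>R u + h *\<^sub>R v) - ?D (p + a *\<^sub>R u)
      = h * frechet_derivative ?D (at (p + a *\<^sub>R u + b *\<^sub>R v)) v" by auto
  have "norm (a *\<^sub>R u + b *\<^sub>R v) \<le> a * norm u + b * norm v"
    using norm_triangle_ineq[of "a *\<^sub>R u" "b *\<^sub>R v"] a b by simp
  also have "\<dots> \<le> h * norm u + h * norm v" using a b by (intro add_mono mult_right_mono) auto
  finally have "norm (p + a *\<^sub>R u + b *\<^sub>R v - p) \<le> h * (norm u + norm v)"
    by (simp add: distrib_left add.assoc)
  moreover have "E (p + h *\<^sub>R u + h *\<^sub>R v) - E (p + h *\<^sub>R u) - E (p + h *\<^sub>R v) + E p = ?g h - ?g 0"
    by (simp add: add_ac)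
  moreover have "p + h *\<^sub>R v + a *\<^sub>R u = p + a *\<^sub>R u + h *\<^sub>R v" by (simp add: add_ac)
  then have "?g h - ?g 0 = h * (h * frechet_derivative ?D (at (p + a *\<^sub>R u + b *\<^sub>R v)) v)"
    using ga gb by (simp only:)
  ultimately show ?thesis by metis
qed

text \<open>Both orders of differentiation represent the same second difference, at intermediate
  points \<open>z\<close> and \<open>z'\<close> that tend to \<open>p\<close> as the step
  \<open>1 / (n + 1)\<close> shrinks; continuity of the second derivatives does the rest.\<close>

lemma second_derivative_symmetric:
  fixes E :: "'a::real_normed_vector \<Rightarrow> real"
  assumes E: "smooth_on UNIV E"
  shows "frechet_derivative (\<lambda>x. frechet_derivative E (at x) u) (at p) v
    = frechet_derivative (\<lambda>x. frechet_derivative E (at x) v) (at p) u"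
proof -
  define A where "A u v x = frechet_derivative (\<lambda>x. frechet_derivative E (at x) u) (at x) v" for u v x
  have cont: "isCont (A u v) x" for u v x
    using smooth_on_continuous[OF smooth_on_frechet_derivative[OF smooth_on_frechet_derivative[OF E]]]
    unfolding A_def by (simp add: continuous_on_eq_continuous_at)
  have sym: "\<exists>z z'. norm (z - p) \<le> inverse (Suc n) * (norm u + norm v) \<and>
      norm (z' - p) \<le> inverse (Suc n) * (norm u + norm v) \<and> A u v z = A v u z'" for n
  proof -
    define h :: real where "h = inverse (Suc n)"
    have h: "h > 0" by (simp add: h_def)
    from second_difference_mean_value[OF E h, of p u v]
    obtain z where z: "norm (z - p) \<le> h * (norm u + norm v)"
       "E (p + h *\<^sub>R u + h *\<^sub>R v) - E (p + h *\<^sub>R u) - E (p + h *\<^sub>R v) + E p = h * (h * A u v z)"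
      unfolding A_def by blast
    from second_difference_mean_value[OF E h, of p v u]
    obtain z' where z': "norm (z' - p) \<le> h * (norm v + norm u)"
       "E (p + h *\<^sub>R v + h *\<^sub>R u) - E (p + h *\<^sub>R v) - E (p + h *\<^sub>R u) + E p = h * (h * A v u z')"
      unfolding A_def by blast
    have "h * (h * A u v z) = h * (h * A v u z')"
      using z(2) z'(2) by (simp add: algebra_simps)
    then have "A u v z = A v u z'" using h by simp
    then show ?thesis using z(1) z'(1) unfolding h_def by (metis add.commute)
  qed
  then obtain z z' where z: "\<And>n. norm (z n - p) \<le> inverse (Suc n) * (norm u + norm v)"
    "\<And>n. norm (z' n - p) \<le> inverse (Suc n) * (norm u + norm v)" "\<And>n. A u v (z n) = A v u (z' n)"
    by metis
  have lim0: "(\<lambda>n. inverse (real (Suc n)) * (norm u + norm v)) \<longlonglongrightarrow> 0"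
    using tendsto_mult_right[OF LIMSEQ_inverse_real_of_nat, of "norm u + norm v"] by simp
  have zp: "z \<longlonglongrightarrow> p"
    by (rule LIM_zero_cancel, rule Lim_null_comparison[OF always_eventually[OF allI] lim0], rule z)
  have z'p: "z' \<longlonglongrightarrow> p"
    by (rule LIM_zero_cancel, rule Lim_null_comparison[OF always_eventually[OF allI] lim0], rule z)
  have "A u v p = A v u p"
    using isCont_tendsto_compose[OF cont zp, of u v] isCont_tendsto_compose[OF cont z'p, of v u]
    unfolding z(3) by (rule LIMSEQ_unique)
  then show ?thesis by (simp only: A_def)
qed

lemma has_vector_derivative_compose_has_derivative:
  assumes "(c has_vector_derivative v) (at t)" "(f has_derivative D) (at (c t))"
  shows "((\<lambda>s. f (c s)) has_vector_derivative D v) (at t)"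
proof -
  have "((\<lambda>s. f (c s)) has_derivative (\<lambda>h. D (h *\<^sub>R v))) (at t)"
    using has_derivative_compose[OF assms(1)[unfolded has_vector_derivative_def] assms(2)] .
  then show ?thesis
    using linear_cmul[OF has_derivative_linear[OF assms(2)]] by (simp add: has_vector_derivative_def)
qed

subsection \<open>Ordinary differential equations\<close>

lemma vector_derivative_bound:
  fixes h :: "real \<Rightarrow> 'b::real_normed_vector"
  assumes "convex S" "\<And>t. t \<in> S \<Longrightarrow> (h has_vector_derivative h' t) (at t within S)"
    and "\<And>t. t \<in> S \<Longrightarrow> norm (h' t) \<le> B" "s \<in> S" "t \<in> S"
  shows "norm (h s - h t) \<le> B * \<bar>s - t\<bar>"
proof -
  have "norm (h s - h t) \<le> B * norm (s - t)"
  proof (rule differentiable_bound[OF assms(1) _ _ assms(4,5)])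
    show "(h has_derivative (\<lambda>x. x *\<^sub>R h' t)) (at t within S)" if "t \<in> S" for t
      using assms(2)[OF that] unfolding has_vector_derivative_def .
    show "onorm (\<lambda>x. x *\<^sub>R h' t) \<le> B" if "t \<in> S" for t
      by (rule onorm_le) (simp add: mult.commute[of B] mult_left_mono[OF assms(3)[OF that]])
  qed
  then show ?thesis by simp
qed

text \<open>Picard iteration as a contraction of the bounded continuous curves with values in the
  ball. The curves live on the whole line and are frozen outside a compact interval, so that the
  complete space of bounded continuous functions is available.\<close>

lemma lipschitz_ode_exists:
  fixes f :: "'a::banach \<Rightarrow> 'a"
  assumes r: "r > 0" and L: "L \<ge> 0"
    and lip: "\<And>x y. x \<in> cball x0 r \<Longrightarrow> y \<in> cball x0 r \<Longrightarrow> norm (f x - f y) \<le> L * norm (x - y)"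
  obtains \<delta> x where "\<delta> > 0" "x 0 = x0"
    "\<And>t. \<bar>t\<bar> < \<delta> \<Longrightarrow> x t \<in> cball x0 r \<and> (x has_vector_derivative f (x t)) (at t)"
proof -
  define M where "M = norm (f x0) + L * r + 1"
  have M: "M > 0" unfolding M_def using r L by (simp add: add_nonneg_pos)
  have fM: "norm (f x) \<le> M" if "x \<in> cball x0 r" for x
  proof -
    have "norm (f x) \<le> norm (f x0) + norm (f x - f x0)"
      by (metis add.commute diff_add_cancel norm_triangle_ineq)
    also have "norm (f x - f x0) \<le> L * norm (x - x0)" using lip[OF that] r by simp
    also have "\<dots> \<le> L * r" using that L
      by (intro mult_left_mono) (auto simp: dist_norm norm_minus_commute)
    finally show ?thesis unfolding M_def by simp
  qed
  have fcont: "continuous_on (cball x0 r) f"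
    by (rule lipschitz_on_continuous_on[of L]) (auto simp: lipschitz_on_def dist_norm L lip)
  \<comment> \<open>The bound \<open>r / M\<close> keeps the iterates inside the ball, where
    \<open>M\<close> bounds \<open>f\<close>; the bound \<open>1 / (2 * (L + 1))\<close> makes the
    iteration contract by the factor 1/2, also for \<open>L = 0\<close>.\<close>
  define \<delta> where "\<delta> = min (r / M) (1 / (2 * (L + 1)))"
  have \<delta>: "\<delta> > 0" "M * \<delta> \<le> r" "L * \<delta> \<le> 1 / 2"
  proof -
    show "\<delta> > 0" using r M L by (simp add: \<delta>_def)
    have "M * \<delta> \<le> M * (r / M)" unfolding \<delta>_def using M by (intro mult_left_mono) auto
    then show "M * \<delta> \<le> r" using M by simp
    have "L * \<delta> \<le> (L + 1) * (1 / (2 * (L + 1)))"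
      using \<open>\<delta> > 0\<close> L by (intro mult_mono) (auto simp: \<delta>_def)
    also have "\<dots> = 1 / 2" using L by simp
    finally show "L * \<delta> \<le> 1 / 2" .
  qed
  define I where "I = {-\<delta>..\<delta>}"
  define cl where "cl t = max (-\<delta>) (min \<delta> t)" for t
  have cl: "cl t \<in> I" "t \<in> I \<Longrightarrow> cl t = t" for t using \<delta>(1) by (auto simp: cl_def I_def)
  have I0: "0 \<in> I" and convI: "convex I" using \<delta>(1) by (auto simp: I_def)
  have clcont: "continuous_on UNIV cl" unfolding cl_def by (intro continuous_intros)
  define S where "S = {u :: real \<Rightarrow>\<^sub>C 'a. \<forall>t. apply_bcontfun u t \<in> cball x0 r}"
  have "S = PiC UNIV (\<lambda>_. cball x0 r)" by (auto simp: S_def mem_PiC_iff Pi_iff)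
  then have "closed S" by (simp add: closed_PiC)
  then have Scomp: "complete S" by (simp add: complete_eq_closed)
  have "const_bcontfun x0 \<in> S" using r by (simp add: S_def const_bcontfun.rep_eq)
  then have Sne: "S \<noteq> {}" by blast
  \<comment> \<open>The Picard operator as a relation: \<open>v\<close> starts at \<open>x0\<close>,
    has derivative \<open>f\<close> of \<open>u\<close> on \<open>I\<close> and is constant beyond
    its ends. Posing it through antiderivatives treats both signs of time at once.\<close>
  define P where "P u v \<longleftrightarrow> v \<in> S \<and> apply_bcontfun v 0 = x0 \<and> (\<forall>t. apply_bcontfun v t = apply_bcontfun v (cl t)) \<and>
     (\<forall>t\<in>I. (apply_bcontfun v has_vector_derivative f (apply_bcontfun u t)) (at t within I))" for u v
  have "\<exists>v. P u v" if u: "u \<in> S" for u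
  proof -
    have uS: "apply_bcontfun u t \<in> cball x0 r" for t using u by (simp add: S_def)
    have "continuous_on I (\<lambda>t. f (apply_bcontfun u t))"
      by (rule continuous_on_compose2[OF fcont]) (use uS in auto)
    then obtain G where G: "\<And>t. t \<in> I \<Longrightarrow>
        (G has_vector_derivative f (apply_bcontfun u t)) (at t within I)"
      unfolding I_def by (rule antiderivative_continuous) blast
    define g where "g t = x0 + (G (cl t) - G 0)" for t
    have bnd: "norm (g t - x0) \<le> r" for t
    proof -
      have "norm (G (cl t) - G 0) \<le> M * \<bar>cl t - 0\<bar>"
        by (rule vector_derivative_bound[OF convI G]) (use cl I0 fM uS in auto)
      also have "\<dots> \<le> M * \<delta>" using cl(1)[of t] M by (intro mult_left_mono) (auto simp: I_def)
      finally show ?thesis using \<delta>(2) by (simp add: g_def)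
    qed
    have "continuous_on I G"
      using G by (auto simp: continuous_on_eq_continuous_within intro: has_vector_derivative_continuous)
    then have "continuous_on UNIV (\<lambda>t. G (cl t))"
      by (rule continuous_on_compose2[OF _ clcont]) (use cl in auto)
    then have gcont: "continuous_on UNIV g" unfolding g_def by (intro continuous_intros)
    have "norm (g t) \<le> norm x0 + r" for t
      using bnd[of t] norm_triangle_ineq[of x0 "g t - x0"] by simp
    then have gb: "g \<in> bcontfun" using gcont by (rule bcontfun_normI[rotated])
    have app: "apply_bcontfun (Bcontfun g) = g" by (rule Bcontfun_inverse[OF gb])
    have "(g has_vector_derivative f (apply_bcontfun u t)) (at t within I)" if t: "t \<in> I" for t
    proof (rule has_vector_derivative_transform[OF t])
      show "g s = x0 + (G s - G 0)" if "s \<in> I" for s using that cl by (simp add: g_def)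
      show "((\<lambda>s. x0 + (G s - G 0)) has_vector_derivative f (apply_bcontfun u t)) (at t within I)"
        using G[OF t] by (auto intro!: derivative_eq_intros)
    qed
    then have "P u (Bcontfun g)"
      unfolding P_def app S_def using bnd cl I0
      by (simp add: app dist_norm norm_minus_commute g_def)
    then show ?thesis by blast
  qed
  then obtain T where T: "\<And>u. u \<in> S \<Longrightarrow> P u (T u)" by metis
  have TS: "T ` S \<subseteq> S" using T unfolding P_def by blast
  have contr: "dist (T u) (T w) \<le> 1 / 2 * dist u w" if uw: "u \<in> S" "w \<in> S" for u w
  proof (rule dist_bound)
    fix t
    let ?h = "\<lambda>t. apply_bcontfun (T u) t - apply_bcontfun (T w) t"
    note Tu = T[OF uw(1), unfolded P_def] and Tw = T[OF uw(2), unfolded P_def]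
    have "norm (?h (cl t) - ?h 0) \<le> (L * dist u w) * \<bar>cl t - 0\<bar>"
    proof (rule vector_derivative_bound[OF convI])
      show "(?h has_vector_derivative f (apply_bcontfun u t) - f (apply_bcontfun w t)) (at t within I)"
        if "t \<in> I" for t using Tu Tw that by (intro has_vector_derivative_diff) auto
      show "norm (f (apply_bcontfun u t) - f (apply_bcontfun w t)) \<le> L * dist u w" for t
      proof -
        have "norm (f (apply_bcontfun u t) - f (apply_bcontfun w t))
          \<le> L * norm (apply_bcontfun u t - apply_bcontfun w t)"
          using uw by (intro lip) (auto simp: S_def)
        also have "\<dots> \<le> L * dist u w"
          using dist_bounded[of u t w] L by (intro mult_left_mono) (auto simp: dist_norm)
        finally show ?thesis .
      qed
    qed (use cl I0 in auto)
    also have "\<dots> \<le> (L * dist u w) * \<delta>"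
      using cl(1)[of t] L by (intro mult_left_mono) (auto simp: I_def)
    also have "\<dots> = (L * \<delta>) * dist u w" by simp
    also have "\<dots> \<le> 1 / 2 * dist u w" using \<delta>(3) by (intro mult_right_mono) auto
    finally show "dist (apply_bcontfun (T u) t) (apply_bcontfun (T w) t) \<le> 1 / 2 * dist u w"
      using Tu Tw by (metis diff_self diff_zero dist_norm)
  qed
  obtain u where u: "u \<in> S" "T u = u"
    using Banach_fix[OF Scomp Sne _ _ TS, of "1/2"] contr by auto
  have Pu: "P u u" using T[OF u(1)] u(2) by simp
  show ?thesis
  proof (rule that[OF \<delta>(1)])
    show "apply_bcontfun u 0 = x0" using Pu by (simp add: P_def)
    show "apply_bcontfun u t \<in> cball x0 r \<and>
        (apply_bcontfun u has_vector_derivative f (apply_bcontfun u t)) (at t)"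
      if "\<bar>t\<bar> < \<delta>" for t
    proof -
      have "t \<in> interior I" using that by (auto simp: I_def)
      then have "at t within I = at t" by (rule at_within_interior)
      moreover have "t \<in> I" using that by (auto simp: I_def)
      ultimately show ?thesis using Pu u(1) unfolding P_def S_def by auto
    qed
  qed
qed

text \<open>At a point where the distance of the two curves is maximal on the interval of radius
  \<open>\<bar>t\<bar>\<close>, the mean value inequality bounds the distance by
  \<open>L * \<bar>t\<bar> < 1\<close> times itself. Short times suffice, because homomorphisms from
  the line are determined near 0.\<close>

lemma lipschitz_ode_unique:
  fixes x y :: "real \<Rightarrow> 'a::real_normed_vector"
  assumes lip: "\<And>x y. x \<in> S \<Longrightarrow> y \<in> S \<Longrightarrow> norm (f x - f y) \<le> L * norm (x - y)"
    and L: "L \<ge> 0" "L * \<delta> < 1"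
    and x: "\<And>t. \<bar>t\<bar> < \<delta> \<Longrightarrow> x t \<in> S \<and> (x has_vector_derivative f (x t)) (at t)"
    and y: "\<And>t. \<bar>t\<bar> < \<delta> \<Longrightarrow> y t \<in> S \<and> (y has_vector_derivative f (y t)) (at t)"
    and init: "x 0 = y 0" and t: "\<bar>t\<bar> < \<delta>"
  shows "x t = y t"
proof -
  define I where "I = {-\<bar>t\<bar>..\<bar>t\<bar>}"
  have I: "convex I" "compact I" "0 \<in> I" "t \<in> I" by (auto simp: I_def)
  let ?h = "\<lambda>s. x s - y s"
  have der: "(?h has_vector_derivative f (x s) - f (y s)) (at s within I)" if "s \<in> I" for s
    using x[of s] y[of s] that t
    by (intro has_vector_derivative_at_within[OF has_vector_derivative_diff]) (auto simp: I_def)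
  then have "continuous_on I ?h"
    by (auto simp: continuous_on_eq_continuous_within intro: has_vector_derivative_continuous)
  then have "continuous_on I (\<lambda>s. norm (?h s))" by (rule continuous_on_norm)
  then obtain s where s: "s \<in> I" "\<And>s'. s' \<in> I \<Longrightarrow> norm (?h s') \<le> norm (?h s)"
    using continuous_attains_sup[OF I(2)] I(3) by blast
  have "norm (?h s - ?h 0) \<le> (L * norm (?h s)) * \<bar>s - 0\<bar>"
  proof (rule vector_derivative_bound[OF I(1) der])
    show "norm (f (x s') - f (y s')) \<le> L * norm (?h s)" if "s' \<in> I" for s'
    proof -
      have "norm (f (x s') - f (y s')) \<le> L * norm (?h s')"
        using x[of s'] y[of s'] that t by (intro lip) (auto simp: I_def)
      also have "\<dots> \<le> L * norm (?h s)" using s(2)[OF that] L by (intro mult_left_mono)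
      finally show ?thesis .
    qed
  qed (use s I in auto)
  also have "\<dots> \<le> (L * norm (?h s)) * \<bar>t\<bar>"
    using s(1) L by (intro mult_left_mono) (auto simp: I_def)
  finally have le: "norm (?h s) \<le> (L * \<bar>t\<bar>) * norm (?h s)" using init by (simp add: mult_ac)
  have "L * \<bar>t\<bar> < 1" using L t by (meson le_less_trans less_imp_le mult_left_mono)
  then have "norm (?h s) \<le> 0" using le
    by (smt (verit) mult_le_cancel_right1 norm_ge_zero)
  then have "norm (?h t) \<le> 0" using s(2)[OF I(4)] by linarith
  then show ?thesis by simp
qed

text \<open>Bootstrapping: when \<open>x\<close> is of class C-n, so is its derivative
  \<open>f (x t)\<close>, and \<open>x\<close> gains one order.\<close>

lemma smooth_on_ode_solution:
  fixes x :: "real \<Rightarrow> 'a::real_normed_vector"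
  assumes fd: "finite_dimensional TYPE('a)" and I: "open I" and f: "smooth_on S f"
    and x: "\<And>t. t \<in> I \<Longrightarrow> x t \<in> S" "\<And>t. t \<in> I \<Longrightarrow> (x has_vector_derivative f (x t)) (at t)"
  shows "smooth_on I x"
  unfolding smooth_on_def
proof
  fix n
  have d: "frechet_derivative x (at t) v = v *\<^sub>R f (x t)" if "t \<in> I" for t v
    using frechet_derivative_at[OF x(2)[OF that, unfolded has_vector_derivative_def]] by metis
  show "higher_differentiable_on I x n"
  proof (induction n)
    case 0
    show ?case
      using x(2) by (auto intro!: continuous_at_imp_continuous_on has_vector_derivative_continuous)
  next
    case (Suc n)
    have "higher_differentiable_on I (\<lambda>t. f (x t)) n"
      by (rule higher_differentiable_on_compose[OF fd I Suc]) (use f x in \<open>auto simp: smooth_on_def\<close>)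
    then have fx: "higher_differentiable_on I (\<lambda>t. v *\<^sub>R f (x t)) n" for v
      by (rule higher_differentiable_on_scaleR[OF I higher_differentiable_on_const])
    have "higher_differentiable_on I (\<lambda>t. frechet_derivative x (at t) v) n" for v
      by (rule higher_differentiable_on_cong[OF I _ fx[of v]]) (simp add: d)
    then show ?case
      using x(2) unfolding higher_differentiable_on.simps differentiable_def has_vector_derivative_def
      by blast
  qed
qed

subsection \<open>Atlases and smooth maps\<close>

text \<open>Unlike \<open>smooth_manifold\<close>, this imposes no separation or countability axiom, so that it applies
  to products with the dual of an arbitrary finite-dimensional normed space.\<close>

definition atlas :: "('m::topological_space \<Rightarrow> ('m, 'a::real_normed_vector) chart) \<Rightarrow> bool" where
  "atlas ch \<longleftrightarrow> finite_dimensional TYPE('a) \<and>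
     (\<forall>p. p \<in> fst (ch p) \<and> open (fst (ch p)) \<and> open (snd (ch p) ` fst (ch p)) \<and>
          homeomorphism (fst (ch p)) (snd (ch p) ` fst (ch p)) (snd (ch p)) (chart_inv (ch p))) \<and>
     (\<forall>p q. smooth_on (snd (ch p) ` (fst (ch p) \<inter> fst (ch q))) (snd (ch q) \<circ> chart_inv (ch p)))"

context
  fixes ch :: "'m::topological_space \<Rightarrow> ('m, 'a::real_normed_vector) chart"
  assumes atlas: "atlas ch"
begin

lemma atlas_finite_dimensional: "finite_dimensional TYPE('a)"
  using atlas by (simp add: atlas_def)

lemma mem_chart: "p \<in> fst (ch p)"
  using atlas by (simp add: atlas_def)

lemma open_chart: "open (fst (ch p))"
  using atlas by (simp add: atlas_def)

lemma open_chart_range: "open (snd (ch p) ` fst (ch p))"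
  using atlas by (simp add: atlas_def)

lemma chart_homeomorphism:
  "homeomorphism (fst (ch p)) (snd (ch p) ` fst (ch p)) (snd (ch p)) (chart_inv (ch p))"
  using atlas by (simp add: atlas_def)

lemma chart_transition:
  "smooth_on (snd (ch p) ` (fst (ch p) \<inter> fst (ch q))) (snd (ch q) \<circ> chart_inv (ch p))"
  using atlas by (simp add: atlas_def)

lemma chart_inv_left: "x \<in> fst (ch p) \<Longrightarrow> chart_inv (ch p) (snd (ch p) x) = x"
  using homeomorphism_apply1[OF chart_homeomorphism] .

lemma continuous_on_chart: "continuous_on (fst (ch p)) (snd (ch p))"
  using homeomorphism_cont1[OF chart_homeomorphism] .

lemma continuous_on_chart_inv: "continuous_on (snd (ch p) ` fst (ch p)) (chart_inv (ch p))"
  using homeomorphism_cont2[OF chart_homeomorphism] .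

lemma open_chart_image:
  assumes "open U" "U \<subseteq> fst (ch p)"
  shows "open (snd (ch p) ` U)"
proof -
  have "openin (top_of_set (fst (ch p))) U"
    using assms by (simp add: openin_open_eq[OF open_chart])
  then have "openin (top_of_set (snd (ch p) ` fst (ch p))) (snd (ch p) ` U)"
    by (rule homeomorphism_imp_open_map[OF chart_homeomorphism])
  then show ?thesis using open_chart_range openin_open_trans by blast
qed

end

lemma smooth_manifold_imp_atlas: "smooth_manifold ch \<Longrightarrow> atlas ch"
  unfolding smooth_manifold_def atlas_def using finite_dimensional_span by blast

lemma vector_charts_simps [simp]:
  "fst (vector_charts p) = UNIV" "snd (vector_charts p) = id" "chart_inv (vector_charts p) = id"
  by (simp_all add: vector_charts_def chart_inv_def inv_id)

lemma atlas_vector_charts: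
  assumes "finite_dimensional TYPE('a::real_normed_vector)"
  shows "atlas (vector_charts :: 'a \<Rightarrow> _)"
  using assms unfolding atlas_def
  by (simp add: homeomorphism_ident[unfolded id_def[symmetric]] smooth_on_ident[unfolded id_def[symmetric]])

lemma prod_charts_simps [simp]:
  "fst (prod_charts ch ch' z) = fst (ch (fst z)) \<times> fst (ch' (snd z))"
  "snd (prod_charts ch ch' z) = map_prod (snd (ch (fst z))) (snd (ch' (snd z)))"
  by (simp_all add: prod_charts_def split: prod.split)

text \<open>The charts are injective on their domains, so the product chart is too.
  \<open>inv_into\<close> is meaningful on the image only, whence the restriction to points of the
  two chart ranges.\<close>

lemma chart_inv_prod_charts:
  assumes "atlas ch" "atlas ch'"
    and "x \<in> snd (ch (fst p)) ` fst (ch (fst p))" "y \<in> snd (ch' (snd p)) ` fst (ch' (snd p))"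
  shows "chart_inv (prod_charts ch ch' p) (x, y) = (chart_inv (ch (fst p)) x, chart_inv (ch' (snd p)) y)"
proof -
  obtain a b where ab: "a \<in> fst (ch (fst p))" "x = snd (ch (fst p)) a"
    "b \<in> fst (ch' (snd p))" "y = snd (ch' (snd p)) b" using assms by blast
  have "inj_on (snd (ch (fst p))) (fst (ch (fst p)))" "inj_on (snd (ch' (snd p))) (fst (ch' (snd p)))"
    using chart_inv_left[OF assms(1)] chart_inv_left[OF assms(2)] inj_on_inverseI by metis+
  then have inj: "inj_on (snd (prod_charts ch ch' p)) (fst (prod_charts ch ch' p))"
    by (simp add: map_prod_inj_on)
  have "chart_inv (prod_charts ch ch' p) (snd (prod_charts ch ch' p) (a, b)) = (a, b)"
    unfolding chart_inv_def by (rule inv_into_f_f[OF inj]) (use ab in auto)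
  then show ?thesis
    using ab chart_inv_left[OF assms(1)] chart_inv_left[OF assms(2)] by simp
qed

lemma map_prod_image_Times: "map_prod f g ` (A \<times> B) = f ` A \<times> g ` B"
  by auto

lemma atlas_prod_charts:
  assumes ch: "atlas ch" and ch': "atlas ch'"
  shows "atlas (prod_charts ch ch')"
proof -
  note inv = chart_inv_prod_charts[OF ch ch']
  note left = chart_inv_left[OF ch] chart_inv_left[OF ch']
  have hom: "homeomorphism (fst (prod_charts ch ch' p)) (snd (prod_charts ch ch' p) ` fst (prod_charts ch ch' p))
      (snd (prod_charts ch ch' p)) (chart_inv (prod_charts ch ch' p))" for p
  proof (rule homeomorphismI)
    have c1: "continuous_on (fst (prod_charts ch ch' p)) (\<lambda>z. snd (ch (fst p)) (fst z))"
      by (rule continuous_on_compose2[OF continuous_on_chart[OF ch] continuous_on_fst[OF continuous_on_id]]) auto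
    have c2: "continuous_on (fst (prod_charts ch ch' p)) (\<lambda>z. snd (ch' (snd p)) (snd z))"
      by (rule continuous_on_compose2[OF continuous_on_chart[OF ch'] continuous_on_snd[OF continuous_on_id]]) auto
    show "continuous_on (fst (prod_charts ch ch' p)) (snd (prod_charts ch ch' p))"
      using continuous_on_Pair[OF c1 c2] by (simp add: map_prod_def split_beta)
    let ?I = "snd (prod_charts ch ch' p) ` fst (prod_charts ch ch' p)"
    have c1: "continuous_on ?I (\<lambda>z. chart_inv (ch (fst p)) (fst z))"
      by (rule continuous_on_compose2[OF continuous_on_chart_inv[OF ch] continuous_on_fst[OF continuous_on_id]]) auto
    have c2: "continuous_on ?I (\<lambda>z. chart_inv (ch' (snd p)) (snd z))"
      by (rule continuous_on_compose2[OF continuous_on_chart_inv[OF ch'] continuous_on_snd[OF continuous_on_id]]) auto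
    show "continuous_on ?I (chart_inv (prod_charts ch ch' p))"
      by (rule continuous_on_eq[OF continuous_on_Pair[OF c1 c2]]) (auto simp: inv)
  qed (auto simp: inv left)
  have tr: "smooth_on (snd (prod_charts ch ch' p) ` (fst (prod_charts ch ch' p) \<inter> fst (prod_charts ch ch' q)))
      (snd (prod_charts ch ch' q) \<circ> chart_inv (prod_charts ch ch' p))" for p q
  proof -
    let ?A = "snd (ch (fst p)) ` (fst (ch (fst p)) \<inter> fst (ch (fst q)))"
    let ?B = "snd (ch' (snd p)) ` (fst (ch' (snd p)) \<inter> fst (ch' (snd q)))"
    have AB: "open (?A \<times> ?B)"
      by (intro open_Times open_chart_image[OF ch] open_chart_image[OF ch'] open_Int
          open_chart[OF ch] open_chart[OF ch']) auto
    have A: "smooth_on (?A \<times> ?B) (\<lambda>z. (snd (ch (fst q)) \<circ> chart_inv (ch (fst p))) (fst z))"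
      by (rule smooth_on_compose[OF atlas_finite_dimensional[OF ch] AB
            smooth_on_bounded_linear[OF AB bounded_linear_fst smooth_on_ident] chart_transition[OF ch]]) auto
    have B: "smooth_on (?A \<times> ?B) (\<lambda>z. (snd (ch' (snd q)) \<circ> chart_inv (ch' (snd p))) (snd z))"
      by (rule smooth_on_compose[OF atlas_finite_dimensional[OF ch'] AB
            smooth_on_bounded_linear[OF AB bounded_linear_snd smooth_on_ident] chart_transition[OF ch']]) auto
    have eq: "snd (prod_charts ch ch' p) ` (fst (prod_charts ch ch' p) \<inter> fst (prod_charts ch ch' q)) = ?A \<times> ?B"
      by (simp add: Times_Int_Times map_prod_image_Times)
    show ?thesis unfolding eq
      by (rule smooth_on_cong[OF smooth_on_Pair[OF AB A B] AB]) (auto simp: inv left)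
  qed
  show ?thesis
    unfolding atlas_def
    using hom tr finite_dimensional_prod[OF atlas_finite_dimensional[OF ch] atlas_finite_dimensional[OF ch']]
      mem_chart[OF ch] mem_chart[OF ch'] open_chart[OF ch] open_chart[OF ch']
      open_chart_range[OF ch] open_chart_range[OF ch']
    by (simp add: map_prod_image_Times open_Times mem_Times_iff)
qed

section \<open>Smoothness at a point, chain rule and tangent maps\<close>

definition local_rep ::
    "('m \<Rightarrow> ('m, 'a) chart) \<Rightarrow> ('n \<Rightarrow> ('n, 'b) chart) \<Rightarrow> ('m \<Rightarrow> 'n) \<Rightarrow> 'm \<Rightarrow> 'a \<Rightarrow> 'b" where
  "local_rep ch ch' f x = snd (ch' (f x)) \<circ> f \<circ> chart_inv (ch x)"

text \<open>The global notion quantifies over all pairs of charts; this one uses only the charts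
  singled out at \<open>x\<close> and at \<open>f x\<close>, the same that define
  \<open>tangent_map\<close>. Composition of maps then becomes composition of local
  representatives.\<close>

definition smooth_near ::
    "('m::topological_space \<Rightarrow> ('m, 'a::real_normed_vector) chart) \<Rightarrow>
     ('n::topological_space \<Rightarrow> ('n, 'b::real_normed_vector) chart) \<Rightarrow> ('m \<Rightarrow> 'n) \<Rightarrow> 'm \<Rightarrow> bool" where
  "smooth_near ch ch' f x \<longleftrightarrow> (\<exists>U. open U \<and> x \<in> U \<and> U \<subseteq> fst (ch x) \<and> f ` U \<subseteq> fst (ch' (f x)) \<and>
     continuous_on U f \<and> smooth_on (snd (ch x) ` U) (local_rep ch ch' f x))"

lemma smooth_nearI:
  assumes "open U" "x \<in> U" "U \<subseteq> fst (ch x)" "f ` U \<subseteq> fst (ch' (f x))" "continuous_on U f"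
    "smooth_on (snd (ch x) ` U) (local_rep ch ch' f x)"
  shows "smooth_near ch ch' f x"
  using assms unfolding smooth_near_def by blast

lemma smooth_nearE:
  assumes "smooth_near ch ch' f x"
  obtains U where "open U" "x \<in> U" "U \<subseteq> fst (ch x)" "f ` U \<subseteq> fst (ch' (f x))" "continuous_on U f"
    "smooth_on (snd (ch x) ` U) (local_rep ch ch' f x)"
  using assms unfolding smooth_near_def by blast

lemma smooth_near_restrict:
  assumes ch: "atlas ch" and f: "smooth_near ch ch' f x" and V: "open V" "x \<in> V"
  obtains U where "open U" "x \<in> U" "U \<subseteq> V" "U \<subseteq> fst (ch x)" "f ` U \<subseteq> fst (ch' (f x))" "continuous_on U f"
    "smooth_on (snd (ch x) ` U) (local_rep ch ch' f x)"
proof -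
  obtain U where U: "open U" "x \<in> U" "U \<subseteq> fst (ch x)" "f ` U \<subseteq> fst (ch' (f x))" "continuous_on U f"
    "smooth_on (snd (ch x) ` U) (local_rep ch ch' f x)"
    using f by (rule smooth_nearE)
  show ?thesis
    by (rule that[of "U \<inter> V"])
       (use U V smooth_on_subset[OF U(6), of "snd (ch x) ` (U \<inter> V)"]
          continuous_on_subset[OF U(5), of "U \<inter> V"] in \<open>auto simp: image_mono\<close>)
qed

lemma smooth_map_imp_smooth_near:
  assumes ch: "atlas ch" and ch': "atlas ch'" and f: "smooth_map ch ch' f"
  shows "smooth_near ch ch' f x"
proof (rule smooth_nearI)
  have cont: "continuous_on UNIV f" using f by (simp add: smooth_map_def)
  show "open (fst (ch x) \<inter> f -` fst (ch' (f x)))"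
    by (intro open_Int open_chart[OF ch] open_vimage[OF open_chart[OF ch'] cont])
  show "continuous_on (fst (ch x) \<inter> f -` fst (ch' (f x))) f"
    using cont continuous_on_subset by blast
  show "smooth_on (snd (ch x) ` (fst (ch x) \<inter> f -` fst (ch' (f x)))) (local_rep ch ch' f x)"
    using f by (simp add: smooth_map_def local_rep_def)
qed (use mem_chart[OF ch] mem_chart[OF ch'] in auto)

text \<open>Near each point the representative in arbitrary charts \<open>p\<close>,
  \<open>q\<close> is the one in the distinguished charts, composed with a chart transition on
  either side.\<close>

lemma smooth_near_imp_smooth_map:
  assumes ch: "atlas ch" and ch': "atlas ch'" and f: "\<And>x. smooth_near ch ch' f x"
  shows "smooth_map ch ch' f"
proof -
  have "\<exists>U. open U \<and> x \<in> U \<and> continuous_on U f" for x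
    using f[of x] by (rule smooth_nearE) blast
  then obtain U where U: "\<And>x. open (U x)" "\<And>x. x \<in> U x" "\<And>x. continuous_on (U x) f" by metis
  have "continuous_on (\<Union>x\<in>UNIV. U x) f" by (rule continuous_on_open_UN) (use U in auto)
  moreover have "(\<Union>x\<in>UNIV. U x) = UNIV" using U(2) by blast
  ultimately have cont: "continuous_on UNIV f" by simp
  have "smooth_on (snd (ch p) ` (fst (ch p) \<inter> f -` fst (ch' q))) (snd (ch' q) \<circ> f \<circ> chart_inv (ch p))" for p q
  proof (rule smooth_on_local)
    fix y assume "y \<in> snd (ch p) ` (fst (ch p) \<inter> f -` fst (ch' q))"
    then obtain x where x: "x \<in> fst (ch p)" "f x \<in> fst (ch' q)" "y = snd (ch p) x" by blast
    have oW: "open (fst (ch p) \<inter> f -` fst (ch' q))"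
      by (intro open_Int open_chart[OF ch] open_vimage[OF open_chart[OF ch'] cont])
    obtain U where U: "open U" "x \<in> U" "U \<subseteq> fst (ch p) \<inter> f -` fst (ch' q)" "U \<subseteq> fst (ch x)"
      "f ` U \<subseteq> fst (ch' (f x))" "smooth_on (snd (ch x) ` U) (local_rep ch ch' f x)"
      by (rule smooth_near_restrict[OF ch f oW]) (use x in auto)
    have oU: "open (snd (ch p) ` U)" using U by (intro open_chart_image[OF ch]) auto
    have left: "chart_inv (ch p) (snd (ch p) z) = z" "chart_inv (ch x) (snd (ch x) z) = z"
      "chart_inv (ch' (f x)) (snd (ch' (f x)) (f z)) = f z" if "z \<in> U" for z
      using U that by (auto intro!: chart_inv_left[OF ch] chart_inv_left[OF ch'])
    have "smooth_on (snd (ch p) ` U) (\<lambda>y. (snd (ch x) \<circ> chart_inv (ch p)) y)"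
      by (rule smooth_on_subset[OF chart_transition[OF ch]]) (use U in auto)
    then have "smooth_on (snd (ch p) ` U) (\<lambda>y. local_rep ch ch' f x ((snd (ch x) \<circ> chart_inv (ch p)) y))"
      by (rule smooth_on_compose[OF atlas_finite_dimensional[OF ch] oU _ U(6)]) (auto simp: left)
    then have "smooth_on (snd (ch p) ` U) (\<lambda>y. (snd (ch' q) \<circ> chart_inv (ch' (f x)))
        (local_rep ch ch' f x ((snd (ch x) \<circ> chart_inv (ch p)) y)))"
      by (rule smooth_on_compose[OF atlas_finite_dimensional[OF ch'] oU _ chart_transition[OF ch']])
         (use U in \<open>auto simp: left local_rep_def image_subset_iff subset_iff intro!: imageI\<close>)
    then have "smooth_on (snd (ch p) ` U) (snd (ch' q) \<circ> f \<circ> chart_inv (ch p))"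
      by (rule smooth_on_cong[OF _ oU]) (auto simp: left local_rep_def)
    then show "\<exists>U. open U \<and> y \<in> U \<and> smooth_on U (snd (ch' q) \<circ> f \<circ> chart_inv (ch p))"
      using oU imageI[OF U(2), of "snd (ch p)"] unfolding x(3) by (intro exI conjI)
  qed
  with cont show ?thesis unfolding smooth_map_def by blast
qed

lemma local_rep_has_derivative:
  assumes ch: "atlas ch" and f: "smooth_near ch ch' f x"
  shows "(local_rep ch ch' f x has_derivative tangent_map ch ch' f x) (at (snd (ch x) x))"
  using f
proof (rule smooth_nearE)
  fix U assume U: "x \<in> U" "smooth_on (snd (ch x) ` U) (local_rep ch ch' f x)"
  show ?thesis
    using smooth_on_has_derivative[OF U(2)] U(1) by (simp add: tangent_map_def local_rep_def)
qed

lemma tangent_map_eqI: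
  "(local_rep ch ch' f x has_derivative D) (at (snd (ch x) x)) \<Longrightarrow> tangent_map ch ch' f x = D"
  by (simp add: tangent_map_def local_rep_def frechet_derivative_at[symmetric])

lemma tangent_map_linear:
  "atlas ch \<Longrightarrow> smooth_near ch ch' f x \<Longrightarrow> linear (tangent_map ch ch' f x)"
  using local_rep_has_derivative has_derivative_linear by blast

lemma
  assumes ch: "atlas ch" and ch': "atlas ch'"
    and f: "smooth_near ch ch' f x" and g: "smooth_near ch' ch'' g (f x)"
  shows smooth_near_compose: "smooth_near ch ch'' (\<lambda>x. g (f x)) x"
    and tangent_map_compose:
      "tangent_map ch ch'' (\<lambda>x. g (f x)) x v = tangent_map ch' ch'' g (f x) (tangent_map ch ch' f x v)"
proof -
  obtain V where V: "open V" "f x \<in> V" "V \<subseteq> fst (ch' (f x))" "g ` V \<subseteq> fst (ch'' (g (f x)))" "continuous_on V g"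
    "smooth_on (snd (ch' (f x)) ` V) (local_rep ch' ch'' g (f x))"
    using g by (rule smooth_nearE)
  obtain U0 where U0: "open U0" "x \<in> U0" "U0 \<subseteq> fst (ch x)" "f ` U0 \<subseteq> fst (ch' (f x))" "continuous_on U0 f"
    "smooth_on (snd (ch x) ` U0) (local_rep ch ch' f x)"
    using f by (rule smooth_nearE)
  define U where "U = f -` V \<inter> U0"
  have oU: "open U" unfolding U_def using U0 V continuous_on_open_vimage by blast
  have U: "x \<in> U" "U \<subseteq> U0" "f ` U \<subseteq> V" using U0 V by (auto simp: U_def)
  have oI: "open (snd (ch x) ` U)" using oU U U0 by (intro open_chart_image[OF ch]) auto
  have rep: "local_rep ch' ch'' g (f x) (local_rep ch ch' f x y) = local_rep ch ch'' (\<lambda>x. g (f x)) x y"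
    if "y \<in> snd (ch x) ` U" for y
  proof -
    from that obtain z where z: "z \<in> U" "y = snd (ch x) z" by blast
    then have "chart_inv (ch x) y = z" using U U0 by (auto intro!: chart_inv_left[OF ch])
    moreover have "chart_inv (ch' (f x)) (snd (ch' (f x)) (f z)) = f z"
      using z U V by (intro chart_inv_left[OF ch']) auto
    ultimately show ?thesis by (simp add: local_rep_def)
  qed
  have "smooth_on (snd (ch x) ` U) (\<lambda>y. local_rep ch' ch'' g (f x) (local_rep ch ch' f x y))"
  proof (rule smooth_on_compose[OF atlas_finite_dimensional[OF ch'] oI _ V(6)])
    show "smooth_on (snd (ch x) ` U) (local_rep ch ch' f x)"
      using U by (intro smooth_on_subset[OF U0(6)]) auto
    have "chart_inv (ch x) (snd (ch x) z) = z" if "z \<in> U" for z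
      using that U U0 by (auto intro!: chart_inv_left[OF ch])
    then show "local_rep ch ch' f x ` snd (ch x) ` U \<subseteq> snd (ch' (f x)) ` V"
      using U by (auto simp: local_rep_def)
  qed
  then have sm: "smooth_on (snd (ch x) ` U) (local_rep ch ch'' (\<lambda>x. g (f x)) x)"
    by (rule smooth_on_cong[OF _ oI rep])
  show "smooth_near ch ch'' (\<lambda>x. g (f x)) x"
  proof (rule smooth_nearI[OF oU U(1) _ _ _ sm])
    show "continuous_on U (\<lambda>x. g (f x))"
      by (rule continuous_on_compose2[OF V(5) continuous_on_subset[OF U0(5) U(2)] U(3)])
  qed (use U U0 V in \<open>auto simp: image_subset_iff subset_iff\<close>)
  have fx: "local_rep ch ch' f x (snd (ch x) x) = snd (ch' (f x)) (f x)"
    by (simp add: local_rep_def chart_inv_left[OF ch mem_chart[OF ch]])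
  have "((\<lambda>y. local_rep ch' ch'' g (f x) (local_rep ch ch' f x y)) has_derivative
      (\<lambda>v. tangent_map ch' ch'' g (f x) (tangent_map ch ch' f x v))) (at (snd (ch x) x))"
    using diff_chain_at[OF local_rep_has_derivative[OF ch f], unfolded fx, OF local_rep_has_derivative[OF ch' g]]
    by (simp add: o_def)
  then have "(local_rep ch ch'' (\<lambda>x. g (f x)) x has_derivative
      (\<lambda>v. tangent_map ch' ch'' g (f x) (tangent_map ch ch' f x v))) (at (snd (ch x) x))"
    by (rule has_derivative_transform_within_open[OF _ oI]) (use U rep in auto)
  then show "tangent_map ch ch'' (\<lambda>x. g (f x)) x v = tangent_map ch' ch'' g (f x) (tangent_map ch ch' f x v)"
    by (simp add: tangent_map_eqI)
qed

lemma
  assumes ch: "atlas ch" and ch': "atlas ch'" and ch'': "atlas ch''"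
    and f: "smooth_near ch ch' f x" and g: "smooth_near ch ch'' g x"
  shows smooth_near_Pair: "smooth_near ch (prod_charts ch' ch'') (\<lambda>x. (f x, g x)) x"
    and tangent_map_Pair: "tangent_map ch (prod_charts ch' ch'') (\<lambda>x. (f x, g x)) x v
      = (tangent_map ch ch' f x v, tangent_map ch ch'' g x v)"
proof -
  obtain V where V: "open V" "x \<in> V" "g ` V \<subseteq> fst (ch'' (g x))" "continuous_on V g"
    "smooth_on (snd (ch x) ` V) (local_rep ch ch'' g x)"
    using g by (rule smooth_nearE)
  obtain U where U: "open U" "x \<in> U" "U \<subseteq> V" "U \<subseteq> fst (ch x)" "f ` U \<subseteq> fst (ch' (f x))" "continuous_on U f"
    "smooth_on (snd (ch x) ` U) (local_rep ch ch' f x)"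
    using smooth_near_restrict[OF ch f V(1,2)] .
  have rep: "local_rep ch (prod_charts ch' ch'') (\<lambda>x. (f x, g x)) x
      = (\<lambda>y. (local_rep ch ch' f x y, local_rep ch ch'' g x y))"
    by (auto simp: local_rep_def)
  show "smooth_near ch (prod_charts ch' ch'') (\<lambda>x. (f x, g x)) x"
  proof (rule smooth_nearI[where U = U])
    show "continuous_on U (\<lambda>x. (f x, g x))"
      using U(3,6) V(4) by (intro continuous_on_Pair) (auto intro: continuous_on_subset)
    show "smooth_on (snd (ch x) ` U) (local_rep ch (prod_charts ch' ch'') (\<lambda>x. (f x, g x)) x)"
      unfolding rep
      by (intro smooth_on_Pair open_chart_image[OF ch] U smooth_on_subset[OF V(5)] image_mono)
  qed (use U V in \<open>auto simp: image_subset_iff subset_iff\<close>)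
  show "tangent_map ch (prod_charts ch' ch'') (\<lambda>x. (f x, g x)) x v
      = (tangent_map ch ch' f x v, tangent_map ch ch'' g x v)"
    by (subst tangent_map_eqI[of _ _ _ _ "\<lambda>v. (tangent_map ch ch' f x v, tangent_map ch ch'' g x v)"])
       (auto simp: rep intro!: has_derivative_Pair local_rep_has_derivative ch f g)
qed

lemma
  assumes ch: "atlas ch"
  shows smooth_near_ident: "smooth_near ch ch (\<lambda>x. x) x"
    and tangent_map_ident: "tangent_map ch ch (\<lambda>x. x) x v = v"
proof -
  have eq: "y = local_rep ch ch (\<lambda>x. x) x y" if "y \<in> snd (ch x) ` fst (ch x)" for y
    using that chart_inv_left[OF ch] by (auto simp: local_rep_def)
  show "smooth_near ch ch (\<lambda>x. x) x"
    by (rule smooth_nearI[OF open_chart[OF ch] mem_chart[OF ch] _ _ _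
          smooth_on_cong[OF smooth_on_ident open_chart_range[OF ch] eq]]) auto
  have "(local_rep ch ch (\<lambda>x. x) x has_derivative (\<lambda>v. v)) (at (snd (ch x) x))"
    by (rule has_derivative_transform_within_open[OF has_derivative_ident open_chart_range[OF ch] _ eq])
       (use mem_chart[OF ch] in auto)
  then show "tangent_map ch ch (\<lambda>x. x) x v = v" by (simp add: tangent_map_eqI)
qed

lemma
  assumes ch: "atlas ch" and ch': "atlas ch'"
  shows smooth_near_const: "smooth_near ch ch' (\<lambda>_. c) x"
    and tangent_map_const: "tangent_map ch ch' (\<lambda>_. c) x v = 0"
proof -
  have rep: "local_rep ch ch' (\<lambda>_. c) x = (\<lambda>_. snd (ch' c) c)" by (auto simp: local_rep_def)
  show "smooth_near ch ch' (\<lambda>_. c) x"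
    by (rule smooth_nearI[OF open_chart[OF ch] mem_chart[OF ch]])
       (auto simp: rep mem_chart[OF ch'] smooth_on_const)
  show "tangent_map ch ch' (\<lambda>_. c) x v = 0"
    by (subst tangent_map_eqI[where D = "\<lambda>_. 0"]) (auto simp: rep)
qed

lemma
  assumes ch: "atlas ch" and ch': "atlas ch'"
  shows smooth_near_fst: "smooth_near (prod_charts ch ch') ch fst z"
    and smooth_near_snd: "smooth_near (prod_charts ch ch') ch' snd z"
proof -
  note prod = atlas_prod_charts[OF ch ch']
  note I = smooth_nearI[where U = "fst (prod_charts ch ch' z)" and x = z and ch = "prod_charts ch ch'", OF open_chart[OF prod, of z] mem_chart[OF prod] subset_refl]
  note left = chart_inv_left[OF ch] chart_inv_left[OF ch'] chart_inv_prod_charts[OF ch ch']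
  show "smooth_near (prod_charts ch ch') ch fst z"
    by (rule I[OF _ _ smooth_on_cong[OF smooth_on_bounded_linear[OF open_chart_range[OF prod]
              bounded_linear_fst smooth_on_ident] open_chart_range[OF prod]]])
       (auto simp: local_rep_def left intro!: continuous_intros)
  show "smooth_near (prod_charts ch ch') ch' snd z"
    by (rule I[OF _ _ smooth_on_cong[OF smooth_on_bounded_linear[OF open_chart_range[OF prod]
              bounded_linear_snd smooth_on_ident] open_chart_range[OF prod]]])
       (auto simp: local_rep_def left intro!: continuous_intros)
qed

lemma smooth_near_vector_charts_iff:
  "smooth_near vector_charts vector_charts f x \<longleftrightarrow> (\<exists>U. open U \<and> x \<in> U \<and> smooth_on U f)"
  unfolding smooth_near_def local_rep_def using smooth_on_continuous by auto

lemma smooth_fun_vector_charts_iff: "smooth_fun vector_charts f \<longleftrightarrow> smooth_on UNIV f"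
  unfolding smooth_fun_def smooth_map_def using smooth_on_continuous by auto

lemma tangent_map_vector_charts: "tangent_map vector_charts vector_charts f x = frechet_derivative f (at x)"
  by (simp add: tangent_map_def)

subsection \<open>Homomorphisms from the real line\<close>

context group
begin

abbreviation square :: "'a \<Rightarrow> 'a" where "square x \<equiv> f x x"

text \<open>\<open>square ^^ k\<close> is the power with exponent \<open>2 ^ k\<close>, which is
  multiplicative on commuting elements. Commutation is inherited by the squares, and this carries
  the induction.\<close>

lemma square_power_mult:
  assumes "f x y = f y x"
  shows "(square ^^ k) (f x y) = f ((square ^^ k) x) ((square ^^ k) y)"
  using assms
proof (induction k arbitrary: x y)
  case (Suc k)
  have comm: "f (square x) (square y) = f (square y) (square x)"
    using Suc.prems by (metis assoc)
  have "square (f x y) = f (square x) (square y)"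
    using Suc.prems by (metis assoc)
  then show ?case
    using Suc.IH[OF comm] by (simp add: funpow_Suc_right del: funpow.simps)
qed simp

lemma real_hom_eq_square_power:
  assumes "\<And>s t :: real. \<gamma> (s + t) = f (\<gamma> s) (\<gamma> t)"
  shows "\<gamma> t = (square ^^ k) (\<gamma> (t / 2 ^ k))"
proof (induction k arbitrary: t)
  case (Suc k)
  have "\<gamma> (t / 2 ^ k) = square (\<gamma> (t / 2 ^ Suc k))"
    using assms[of "t / 2 ^ Suc k" "t / 2 ^ Suc k"] by simp
  then show ?case using Suc[of t] by (simp add: funpow_Suc_right del: funpow.simps)
qed simp

text \<open>Every real number enters the interval of agreement after enough halvings, and the value
  at \<open>t\<close> is an iterated square of the value at \<open>t / 2 ^ k\<close>.\<close>

lemma real_hom_eqI: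
  assumes "\<And>s t :: real. \<gamma> (s + t) = f (\<gamma> s) (\<gamma> t)" "\<And>s t :: real. \<gamma>' (s + t) = f (\<gamma>' s) (\<gamma>' t)"
    and "e > 0" "\<And>t. \<bar>t\<bar> < e \<Longrightarrow> \<gamma> t = \<gamma>' t"
  shows "\<gamma> = \<gamma>'"
proof
  fix t
  obtain k where "\<bar>t\<bar> / e < 2 ^ k" using real_arch_pow[of 2] by auto
  then have "\<bar>t / 2 ^ k\<bar> < e" using assms(3) by (simp add: field_simps abs_divide)
  then show "\<gamma> t = \<gamma>' t"
    using real_hom_eq_square_power[of \<gamma> t k] real_hom_eq_square_power[of \<gamma>' t k] assms by metis
qed

text \<open>The extension is \<open>t \<mapsto> g (t / 2 ^ k) ^ (2 ^ k)\<close>, which does not depend on the large number \<open>k\<close>.\<close>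

lemma local_real_hom_extends:
  assumes e: "e > 0"
    and hom: "\<And>s t :: real. \<bar>s\<bar> < e \<Longrightarrow> \<bar>t\<bar> < e \<Longrightarrow> g (s + t) = f (g s) (g t)"
  obtains \<gamma> where "\<And>s t. \<gamma> (s + t) = f (\<gamma> s) (\<gamma> t)" "\<And>t. \<bar>t\<bar> < e \<Longrightarrow> \<gamma> t = g t"
proof -
  define P where "P k t = (square ^^ k) (g (t / 2 ^ k))" for k and t :: real
  define K where "K t = (LEAST k. \<bar>t\<bar> < e * 2 ^ k)" for t :: real
  define \<gamma> where "\<gamma> t = P (K t) t" for t
  have Kt: "\<bar>t\<bar> < e * 2 ^ K t" for t
  proof -
    obtain k where "\<bar>t\<bar> / e < 2 ^ k" using real_arch_pow[of 2] by auto
    then have "\<bar>t\<bar> < e * 2 ^ k" using e by (simp add: field_simps)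
    then show ?thesis unfolding K_def by (rule LeastI)
  qed
  have small: "\<bar>t / 2 ^ k\<bar> < e" if "k \<ge> K t" for k t
  proof -
    have "e * 2 ^ K t \<le> e * 2 ^ k" using e that by (intro mult_left_mono power_increasing) auto
    then show ?thesis using Kt[of t] by (simp add: abs_divide divide_less_eq)
  qed
  \<comment> \<open>Passing from \<open>k\<close> to \<open>k + 1\<close> changes nothing: by the
    local homomorphism property one squaring undoes one halving.\<close>
  have P: "P k t = \<gamma> t" if "k \<ge> K t" for k t
    using that
  proof (induction k rule: dec_induct)
    case base
    then show ?case by (simp add: \<gamma>_def)
  next
    case (step k)
    have "\<bar>t / 2 ^ Suc k\<bar> < e" using step.hyps by (intro small) auto
    then have "square (g (t / 2 ^ Suc k)) = g (t / 2 ^ k)"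
      using hom[of "t / 2 ^ Suc k" "t / 2 ^ Suc k"] by simp
    then show ?case using step.IH by (simp add: P_def funpow_Suc_right del: funpow.simps)
  qed
  show ?thesis
  proof (rule that)
    fix s t
    define k where "k = max (K (s + t)) (max (K s) (K t))"
    have k: "k \<ge> K (s + t)" "k \<ge> K s" "k \<ge> K t" by (auto simp: k_def)
    \<comment> \<open>The two factors commute because both of their products equal
      \<open>g ((s + t) / 2 ^ k)\<close>.\<close>
    have st: "f (g (s / 2 ^ k)) (g (t / 2 ^ k)) = g ((s + t) / 2 ^ k)"
      using hom[OF small[OF k(2)] small[OF k(3)]] by (simp add: add_divide_distrib)
    also have "\<dots> = f (g (t / 2 ^ k)) (g (s / 2 ^ k))"
      using hom[OF small[OF k(3)] small[OF k(2)]] by (simp add: add_divide_distrib add.commute)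
    finally have comm: "f (g (s / 2 ^ k)) (g (t / 2 ^ k)) = f (g (t / 2 ^ k)) (g (s / 2 ^ k))" .
    have "\<gamma> (s + t) = P k (s + t)" using P k by simp
    also have "\<dots> = f (P k s) (P k t)"
      unfolding P_def st[symmetric] by (rule square_power_mult[OF comm])
    finally show "\<gamma> (s + t) = f (\<gamma> s) (\<gamma> t)" using P k by simp
  next
    fix t assume "\<bar>t\<bar> < e"
    then have "K t = 0" unfolding K_def by (intro Least_equality) auto
    then show "\<gamma> t = g t" by (simp add: \<gamma>_def P_def)
  qed
qed

end

subsection \<open>One-parameter subgroups\<close>

context lie_group
begin

abbreviation "\<phi> \<equiv> snd (ch gunit)"
abbreviation "\<psi> \<equiv> chart_inv (ch gunit)"

lemma atlas_ch: "atlas ch"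
  by (rule smooth_manifold_imp_atlas[OF manifold])

lemmas finite_dimensional_model = atlas_finite_dimensional[OF atlas_ch]

lemma atlas_real: "atlas (vector_charts :: real \<Rightarrow> _)"
  by (rule atlas_vector_charts[OF finite_dimensional_real])

lemma smooth_near_mult:
  assumes "atlas C" "smooth_near C ch u x" "smooth_near C ch v x"
  shows "smooth_near C ch (\<lambda>x. u x \<cdot> v x) x"
proof -
  note prod = atlas_prod_charts[OF atlas_ch atlas_ch]
  show ?thesis
    using smooth_near_compose[OF assms(1) prod smooth_near_Pair[OF assms(1) atlas_ch atlas_ch assms(2,3)]
        smooth_map_imp_smooth_near[OF prod atlas_ch smooth_mult]] by simp
qed

lemma smooth_near_ginv:
  assumes "atlas C" "smooth_near C ch u x"
  shows "smooth_near C ch (\<lambda>x. ginv (u x)) x"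
  by (rule smooth_near_compose[OF assms(1) atlas_ch assms(2)
        smooth_map_imp_smooth_near[OF atlas_ch atlas_ch smooth_ginv]])

lemma smooth_near_ch_const: "atlas C \<Longrightarrow> smooth_near C ch (\<lambda>_. g) x"
  by (rule smooth_near_const[OF _ atlas_ch])

lemma continuous_on_group_mult:
  assumes "continuous_on T u" "continuous_on T v"
  shows "continuous_on T (\<lambda>x. u x \<cdot> v x)"
proof -
  have "continuous_on UNIV (\<lambda>(g, h). g \<cdot> h)" using smooth_mult by (simp add: smooth_map_def)
  from continuous_on_compose2[OF this continuous_on_Pair[OF assms]] show ?thesis by simp
qed

section \<open>Multiplication near the unit and left invariant fields\<close>

definition unit_rep :: "'a \<times> 'a \<Rightarrow> 'a" where
  "unit_rep z = \<phi> (\<psi> (fst z) \<cdot> \<psi> (snd z))"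

text \<open>Products of elements of \<open>A\<close> only have to stay in the chart domain, which is
  enough to differentiate \<open>\<phi> (g \<cdot> h)\<close>. Where the product must return to
  \<open>A\<close>, this is assumed separately.\<close>

definition unit_nbhd :: "'g set \<Rightarrow> bool" where
  "unit_nbhd A \<longleftrightarrow> open A \<and> gunit \<in> A \<and> A \<subseteq> fst (ch gunit) \<and> (\<forall>g\<in>A. \<forall>h\<in>A. g \<cdot> h \<in> fst (ch gunit)) \<and>
     smooth_on ((\<phi> ` A) \<times> (\<phi> ` A)) unit_rep"

text \<open>The left invariant vector field with value \<open>\<xi>\<close> at the unit, in the chart at the unit.\<close>

definition left_field :: "'a \<Rightarrow> 'a \<Rightarrow> 'a" where
  "left_field \<xi> x = frechet_derivative unit_rep (at (x, \<phi> gunit)) (0, \<xi>)"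

lemma unit_nbhd_exists: "\<exists>A. unit_nbhd A"
proof -
  note prod = atlas_prod_charts[OF atlas_ch atlas_ch]
  have "smooth_near (prod_charts ch ch) ch (\<lambda>(g, h). g \<cdot> h) (gunit, gunit)"
    by (rule smooth_map_imp_smooth_near[OF prod atlas_ch smooth_mult])
  then obtain U where U: "open U" "(gunit, gunit) \<in> U" "U \<subseteq> fst (ch gunit) \<times> fst (ch gunit)"
      "(\<lambda>(g, h). g \<cdot> h) ` U \<subseteq> fst (ch gunit)"
      "smooth_on (map_prod \<phi> \<phi> ` U) (local_rep (prod_charts ch ch) ch (\<lambda>(g, h). g \<cdot> h) (gunit, gunit))"
    by (rule smooth_nearE) simp
  obtain A1 A2 where A12: "open A1" "open A2" "(gunit, gunit) \<in> A1 \<times> A2" "A1 \<times> A2 \<subseteq> U"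
    using open_prod_elim[OF U(1,2)] by metis
  define A where "A = A1 \<inter> A2"
  have A: "open A" "gunit \<in> A" "A \<times> A \<subseteq> U" using A12 by (auto simp: A_def)
  have AD: "A \<subseteq> fst (ch gunit)" using A U by blast
  have oA: "open ((\<phi> ` A) \<times> (\<phi> ` A))"
    by (intro open_Times open_chart_image[OF atlas_ch] A AD)
  have "smooth_on ((\<phi> ` A) \<times> (\<phi> ` A)) unit_rep"
  proof (rule smooth_on_cong[OF smooth_on_subset[OF U(5)] oA])
    show "(\<phi> ` A) \<times> (\<phi> ` A) \<subseteq> map_prod \<phi> \<phi> ` U"
      using image_mono[OF A(3), of "map_prod \<phi> \<phi>"] by (simp add: map_prod_image_Times)
    show "local_rep (prod_charts ch ch) ch (\<lambda>(g, h). g \<cdot> h) (gunit, gunit) z = unit_rep z"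
      if "z \<in> (\<phi> ` A) \<times> (\<phi> ` A)" for z
      using that AD chart_inv_prod_charts[OF atlas_ch atlas_ch, of _ "(gunit, gunit)"]
      by (auto simp: local_rep_def unit_rep_def subset_iff)
  qed
  moreover have "g \<cdot> h \<in> fst (ch gunit)" if "g \<in> A" "h \<in> A" for g h using A U(4) that by blast
  ultimately show ?thesis using A AD unfolding unit_nbhd_def by blast
qed

lemma lie_chart_inv_left: "g \<in> fst (ch gunit) \<Longrightarrow> \<psi> (\<phi> g) = g"
  by (rule chart_inv_left[OF atlas_ch])

context
  fixes A assumes A: "unit_nbhd A"
begin

lemma unit_nbhdD:
  "open A" "gunit \<in> A" "A \<subseteq> fst (ch gunit)" "g \<in> A \<Longrightarrow> h \<in> A \<Longrightarrow> g \<cdot> h \<in> fst (ch gunit)"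
  "smooth_on ((\<phi> ` A) \<times> (\<phi> ` A)) unit_rep" "g \<in> A \<Longrightarrow> \<psi> (\<phi> g) = g"
  using A lie_chart_inv_left unfolding unit_nbhd_def by blast+

lemma open_unit_nbhd_image: "open (\<phi> ` A)"
  by (intro open_chart_image[OF atlas_ch] unit_nbhdD)

text \<open>Tangent vectors are handled as velocities of curves in the group, so that identities
  between products become identities between derivatives by uniqueness of the derivative.\<close>

lemma mult_curve_derivative:
  assumes g: "g \<in> A" and T: "open T" "t0 \<in> T" "c ` T \<subseteq> A"
    and c: "((\<lambda>s. \<phi> (c s)) has_vector_derivative v) (at t0)"
  shows "((\<lambda>s. \<phi> (g \<cdot> c s)) has_vector_derivative
    frechet_derivative unit_rep (at (\<phi> g, \<phi> (c t0))) (0, v)) (at t0)"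
proof -
  have "((\<lambda>s. (\<phi> g, \<phi> (c s))) has_vector_derivative (0, v)) (at t0)"
    using has_vector_derivative_Pair[OF has_vector_derivative_const c] .
  then have "((\<lambda>s. unit_rep (\<phi> g, \<phi> (c s))) has_vector_derivative
      frechet_derivative unit_rep (at (\<phi> g, \<phi> (c t0))) (0, v)) (at t0)"
    by (rule has_vector_derivative_compose_has_derivative[OF _ smooth_on_has_derivative[OF unit_nbhdD(5)]])
       (use g T in auto)
  then show ?thesis
    unfolding has_vector_derivative_def
  proof (rule has_derivative_transform_within_open[OF _ T(1,2)])
    show "unit_rep (\<phi> g, \<phi> (c s)) = \<phi> (g \<cdot> c s)" if "s \<in> T" for s
      using that T g by (auto simp: unit_rep_def unit_nbhdD(6))
  qed
qed

text \<open>Pulling a straight line in the chart back to the group realises every tangent vector at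
  the unit as a velocity.\<close>

lemma straight_curve:
  obtains T c where "open T" "(0::real) \<in> T" "c ` T \<subseteq> A" "continuous_on T c" "c 0 = gunit"
    "((\<lambda>s. \<phi> (c s)) has_vector_derivative v) (at 0)"
proof -
  define T where "T = (\<lambda>s. \<phi> gunit + s *\<^sub>R v) -` (\<phi> ` A)"
  define c where "c s = \<psi> (\<phi> gunit + s *\<^sub>R v)" for s
  have T: "open T" unfolding T_def
    by (rule open_vimage[OF open_unit_nbhd_image]) (intro continuous_intros)
  have 0: "0 \<in> T" using unit_nbhdD by (simp add: T_def)
  have c: "c s \<in> A \<and> \<phi> (c s) = \<phi> gunit + s *\<^sub>R v" if "s \<in> T" for s
  proof -
    from that have "\<phi> gunit + s *\<^sub>R v \<in> \<phi> ` A" by (simp add: T_def)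
    then obtain g where "g \<in> A" "\<phi> gunit + s *\<^sub>R v = \<phi> g" by blast
    then show ?thesis by (simp add: c_def unit_nbhdD(6))
  qed
  have "continuous_on T c" unfolding c_def
    by (rule continuous_on_compose2[OF continuous_on_chart_inv[OF atlas_ch]])
       (use unit_nbhdD(3) in \<open>auto intro!: continuous_intros simp: T_def\<close>)
  moreover have "((\<lambda>s. \<phi> (c s)) has_vector_derivative v) (at 0)"
  proof -
    have "((\<lambda>s. \<phi> gunit + s *\<^sub>R v) has_derivative (\<lambda>h. h *\<^sub>R v)) (at 0)"
      by (auto intro!: derivative_eq_intros)
    then show ?thesis
      unfolding has_vector_derivative_def
      by (rule has_derivative_transform_within_open[OF _ T 0]) (use c in auto)
  qed
  moreover have "c 0 = gunit" by (simp add: c_def unit_nbhdD)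
  moreover have "c ` T \<subseteq> A" using c by blast
  ultimately show ?thesis by (intro that[OF T 0])
qed

lemma left_field_smooth: "smooth_on (\<phi> ` A) (left_field \<xi>)"
proof -
  have "smooth_on (\<phi> ` A) (\<lambda>x. (x, \<phi> gunit))"
    by (intro smooth_on_Pair open_unit_nbhd_image smooth_on_ident smooth_on_const)
  then show ?thesis
    unfolding left_field_def
    by (rule smooth_on_compose[OF finite_dimensional_prod[OF finite_dimensional_model finite_dimensional_model]
          open_unit_nbhd_image _ smooth_on_frechet_derivative[OF unit_nbhdD(5)]])
       (use unit_nbhdD in auto)
qed

lemma left_field_curve:
  assumes "g \<in> A" "open T" "t0 \<in> T" "c ` T \<subseteq> A" "c t0 = gunit"
    and "((\<lambda>s. \<phi> (c s)) has_vector_derivative \<xi>) (at t0)"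
  shows "((\<lambda>s. \<phi> (g \<cdot> c s)) has_vector_derivative left_field \<xi> (\<phi> g)) (at t0)"
  using mult_curve_derivative[OF assms(1-4,6)] assms(5) by (simp add: left_field_def)

lemma left_field_unit: "left_field \<xi> (\<phi> gunit) = \<xi>"
proof -
  obtain T c where T: "open T" "(0::real) \<in> T" "c ` T \<subseteq> A" "continuous_on T c" "c 0 = gunit"
    "((\<lambda>s. \<phi> (c s)) has_vector_derivative \<xi>) (at 0)" by (rule straight_curve)
  have "((\<lambda>s. \<phi> (c s)) has_vector_derivative left_field \<xi> (\<phi> gunit)) (at 0)"
    using left_field_curve[OF unit_nbhdD(2) T(1-3,5,6)] by simp
  then show ?thesis using T(6) by (rule vector_derivative_unique_at)
qed

text \<open>Associativity differentiated: for a curve \<open>c\<close> through the unit with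
  velocity \<open>\<xi>\<close>, the curve of products of \<open>g\<close>, \<open>h\<close> and
  \<open>c s\<close> is read once as a translate by \<open>g\<close> and once as a translate by
  \<open>g \<cdot> h\<close>.\<close>

lemma left_field_invariant:
  assumes gh: "g \<in> A" "h \<in> A" "g \<cdot> h \<in> A"
  shows "frechet_derivative unit_rep (at (\<phi> g, \<phi> h)) (0, left_field \<xi> (\<phi> h)) = left_field \<xi> (\<phi> (g \<cdot> h))"
proof -
  obtain T c where T: "open T" "(0::real) \<in> T" "c ` T \<subseteq> A" "continuous_on T c" "c 0 = gunit"
    "((\<lambda>s. \<phi> (c s)) has_vector_derivative \<xi>) (at 0)" by (rule straight_curve)
  have cont: "continuous_on T (\<lambda>s. h \<cdot> c s)" by (intro continuous_on_group_mult continuous_on_const T)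
  define T' where "T' = (\<lambda>s. h \<cdot> c s) -` A \<inter> T"
  have T': "open T'" "0 \<in> T'"
    using cont T unit_nbhdD(1) gh continuous_on_open_vimage[OF T(1)] by (auto simp: T'_def)
  have 1: "((\<lambda>s. \<phi> (g \<cdot> (h \<cdot> c s))) has_vector_derivative
      frechet_derivative unit_rep (at (\<phi> g, \<phi> (h \<cdot> c 0))) (0, left_field \<xi> (\<phi> h))) (at 0)"
    by (rule mult_curve_derivative[OF gh(1) T' _ left_field_curve[OF gh(2) T(1-3,5,6)]])
       (auto simp: T'_def)
  have 2: "((\<lambda>s. \<phi> ((g \<cdot> h) \<cdot> c s)) has_vector_derivative left_field \<xi> (\<phi> (g \<cdot> h))) (at 0)"
    by (rule left_field_curve[OF gh(3) T(1-3,5,6)])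
  show ?thesis
    using vector_derivative_unique_at[OF 1 2[unfolded assoc]] by (simp add: T(5))
qed

end

section \<open>One-parameter subgroups as integral curves\<close>

lemma smooth_near_curve_derivative:
  assumes "smooth_near vector_charts ch \<gamma> t"
  shows "((\<lambda>s. snd (ch (\<gamma> t)) (\<gamma> s)) has_vector_derivative tangent_map vector_charts ch \<gamma> t 1) (at t)"
proof -
  have d: "((\<lambda>s. snd (ch (\<gamma> t)) (\<gamma> s)) has_derivative tangent_map vector_charts ch \<gamma> t) (at t)"
    using local_rep_has_derivative[OF atlas_real assms] by (simp add: local_rep_def o_def)
  show ?thesis
    using has_vector_derivative_compose_has_derivative[of "\<lambda>s. s" 1 t, OF _ d] by simp
qed

lemma one_parameter_subgroup_unit: "one_parameter_subgroup \<xi> \<gamma> \<Longrightarrow> \<gamma> 0 = gunit"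
  unfolding one_parameter_subgroup_def by (metis add_0 left_cancel right_neutral)

lemma one_parameter_subgroup_derivative:
  assumes "one_parameter_subgroup \<xi> \<gamma>"
  shows "((\<lambda>s. \<phi> (\<gamma> s)) has_vector_derivative \<xi>) (at 0)"
proof -
  have "smooth_near vector_charts ch \<gamma> 0"
    using assms smooth_map_imp_smooth_near[OF atlas_real atlas_ch] by (simp add: one_parameter_subgroup_def)
  from smooth_near_curve_derivative[OF this] show ?thesis
    using assms by (simp add: one_parameter_subgroup_unit one_parameter_subgroup_def)
qed

lemma one_parameter_subgroup_continuous:
  "one_parameter_subgroup \<xi> \<gamma> \<Longrightarrow> continuous_on T \<gamma>"
  unfolding one_parameter_subgroup_def smooth_map_def by (meson continuous_on_subset subset_UNIV)

text \<open>Since \<open>\<gamma> s = \<gamma> t \<cdot> \<gamma> (s - t)\<close>, the velocity at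
  time \<open>t\<close> is the left translate by \<open>\<gamma> t\<close> of the velocity at time
  0.\<close>

lemma one_parameter_subgroup_ode:
  assumes A: "unit_nbhd A" and \<gamma>: "one_parameter_subgroup \<xi> \<gamma>" and t: "\<gamma> t \<in> A"
  shows "((\<lambda>s. \<phi> (\<gamma> s)) has_vector_derivative left_field \<xi> (\<phi> (\<gamma> t))) (at t)"
proof -
  define T where "T = (\<lambda>s. \<gamma> (s - t)) -` A"
  have T: "open T" unfolding T_def
    by (rule open_vimage[OF unit_nbhdD(1)[OF A]])
       (auto intro!: continuous_on_compose2[OF one_parameter_subgroup_continuous[OF \<gamma>, of UNIV]] continuous_intros)
  have tT: "t \<in> T" using one_parameter_subgroup_unit[OF \<gamma>] unit_nbhdD(2)[OF A] by (simp add: T_def)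
  have "((\<lambda>s. s - t) has_derivative (\<lambda>h. h)) (at t)" by (auto intro!: derivative_eq_intros)
  from has_derivative_compose[OF this, of "\<lambda>s. \<phi> (\<gamma> s)" "\<lambda>h. h *\<^sub>R \<xi>"]
  have d: "((\<lambda>s. \<phi> (\<gamma> (s - t))) has_vector_derivative \<xi>) (at t)"
    using one_parameter_subgroup_derivative[OF \<gamma>] by (simp add: has_vector_derivative_def)
  have "\<gamma> t \<cdot> \<gamma> (s - t) = \<gamma> s" for s
    using \<gamma> unfolding one_parameter_subgroup_def by (metis add.commute diff_add_cancel)
  then show ?thesis
    using left_field_curve[OF A t T tT _ _ d] one_parameter_subgroup_unit[OF \<gamma>] by (simp add: T_def)
qed

text \<open>On a ball where the left invariant field is Lipschitz both curves solve the same
  equation, so they agree for short times; \<open>real_hom_eqI\<close> spreads the agreement over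
  the line.\<close>

lemma one_parameter_subgroup_unique:
  assumes \<gamma>: "one_parameter_subgroup \<xi> \<gamma>" and \<gamma>': "one_parameter_subgroup \<xi> \<gamma>'"
  shows "\<gamma> = \<gamma>'"
proof -
  obtain A where A: "unit_nbhd A" using unit_nbhd_exists by blast
  have x0: "\<phi> gunit \<in> \<phi> ` A" using unit_nbhdD(2)[OF A] by blast
  obtain r L where rL: "r > 0" "L \<ge> 0" "cball (\<phi> gunit) r \<subseteq> \<phi> ` A"
    "\<And>x y. x \<in> cball (\<phi> gunit) r \<Longrightarrow> y \<in> cball (\<phi> gunit) r \<Longrightarrow>
      norm (left_field \<xi> x - left_field \<xi> y) \<le> L * norm (x - y)"
    by (rule smooth_on_locally_lipschitz[OF finite_dimensional_model open_unit_nbhd_image[OF A] x0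
          left_field_smooth[OF A, of \<xi>]], rule that; assumption)
  define W where "W = A \<inter> \<phi> -` (ball (\<phi> gunit) r)"
  have "open (\<phi> -` (ball (\<phi> gunit) r) \<inter> A)"
    by (rule continuous_on_open_vimage[OF unit_nbhdD(1)[OF A], THEN iffD1, rule_format, OF _ open_ball])
       (rule continuous_on_subset[OF continuous_on_chart[OF atlas_ch] unit_nbhdD(3)[OF A]])
  then have W: "open W" "gunit \<in> W"
    using unit_nbhdD(2)[OF A] rL(1) by (simp_all add: W_def Int_commute)
  have "open (\<gamma> -` W \<inter> \<gamma>' -` W)"
    by (intro open_Int open_vimage W one_parameter_subgroup_continuous[OF \<gamma>] one_parameter_subgroup_continuous[OF \<gamma>'])
  moreover have "0 \<in> \<gamma> -` W \<inter> \<gamma>' -` W"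
    using one_parameter_subgroup_unit[OF \<gamma>] one_parameter_subgroup_unit[OF \<gamma>'] W by simp
  ultimately obtain d where d: "d > 0" "ball 0 d \<subseteq> \<gamma> -` W \<inter> \<gamma>' -` W"
    by (rule openE)
  \<comment> \<open>With \<open>1 / (L + 1)\<close> the product \<open>L * \<delta>\<close> stays
    below 1, as the short-time uniqueness requires.\<close>
  define \<delta> where "\<delta> = min d (1 / (L + 1))"
  have \<delta>: "\<delta> > 0" using d rL by (simp add: \<delta>_def)
  have "L * \<delta> \<le> L * (1 / (L + 1))" using rL by (intro mult_left_mono) (auto simp: \<delta>_def)
  also have "\<dots> < 1" using rL by simp
  finally have L\<delta>: "L * \<delta> < 1" .
  have in_W: "\<gamma> t \<in> W" "\<gamma>' t \<in> W" if "\<bar>t\<bar> < \<delta>" for t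
    using that d(2) by (auto simp: \<delta>_def subset_iff dist_norm)
  have "\<gamma> t = \<gamma>' t" if t: "\<bar>t\<bar> < \<delta>" for t
  proof -
    have "\<phi> (\<gamma> t) = \<phi> (\<gamma>' t)"
    proof (rule lipschitz_ode_unique[OF rL(4) rL(2) L\<delta> _ _ _ t])
      show "\<phi> (\<gamma> t) \<in> cball (\<phi> gunit) r \<and>
          ((\<lambda>t. \<phi> (\<gamma> t)) has_vector_derivative left_field \<xi> (\<phi> (\<gamma> t))) (at t)" if "\<bar>t\<bar> < \<delta>" for t
        using in_W[OF that] one_parameter_subgroup_ode[OF A \<gamma>] by (auto simp: W_def)
      show "\<phi> (\<gamma>' t) \<in> cball (\<phi> gunit) r \<and>
          ((\<lambda>t. \<phi> (\<gamma>' t)) has_vector_derivative left_field \<xi> (\<phi> (\<gamma>' t))) (at t)" if "\<bar>t\<bar> < \<delta>" for t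
        using in_W[OF that] one_parameter_subgroup_ode[OF A \<gamma>'] by (auto simp: W_def)
    qed (use one_parameter_subgroup_unit[OF \<gamma>] one_parameter_subgroup_unit[OF \<gamma>'] in auto)
    then have "\<psi> (\<phi> (\<gamma> t)) = \<psi> (\<phi> (\<gamma>' t))" by simp
    then show ?thesis using in_W[OF t] by (simp add: W_def unit_nbhdD(6)[OF A])
  qed
  then show ?thesis
    by (rule real_hom_eqI[OF _ _ \<delta>, rotated 2]) (use \<gamma> \<gamma>' in \<open>simp_all add: one_parameter_subgroup_def\<close>)
qed

text \<open>Smoothness near 0 is carried to an arbitrary time \<open>t\<close> by the identity
  \<open>\<gamma> s = \<gamma> t \<cdot> \<gamma> (s - t)\<close>, as left multiplication by
  \<open>\<gamma> t\<close> is smooth.\<close>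

lemma one_parameter_subgroupI:
  assumes hom: "\<And>s t. \<gamma> (s + t) = \<gamma> s \<cdot> \<gamma> t"
    and e: "e > 0" "\<And>t. \<bar>t\<bar> < e \<Longrightarrow> \<gamma> t \<in> fst (ch gunit)"
    and cont: "continuous_on {-e<..<e} \<gamma>" and sm: "smooth_on {-e<..<e} (\<lambda>t. \<phi> (\<gamma> t))"
    and d: "((\<lambda>t. \<phi> (\<gamma> t)) has_vector_derivative \<xi>) (at 0)"
  shows "one_parameter_subgroup \<xi> \<gamma>"
proof -
  have \<gamma>0: "\<gamma> 0 = gunit" using hom[of 0 0] by (metis add_0 left_cancel right_neutral)
  have n0: "smooth_near vector_charts ch \<gamma> 0"
    by (rule smooth_nearI[of "{-e<..<e}"])
       (use e cont sm in \<open>auto simp: local_rep_def \<gamma>0 o_def abs_less_iff\<close>)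
  have near: "smooth_near vector_charts ch \<gamma> t" for t
  proof -
    have "smooth_near vector_charts vector_charts (\<lambda>s::real. s - t) t"
      unfolding smooth_near_vector_charts_iff
      by (intro exI[of _ UNIV] conjI smooth_on_diff smooth_on_ident smooth_on_const) auto
    from smooth_near_compose[OF atlas_real atlas_real this, of ch \<gamma>]
    have "smooth_near vector_charts ch (\<lambda>s. \<gamma> (s - t)) t" using n0 by simp
    from smooth_near_mult[OF atlas_real smooth_near_ch_const[OF atlas_real] this]
    have "smooth_near vector_charts ch (\<lambda>s. \<gamma> t \<cdot> \<gamma> (s - t)) t" .
    moreover have "(\<lambda>s. \<gamma> t \<cdot> \<gamma> (s - t)) = \<gamma>"
      using hom[of t] by (simp add: fun_eq_iff flip: hom)
    ultimately show ?thesis by simp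
  qed
  have "tangent_map vector_charts ch \<gamma> 0 1 = \<xi>"
    using smooth_near_curve_derivative[OF n0] d unfolding \<gamma>0 by (rule vector_derivative_unique_at)
  then show ?thesis
    unfolding one_parameter_subgroup_def
    using hom smooth_near_imp_smooth_map[OF atlas_real atlas_ch near] by blast
qed

text \<open>The integral curve of the left invariant field through the unit exists for short times.
  Uniqueness of integral curves makes it a local homomorphism, which then extends to the whole
  line.\<close>

lemma one_parameter_subgroup_exists: "\<exists>\<gamma>. one_parameter_subgroup \<xi> \<gamma>"
proof -
  obtain A where A: "unit_nbhd A" using unit_nbhd_exists by blast
  note A' = unit_nbhdD[OF A]
  define f where "f = left_field \<xi>"
  have x0: "\<phi> gunit \<in> \<phi> ` A" using A'(2) by blast
  obtain r L where rL: "r > 0" "L \<ge> 0" "cball (\<phi> gunit) r \<subseteq> \<phi> ` A"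
    and "\<And>x y. x \<in> cball (\<phi> gunit) r \<Longrightarrow> y \<in> cball (\<phi> gunit) r \<Longrightarrow>
      norm (left_field \<xi> x - left_field \<xi> y) \<le> L * norm (x - y)"
    by (rule smooth_on_locally_lipschitz[OF finite_dimensional_model open_unit_nbhd_image[OF A] x0
          left_field_smooth[OF A, of \<xi>]], rule that; assumption)
  then have lip: "norm (f x - f y) \<le> L * norm (x - y)"
    if "x \<in> cball (\<phi> gunit) r" "y \<in> cball (\<phi> gunit) r" for x y
    using that by (simp only: f_def)
  obtain \<delta> x where \<delta>: "\<delta> > 0" and xinit: "x 0 = \<phi> gunit"
    and x: "\<And>t. \<bar>t\<bar> < \<delta> \<Longrightarrow> x t \<in> cball (\<phi> gunit) r \<and> (x has_vector_derivative f (x t)) (at t)"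
    by (rule lipschitz_ode_exists[OF rL(1,2) lip], assumption, assumption, rule that; assumption)
  define g where "g t = \<psi> (x t)" for t
  have xA: "x t \<in> \<phi> ` A" if "\<bar>t\<bar> < \<delta>" for t using x[OF that] rL(3) by blast
  have gA: "g t \<in> A" and \<phi>g: "\<phi> (g t) = x t" if "\<bar>t\<bar> < \<delta>" for t
    using xA[OF that] A'(6) by (auto simp: g_def)
  have g0: "g 0 = gunit" using A'(2,6) by (simp add: g_def xinit)
  define J where "J = {-\<delta><..<\<delta>}"
  have J: "open J" "0 \<in> J" "t \<in> J \<longleftrightarrow> \<bar>t\<bar> < \<delta>" for t using \<delta> by (auto simp: J_def)
  have xcont: "continuous_on J x"
    using x J by (auto intro!: continuous_at_imp_continuous_on has_vector_derivative_continuous)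
  have gcont: "continuous_on J g"
    unfolding g_def
    by (rule continuous_on_compose2[OF continuous_on_chart_inv[OF atlas_ch] xcont])
       (use xA A'(3) J in blast)
  define W where "W = A \<inter> \<phi> -` (ball (\<phi> gunit) r)"
  have "open (\<phi> -` (ball (\<phi> gunit) r) \<inter> A)"
    by (rule continuous_on_open_vimage[OF A'(1), THEN iffD1, rule_format, OF _ open_ball])
       (rule continuous_on_subset[OF continuous_on_chart[OF atlas_ch] A'(3)])
  then have W: "open W" "gunit \<in> W"
    using A'(2) rL(1) by (simp_all add: W_def Int_commute)
  \<comment> \<open>Pairs whose product lies in \<open>W\<close>, that is, in \<open>A\<close> and
    over the ball carrying the Lipschitz bound; a product box inside \<open>V\<close> confines
    \<open>g s \<cdot> g t\<close> for small \<open>s\<close> and \<open>t\<close>.\<close>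
  define V where "V = (\<lambda>z. fst z \<cdot> snd z) -` W"
  have V: "open V" unfolding V_def
    by (intro open_vimage W continuous_on_group_mult continuous_intros)
  have inV: "(gunit, gunit) \<in> V" using W by (simp add: V_def)
  obtain B1 B2 where B12: "open B1" "open B2" "(gunit, gunit) \<in> B1 \<times> B2" "B1 \<times> B2 \<subseteq> V"
    by (rule open_prod_elim[OF V inV], rule that; assumption)
  have "open (g -` (B1 \<inter> B2) \<inter> J)"
    by (rule continuous_on_open_vimage[OF J(1), THEN iffD1, rule_format, OF gcont]) (intro open_Int B12)
  moreover have "0 \<in> g -` (B1 \<inter> B2) \<inter> J" using B12 J g0 by simp
  ultimately obtain d where d: "d > 0" "ball 0 d \<subseteq> g -` (B1 \<inter> B2) \<inter> J"
    by (rule openE)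
  \<comment> \<open>The three bounds serve, in turn, to keep products in \<open>W\<close>, to keep
    \<open>s + t\<close> within the time of existence, and to make \<open>L * \<epsilon> < 1\<close>
    for uniqueness.\<close>
  define \<epsilon> where "\<epsilon> = Min {d, \<delta> / 2, 1 / (L + 1)}"
  have \<epsilon>: "\<epsilon> > 0" "\<epsilon> \<le> d" "\<epsilon> \<le> \<delta> / 2" "\<epsilon> \<le> 1 / (L + 1)" using d \<delta> rL by (auto simp: \<epsilon>_def)
  have "L * \<epsilon> \<le> L * (1 / (L + 1))" using rL \<epsilon> by (intro mult_left_mono) auto
  also have "\<dots> < 1" using rL by simp
  finally have L\<epsilon>: "L * \<epsilon> < 1" .
  have small: "\<bar>t\<bar> < \<delta>" if "\<bar>t\<bar> < \<epsilon>" for t using that \<epsilon> \<delta> by linarith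
  have small2: "\<bar>s + t\<bar> < \<delta>" if "\<bar>s\<bar> < \<epsilon>" "\<bar>t\<bar> < \<epsilon>" for s t using that \<epsilon> by linarith
  have prodW: "g s \<cdot> g t \<in> W" if "\<bar>s\<bar> < \<epsilon>" "\<bar>t\<bar> < \<epsilon>" for s t
  proof -
    have "g u \<in> B1 \<inter> B2" if "\<bar>u\<bar> < \<epsilon>" for u
      using d(2) \<epsilon>(2) that by (auto simp: subset_iff dist_norm)
    then have "(g s, g t) \<in> V" using that B12(4) by blast
    then show ?thesis by (simp add: V_def)
  qed
  have local_hom: "g (s + t) = g s \<cdot> g t" if s: "\<bar>s\<bar> < \<epsilon>" and t: "\<bar>t\<bar> < \<epsilon>" for s t
  proof -
    \<comment> \<open>both sides, as functions of \<open>t\<close>, are integral curves of the left invariant field\<close>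
    have "x (s + t) = \<phi> (g s \<cdot> g t)"
    proof (rule lipschitz_ode_unique[OF lip rL(2) L\<epsilon> _ _ _ t])
      show "x (s + u) \<in> cball (\<phi> gunit) r \<and> ((\<lambda>u. x (s + u)) has_vector_derivative f (x (s + u))) (at u)"
        if u: "\<bar>u\<bar> < \<epsilon>" for u
      proof -
        have "((\<lambda>u. s + u) has_derivative (\<lambda>h. h)) (at u)" by (auto intro!: derivative_eq_intros)
        from has_derivative_compose[OF this, of x "\<lambda>h. h *\<^sub>R f (x (s + u))"]
        show ?thesis using x[OF small2[OF s u]] by (simp add: has_vector_derivative_def)
      qed
      show "\<phi> (g s \<cdot> g u) \<in> cball (\<phi> gunit) r \<and>
          ((\<lambda>u. \<phi> (g s \<cdot> g u)) has_vector_derivative f (\<phi> (g s \<cdot> g u))) (at u)"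
        if u: "\<bar>u\<bar> < \<epsilon>" for u
      proof
        have uJ: "u \<in> J" using small[OF u] J by blast
        have gJ: "g ` J \<subseteq> A" using gA J by blast
        have "((\<lambda>u. \<phi> (g u)) has_derivative (\<lambda>h. h *\<^sub>R f (x u))) (at u)"
          by (rule has_derivative_transform_within_open[OF _ J(1) uJ])
             (use x[OF small[OF u]] \<phi>g J in \<open>simp_all add: has_vector_derivative_def\<close>)
        then have "((\<lambda>u. \<phi> (g s \<cdot> g u)) has_vector_derivative
            frechet_derivative unit_rep (at (\<phi> (g s), \<phi> (g u))) (0, f (x u))) (at u)"
          unfolding has_vector_derivative_def[of "\<lambda>u. \<phi> (g u)", symmetric]
          by (rule mult_curve_derivative[OF A gA[OF small[OF s]] J(1) uJ gJ])
        \<comment> \<open>Left translation by \<open>g s\<close> preserves the field, so the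
          velocity of the translated curve is again the value of the field.\<close>
        moreover have "frechet_derivative unit_rep (at (\<phi> (g s), \<phi> (g u))) (0, f (x u)) = f (\<phi> (g s \<cdot> g u))"
          using left_field_invariant[OF A gA[OF small[OF s]] gA[OF small[OF u]], of \<xi>] prodW[OF s u]
          by (simp add: f_def \<phi>g[OF small[OF u]] W_def)
        ultimately show "((\<lambda>u. \<phi> (g s \<cdot> g u)) has_vector_derivative f (\<phi> (g s \<cdot> g u))) (at u)" by simp
        show "\<phi> (g s \<cdot> g u) \<in> cball (\<phi> gunit) r" using prodW[OF s u] by (simp add: W_def)
      qed
      show "x (s + 0) = \<phi> (g s \<cdot> g 0)" using \<phi>g[OF small[OF s]] g0 by simp
    qed
    then have "\<psi> (x (s + t)) = \<psi> (\<phi> (g s \<cdot> g t))" by simp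
    then show ?thesis using prodW[OF s t] A'(6) by (simp add: g_def[symmetric] W_def)
  qed
  obtain \<gamma> where \<gamma>: "\<And>s t. \<gamma> (s + t) = \<gamma> s \<cdot> \<gamma> t" and \<gamma>g: "\<And>t. \<bar>t\<bar> < \<epsilon> \<Longrightarrow> \<gamma> t = g t"
    by (rule local_real_hom_extends[OF \<epsilon>(1) local_hom], assumption, assumption, rule that; assumption)
  define I where "I = {-\<epsilon><..<\<epsilon>}"
  have I: "open I" "0 \<in> I" "t \<in> I \<longleftrightarrow> \<bar>t\<bar> < \<epsilon>" for t using \<epsilon>(1) by (auto simp: I_def)
  have IJ: "I \<subseteq> J" using small I J by blast
  have eq: "x t = \<phi> (\<gamma> t)" if "t \<in> I" for t using that I \<phi>g small \<gamma>g by simp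
  have "smooth_on I x"
    by (rule smooth_on_ode_solution[OF finite_dimensional_model I(1) left_field_smooth[OF A, of \<xi>]])
       (use x xA small I in \<open>auto simp: f_def\<close>)
  then have sm: "smooth_on I (\<lambda>t. \<phi> (\<gamma> t))" by (rule smooth_on_cong[OF _ I(1) eq])
  have "(x has_vector_derivative \<xi>) (at 0)"
    using x[of 0] \<delta> by (simp add: xinit f_def left_field_unit[OF A])
  then have d0: "((\<lambda>t. \<phi> (\<gamma> t)) has_vector_derivative \<xi>) (at 0)"
    unfolding has_vector_derivative_def by (rule has_derivative_transform_within_open[OF _ I(1,2) eq])
  have cont: "continuous_on I \<gamma>"
    by (rule continuous_on_eq[OF continuous_on_subset[OF gcont IJ]]) (use I \<gamma>g in simp)
  have dom: "\<gamma> t \<in> fst (ch gunit)" if "\<bar>t\<bar> < \<epsilon>" for t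
    using gA[OF small[OF that]] \<gamma>g[OF that] A'(3) by auto
  from one_parameter_subgroupI[OF \<gamma> \<epsilon>(1) dom cont[unfolded I_def] sm[unfolded I_def] d0]
  show ?thesis by blast
qed

lemma one_parameter_subgroup_scale:
  assumes \<gamma>: "one_parameter_subgroup \<xi> \<gamma>"
  shows "one_parameter_subgroup (t *\<^sub>R \<xi>) (\<lambda>s. \<gamma> (t * s))"
proof -
  have near: "smooth_near vector_charts ch \<gamma> s" for s
    using \<gamma> smooth_map_imp_smooth_near[OF atlas_real atlas_ch] by (simp add: one_parameter_subgroup_def)
  have lin: "smooth_near vector_charts vector_charts (\<lambda>s. t * s) s" for s
    unfolding smooth_near_vector_charts_iff
    by (intro exI[of _ UNIV] conjI smooth_on_mult smooth_on_ident smooth_on_const) auto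
  have "((\<lambda>s. t * s) has_derivative (\<lambda>s. t * s)) (at 0)" by (auto intro!: derivative_eq_intros)
  then have "tangent_map vector_charts vector_charts (\<lambda>s. t * s) 0 1 = t"
    by (simp add: tangent_map_vector_charts frechet_derivative_at[symmetric])
  then have "tangent_map vector_charts ch (\<lambda>s. \<gamma> (t * s)) 0 1 = tangent_map vector_charts ch \<gamma> 0 (t *\<^sub>R 1)"
    using tangent_map_compose[OF atlas_real atlas_real lin near, of 0 1] by simp
  also have "\<dots> = t *\<^sub>R \<xi>"
    using \<gamma> linear_cmul[OF tangent_map_linear[OF atlas_real near, of 0], of t 1]
    by (simp add: one_parameter_subgroup_def)
  finally have T: "tangent_map vector_charts ch (\<lambda>s. \<gamma> (t * s)) 0 1 = t *\<^sub>R \<xi>" .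
  have "smooth_map vector_charts ch (\<lambda>s. \<gamma> (t * s))"
    by (rule smooth_near_imp_smooth_map[OF atlas_real atlas_ch smooth_near_compose[OF atlas_real atlas_real lin near]])
  with T \<gamma> show ?thesis by (simp add: one_parameter_subgroup_def distrib_left)
qed

text \<open>Uniqueness evaluates the description in \<open>lie_exp\<close>: the one-parameter
  subgroup of \<open>t *\<^sub>R \<xi>\<close> is \<open>\<gamma>\<close> run at speed
  \<open>t\<close>, and its value at 1 is \<open>\<gamma> t\<close>.\<close>

lemma lie_exp_scale:
  assumes \<gamma>: "one_parameter_subgroup \<xi> \<gamma>"
  shows "lie_exp (t *\<^sub>R \<xi>) = \<gamma> t"
proof -
  have "(THE \<gamma>. one_parameter_subgroup (t *\<^sub>R \<xi>) \<gamma>) = (\<lambda>s. \<gamma> (t * s))"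
    by (rule the_equality, rule one_parameter_subgroup_scale[OF \<gamma>])
       (rule one_parameter_subgroup_unique[OF _ one_parameter_subgroup_scale[OF \<gamma>]])
  then show ?thesis by (simp add: lie_exp_def)
qed

end

subsection \<open>The Lie bracket\<close>

context lie_group
begin

lemma smooth_near_conj: "smooth_near ch ch (\<lambda>h. ginv g \<cdot> h \<cdot> g) x"
  by (intro smooth_near_mult smooth_near_ch_const smooth_near_ident atlas_ch)

lemma smooth_near_right_mult: "smooth_near ch ch (\<lambda>h. h \<cdot> g) x"
  by (intro smooth_near_mult smooth_near_ch_const smooth_near_ident atlas_ch)

lemma linear_Ad: "linear (Ad g)"
  unfolding Ad_def by (rule tangent_map_linear[OF atlas_ch smooth_near_conj])

lemma Ad_unit: "Ad gunit \<eta> = \<eta>"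
  by (simp add: Ad_def tangent_map_ident[OF atlas_ch])

text \<open>The order is reversed because conjugation is by the inverse; this is the chain rule for
  two successive conjugations, both of which fix the unit.\<close>

lemma Ad_mult: "Ad (g \<cdot> h) \<eta> = Ad h (Ad g \<eta>)"
proof -
  have eq: "ginv (g \<cdot> h) \<cdot> k \<cdot> (g \<cdot> h) = ginv h \<cdot> (ginv g \<cdot> k \<cdot> g) \<cdot> h" for k
    by (simp add: inverse_distrib_swap assoc)
  have "tangent_map ch ch (\<lambda>k. ginv h \<cdot> (ginv g \<cdot> k \<cdot> g) \<cdot> h) gunit \<eta>
    = tangent_map ch ch (\<lambda>k. ginv h \<cdot> k \<cdot> h) (ginv g \<cdot> gunit \<cdot> g) (Ad g \<eta>)"
    unfolding Ad_def by (rule tangent_map_compose[OF atlas_ch atlas_ch smooth_near_conj smooth_near_conj])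
  then show ?thesis unfolding Ad_def eq by simp
qed

section \<open>The bracket as a mixed second derivative of conjugation\<close>

definition conj_rep :: "'a \<times> 'a \<Rightarrow> 'a" where
  "conj_rep z = \<phi> (ginv (\<psi> (fst z)) \<cdot> \<psi> (snd z) \<cdot> \<psi> (fst z))"

lemma conj_rep_smooth:
  obtains A where "open A" "gunit \<in> A" "A \<subseteq> fst (ch gunit)" "smooth_on ((\<phi> ` A) \<times> (\<phi> ` A)) conj_rep"
proof -
  note prod = atlas_prod_charts[OF atlas_ch atlas_ch]
  have "smooth_near (prod_charts ch ch) ch (\<lambda>z. ginv (fst z) \<cdot> snd z \<cdot> fst z) (gunit, gunit)"
    by (intro smooth_near_mult smooth_near_ginv smooth_near_fst smooth_near_snd atlas_ch prod)
  then obtain U where U: "open U" "(gunit, gunit) \<in> U" "U \<subseteq> fst (ch gunit) \<times> fst (ch gunit)"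
      "smooth_on (map_prod \<phi> \<phi> ` U)
        (local_rep (prod_charts ch ch) ch (\<lambda>z. ginv (fst z) \<cdot> snd z \<cdot> fst z) (gunit, gunit))"
    by (rule smooth_nearE) simp
  obtain A1 A2 where A12: "open A1" "open A2" "(gunit, gunit) \<in> A1 \<times> A2" "A1 \<times> A2 \<subseteq> U"
    by (rule open_prod_elim[OF U(1,2)], rule that; assumption)
  define A where "A = A1 \<inter> A2"
  have A: "open A" "gunit \<in> A" "A \<times> A \<subseteq> U" using A12 by (auto simp: A_def)
  have AD: "A \<subseteq> fst (ch gunit)" using A U by blast
  have oA: "open ((\<phi> ` A) \<times> (\<phi> ` A))"
    by (intro open_Times open_chart_image[OF atlas_ch] A AD)
  have "smooth_on ((\<phi> ` A) \<times> (\<phi> ` A)) conj_rep"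
  proof (rule smooth_on_cong[OF smooth_on_subset[OF U(4)] oA])
    show "(\<phi> ` A) \<times> (\<phi> ` A) \<subseteq> map_prod \<phi> \<phi> ` U"
      using image_mono[OF A(3), of "map_prod \<phi> \<phi>"] by (simp add: map_prod_image_Times)
    show "local_rep (prod_charts ch ch) ch (\<lambda>z. ginv (fst z) \<cdot> snd z \<cdot> fst z) (gunit, gunit) z = conj_rep z"
      if "z \<in> (\<phi> ` A) \<times> (\<phi> ` A)" for z
      using that AD chart_inv_prod_charts[OF atlas_ch atlas_ch, of _ "(gunit, gunit)"]
      by (auto simp: local_rep_def conj_rep_def subset_iff)
  qed
  then show ?thesis by (rule that[OF A(1,2) AD])
qed

text \<open>One derivative in the conjugated element, along \<open>\<eta>\<close>, then one in the
  conjugating element, along \<open>\<xi>\<close>, both taken at the unit. No exponential map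
  occurs.\<close>

definition ad_form :: "'a \<Rightarrow> 'a \<Rightarrow> 'a" where
  "ad_form \<xi> \<eta> = frechet_derivative (\<lambda>z. frechet_derivative conj_rep (at z) (0, \<eta>))
     (at (\<phi> gunit, \<phi> gunit)) (\<xi>, 0)"

text \<open>By the chain rule the result depends on the curve only through its velocity at the unit,
  so the exponential curve may be replaced by any other with the same velocity.\<close>

lemma Ad_curve_derivative:
  assumes T: "open T" "0 \<in> T" "continuous_on T c" "c 0 = gunit"
    and c: "((\<lambda>t. \<phi> (c t)) has_vector_derivative \<xi>) (at 0)"
  shows "((\<lambda>t. Ad (c t) \<eta>) has_vector_derivative ad_form \<xi> \<eta>) (at 0)"
proof -
  obtain A where A: "open A" "gunit \<in> A" "A \<subseteq> fst (ch gunit)" "smooth_on ((\<phi> ` A) \<times> (\<phi> ` A)) conj_rep"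
    by (rule conj_rep_smooth)
  have oA: "open (\<phi> ` A)" by (intro open_chart_image[OF atlas_ch] A)
  have left: "\<psi> (\<phi> g) = g" if "g \<in> A" for g
    using that A(3) by (intro lie_chart_inv_left) auto
  \<comment> \<open>Conjugation fixes the unit, so the chart at the unit serves at both ends of the
    tangent map, and \<open>Ad g\<close> is the partial derivative of \<open>conj_rep\<close> in its
    second variable.\<close>
  have Ad: "Ad g \<eta> = frechet_derivative conj_rep (at (\<phi> g, \<phi> gunit)) (0, \<eta>)" if g: "g \<in> A" for g
  proof -
    have 1: "(conj_rep has_derivative frechet_derivative conj_rep (at (\<phi> g, \<phi> gunit))) (at (\<phi> g, \<phi> gunit))"
      by (rule smooth_on_has_derivative[OF A(4)]) (use g A in auto)
    have 2: "((\<lambda>y. (\<phi> g, y)) has_derivative (\<lambda>v. (0, v))) (at (\<phi> gunit))"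
      by (auto intro!: derivative_eq_intros)
    have 3: "((\<lambda>y. conj_rep (\<phi> g, y)) has_derivative
        (\<lambda>v. frechet_derivative conj_rep (at (\<phi> g, \<phi> gunit)) (0, v))) (at (\<phi> gunit))"
      by (rule has_derivative_compose[OF 2 1])
    have "(local_rep ch ch (\<lambda>h. ginv g \<cdot> h \<cdot> g) gunit has_derivative
        (\<lambda>v. frechet_derivative conj_rep (at (\<phi> g, \<phi> gunit)) (0, v))) (at (\<phi> gunit))"
      by (rule has_derivative_transform_within_open[OF 3 oA])
         (use A g left in \<open>auto simp: local_rep_def conj_rep_def\<close>)
    then show ?thesis unfolding Ad_def by (simp add: tangent_map_eqI)
  qed
  define T' where "T' = c -` A \<inter> T"
  have T': "open T'" "0 \<in> T'"
    unfolding T'_def using T A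
    by (auto intro!: continuous_on_open_vimage[OF T(1), THEN iffD1, rule_format])
  have "((\<lambda>t. (\<phi> (c t), \<phi> gunit)) has_vector_derivative (\<xi>, 0)) (at 0)"
    by (rule has_vector_derivative_Pair[OF c has_vector_derivative_const])
  then have "((\<lambda>t. frechet_derivative conj_rep (at (\<phi> (c t), \<phi> gunit)) (0, \<eta>))
      has_vector_derivative ad_form \<xi> \<eta>) (at 0)"
    unfolding ad_form_def
  proof (rule has_vector_derivative_compose_has_derivative)
    show "((\<lambda>z. frechet_derivative conj_rep (at z) (0, \<eta>)) has_derivative
       frechet_derivative (\<lambda>z. frechet_derivative conj_rep (at z) (0, \<eta>)) (at (\<phi> gunit, \<phi> gunit)))
       (at (\<phi> (c 0), \<phi> gunit))"
      unfolding T(4) by (rule smooth_on_has_derivative[OF smooth_on_frechet_derivative[OF A(4)]]) (use A in auto)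
  qed
  then show ?thesis
    unfolding has_vector_derivative_def
    by (rule has_derivative_transform_within_open[OF _ T']) (simp add: Ad T'_def)
qed

lemma lie_bracket_eq_ad_form: "lie_bracket \<xi> \<eta> = ad_form \<xi> \<eta>"
proof -
  obtain \<gamma> where \<gamma>: "one_parameter_subgroup \<xi> \<gamma>" using one_parameter_subgroup_exists by blast
  have "((\<lambda>t. Ad (\<gamma> t) \<eta>) has_vector_derivative ad_form \<xi> \<eta>) (at 0)"
    by (rule Ad_curve_derivative[OF open_UNIV UNIV_I one_parameter_subgroup_continuous[OF \<gamma>]
          one_parameter_subgroup_unit[OF \<gamma>] one_parameter_subgroup_derivative[OF \<gamma>]])
  then show ?thesis by (simp add: lie_bracket_def lie_exp_scale[OF \<gamma>] vector_derivative_at)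
qed

lemma Ad_one_parameter_subgroup_derivative:
  assumes \<gamma>: "one_parameter_subgroup \<xi> \<gamma>"
  shows "((\<lambda>t. Ad (\<gamma> t) \<eta>) has_vector_derivative lie_bracket \<xi> \<eta>) (at 0)"
  unfolding lie_bracket_eq_ad_form
  by (rule Ad_curve_derivative[OF open_UNIV UNIV_I one_parameter_subgroup_continuous[OF \<gamma>]
        one_parameter_subgroup_unit[OF \<gamma>] one_parameter_subgroup_derivative[OF \<gamma>]])

text \<open>Conjugation is a smooth homomorphism whose tangent map at the unit is
  \<open>Ad g\<close>. Both the alternating property of the bracket and its invariance under
  \<open>Ad\<close> rest on this.\<close>

lemma conj_one_parameter_subgroup:
  assumes \<gamma>: "one_parameter_subgroup \<xi> \<gamma>"
  shows "one_parameter_subgroup (Ad g \<xi>) (\<lambda>t. ginv g \<cdot> \<gamma> t \<cdot> g)"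
proof -
  have near: "smooth_near vector_charts ch \<gamma> t" for t
    using \<gamma> smooth_map_imp_smooth_near[OF atlas_real atlas_ch] by (simp add: one_parameter_subgroup_def)
  have sm: "smooth_map vector_charts ch (\<lambda>t. ginv g \<cdot> \<gamma> t \<cdot> g)"
    by (rule smooth_near_imp_smooth_map[OF atlas_real atlas_ch
          smooth_near_compose[OF atlas_real atlas_ch near smooth_near_conj]])
  have hom: "ginv g \<cdot> \<gamma> (s + t) \<cdot> g = (ginv g \<cdot> \<gamma> s \<cdot> g) \<cdot> (ginv g \<cdot> \<gamma> t \<cdot> g)" for s t
  proof -
    have "g \<cdot> (ginv g \<cdot> (\<gamma> t \<cdot> g)) = \<gamma> t \<cdot> g" by (simp flip: assoc)
    then show ?thesis using \<gamma> by (simp add: one_parameter_subgroup_def assoc)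
  qed
  have "tangent_map vector_charts ch (\<lambda>t. ginv g \<cdot> \<gamma> t \<cdot> g) 0 1 = Ad g \<xi>"
    using tangent_map_compose[OF atlas_real atlas_ch near[of 0] smooth_near_conj[of g], of 1] \<gamma>
    by (simp add: Ad_def one_parameter_subgroup_unit[OF \<gamma>] one_parameter_subgroup_def)
  with sm hom show ?thesis unfolding one_parameter_subgroup_def by blast
qed

text \<open>Seen through \<open>ad_form\<close>, where \<open>\<xi>\<close> enters as the argument
  of a derivative; the definition by itself does not relate the exponential curves of
  \<open>\<xi>\<close>, \<open>\<xi>'\<close> and \<open>\<xi> + \<xi>'\<close>.\<close>

lemma linear_lie_bracket_left: "linear (\<lambda>\<xi>. lie_bracket \<xi> \<eta>)"
proof -
  obtain A where A: "open A" "gunit \<in> A" "A \<subseteq> fst (ch gunit)" "smooth_on ((\<phi> ` A) \<times> (\<phi> ` A)) conj_rep"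
    by (rule conj_rep_smooth)
  have "linear (frechet_derivative (\<lambda>z. frechet_derivative conj_rep (at z) (0, \<eta>)) (at (\<phi> gunit, \<phi> gunit)))"
    by (rule has_derivative_linear[OF smooth_on_has_derivative[OF smooth_on_frechet_derivative[OF A(4)]]])
       (use A in auto)
  moreover have "linear (\<lambda>\<xi>::'a. (\<xi>, 0::'a))" by (auto simp: linear_iff)
  ultimately show ?thesis
    unfolding lie_bracket_eq_ad_form ad_form_def using linear_compose[of "\<lambda>\<xi>::'a. (\<xi>, 0::'a)"] by (simp add: o_def)
qed

lemma linear_lie_bracket_right: "linear (lie_bracket \<xi>)"
proof -
  obtain \<gamma> where \<gamma>: "one_parameter_subgroup \<xi> \<gamma>" using one_parameter_subgroup_exists by blast
  note d = Ad_one_parameter_subgroup_derivative[OF \<gamma>]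
  show ?thesis
  proof (rule linearI)
    fix \<eta> \<eta>'
    have "((\<lambda>t. Ad (\<gamma> t) (\<eta> + \<eta>')) has_vector_derivative lie_bracket \<xi> \<eta> + lie_bracket \<xi> \<eta>') (at 0)"
      unfolding linear_add[OF linear_Ad] by (rule has_vector_derivative_add[OF d d])
    then show "lie_bracket \<xi> (\<eta> + \<eta>') = lie_bracket \<xi> \<eta> + lie_bracket \<xi> \<eta>'"
      by (rule vector_derivative_unique_at[OF d])
  next
    fix r \<eta>
    have "((\<lambda>t. Ad (\<gamma> t) (r *\<^sub>R \<eta>)) has_vector_derivative r *\<^sub>R lie_bracket \<xi> \<eta>) (at 0)"
      unfolding linear_cmul[OF linear_Ad]
      using bounded_linear.has_vector_derivative[OF bounded_linear_scaleR_right d] .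
    then show "lie_bracket \<xi> (r *\<^sub>R \<eta>) = r *\<^sub>R lie_bracket \<xi> \<eta>"
      by (rule vector_derivative_unique_at[OF d])
  qed
qed

lemma bounded_bilinear_lie_bracket: "bounded_bilinear lie_bracket"
  by (rule finite_dimensional_bounded_bilinear[OF finite_dimensional_model finite_dimensional_model
        linear_lie_bracket_left linear_lie_bracket_right])

sublocale lie_bracket: bounded_bilinear lie_bracket
  by (rule bounded_bilinear_lie_bracket)

section \<open>The Lie algebra identities\<close>

lemma lie_bracket_self: "lie_bracket \<xi> \<xi> = 0"
proof -
  obtain \<gamma> where \<gamma>: "one_parameter_subgroup \<xi> \<gamma>" using one_parameter_subgroup_exists by blast
  have hom: "\<gamma> (s + t) = \<gamma> s \<cdot> \<gamma> t" for s t using \<gamma> by (simp add: one_parameter_subgroup_def)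
  \<comment> \<open>The values of \<open>\<gamma>\<close> commute, so conjugation by
    \<open>\<gamma> t\<close> leaves the whole curve unchanged; its velocity at 0 is therefore both
    \<open>Ad (\<gamma> t) \<xi>\<close> and \<open>\<xi>\<close>.\<close>
  have "Ad (\<gamma> t) \<xi> = \<xi>" for t
  proof -
    have "ginv (\<gamma> t) \<cdot> \<gamma> s \<cdot> \<gamma> t = \<gamma> s" for s
    proof -
      have "\<gamma> s \<cdot> \<gamma> t = \<gamma> t \<cdot> \<gamma> s" by (metis hom add.commute)
      then have "ginv (\<gamma> t) \<cdot> \<gamma> s \<cdot> \<gamma> t = (ginv (\<gamma> t) \<cdot> \<gamma> t) \<cdot> \<gamma> s" by (simp only: assoc)
      then show ?thesis by simp
    qed
    then have "one_parameter_subgroup (Ad (\<gamma> t) \<xi>) \<gamma>"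
      using conj_one_parameter_subgroup[OF \<gamma>, of "\<gamma> t"] by simp
    then show ?thesis using \<gamma> unfolding one_parameter_subgroup_def by simp
  qed
  then have "((\<lambda>t. \<xi>) has_vector_derivative lie_bracket \<xi> \<xi>) (at 0)"
    using Ad_one_parameter_subgroup_derivative[OF \<gamma>, of \<xi>] by simp
  then show ?thesis using has_vector_derivative_const by (rule vector_derivative_unique_at)
qed

lemma lie_bracket_antisym: "lie_bracket \<xi> \<eta> = - lie_bracket \<eta> \<xi>"
proof -
  have "lie_bracket (\<xi> + \<eta>) (\<xi> + \<eta>) = lie_bracket \<xi> \<xi> + lie_bracket \<eta> \<xi> + (lie_bracket \<xi> \<eta> + lie_bracket \<eta> \<eta>)"
    by (simp only: lie_bracket.add_left lie_bracket.add_right)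
  then have "lie_bracket \<xi> \<eta> + lie_bracket \<eta> \<xi> = 0"
    unfolding lie_bracket_self by (simp add: add.commute)
  then show ?thesis by (rule eq_neg_iff_add_eq_0[THEN iffD2])
qed

text \<open>Conjugating the one-parameter subgroup of \<open>\<xi>\<close> by \<open>g\<close> gives
  that of \<open>Ad g \<xi>\<close>. Composing \<open>Ad\<close> along the conjugated curve with
  \<open>Ad g\<close> equals composing in the other order along \<open>\<gamma>\<close>, and the two
  derivatives at 0 are compared.\<close>

lemma Ad_lie_bracket: "Ad g (lie_bracket \<xi> \<eta>) = lie_bracket (Ad g \<xi>) (Ad g \<eta>)"
proof -
  obtain \<gamma> where \<gamma>: "one_parameter_subgroup \<xi> \<gamma>" using one_parameter_subgroup_exists by blast
  have "Ad (ginv g \<cdot> \<gamma> t \<cdot> g) (Ad g \<eta>) = Ad g (Ad (\<gamma> t) \<eta>)" for t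
    by (simp add: Ad_mult[symmetric] assoc[symmetric])
  then have 1: "((\<lambda>t. Ad g (Ad (\<gamma> t) \<eta>)) has_vector_derivative lie_bracket (Ad g \<xi>) (Ad g \<eta>)) (at 0)"
    using Ad_one_parameter_subgroup_derivative[OF conj_one_parameter_subgroup[OF \<gamma>, of g], of "Ad g \<eta>"] by simp
  have "bounded_linear (Ad g)"
    by (rule finite_dimensional_bounded_linear[OF finite_dimensional_model linear_Ad])
  from bounded_linear.has_vector_derivative[OF this Ad_one_parameter_subgroup_derivative[OF \<gamma>]]
  have "((\<lambda>t. Ad g (Ad (\<gamma> t) \<eta>)) has_vector_derivative Ad g (lie_bracket \<xi> \<eta>)) (at 0)" .
  then show ?thesis using 1 by (rule vector_derivative_unique_at)
qed

lemma lie_bracket_jacobi: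
  "lie_bracket \<zeta> (lie_bracket \<xi> \<eta>) = lie_bracket (lie_bracket \<zeta> \<xi>) \<eta> + lie_bracket \<xi> (lie_bracket \<zeta> \<eta>)"
proof -
  obtain \<gamma> where \<gamma>: "one_parameter_subgroup \<zeta> \<gamma>" using one_parameter_subgroup_exists by blast
  note d = Ad_one_parameter_subgroup_derivative[OF \<gamma>]
  have "((\<lambda>t. lie_bracket (Ad (\<gamma> t) \<xi>) (Ad (\<gamma> t) \<eta>)) has_vector_derivative
      lie_bracket (Ad (\<gamma> 0) \<xi>) (lie_bracket \<zeta> \<eta>) + lie_bracket (lie_bracket \<zeta> \<xi>) (Ad (\<gamma> 0) \<eta>)) (at 0)"
    by (rule lie_bracket.has_vector_derivative[OF d d])
  then have "((\<lambda>t. Ad (\<gamma> t) (lie_bracket \<xi> \<eta>)) has_vector_derivative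
      lie_bracket \<xi> (lie_bracket \<zeta> \<eta>) + lie_bracket (lie_bracket \<zeta> \<xi>) \<eta>) (at 0)"
    by (simp add: Ad_lie_bracket one_parameter_subgroup_unit[OF \<gamma>] Ad_unit)
  from vector_derivative_unique_at[OF d this] show ?thesis by (simp add: add.commute)
qed

text \<open>Right translations by \<open>g\<close> and by its inverse undo each other, so the chain
  rule makes their tangent maps mutually inverse. This is what inverts the group component of
  \<open>vfield\<close>.\<close>

lemma
  shows TR_inverse_left: "tangent_map ch ch (\<lambda>h. h \<cdot> ginv g) g (TR g v) = v"
    and TR_inverse_right: "TR g (tangent_map ch ch (\<lambda>h. h \<cdot> ginv g) g v) = v"
proof -
  have "tangent_map ch ch (\<lambda>h. h \<cdot> g \<cdot> ginv g) gunit v = tangent_map ch ch (\<lambda>h. h \<cdot> ginv g) (gunit \<cdot> g) (TR g v)"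
    unfolding TR_def
    by (rule tangent_map_compose[OF atlas_ch atlas_ch smooth_near_right_mult smooth_near_right_mult])
  then show "tangent_map ch ch (\<lambda>h. h \<cdot> ginv g) g (TR g v) = v"
    by (simp add: assoc tangent_map_ident[OF atlas_ch])
  have "tangent_map ch ch (\<lambda>h. h \<cdot> ginv g \<cdot> g) g v
    = tangent_map ch ch (\<lambda>h. h \<cdot> g) (g \<cdot> ginv g) (tangent_map ch ch (\<lambda>h. h \<cdot> ginv g) g v)"
    by (rule tangent_map_compose[OF atlas_ch atlas_ch smooth_near_right_mult smooth_near_right_mult])
  then show "TR g (tangent_map ch ch (\<lambda>h. h \<cdot> ginv g) g v) = v"
    unfolding TR_def by (simp add: assoc tangent_map_ident[OF atlas_ch])
qed

end

subsection \<open>Partial derivatives on the reduced space\<close>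

lemma dual_separates:
  fixes a b :: "'a::real_normed_vector"
  assumes "finite_dimensional TYPE('a)" "\<And>\<sigma> :: 'a dual. blinfun_apply \<sigma> a = blinfun_apply \<sigma> b"
  shows "a = b"
proof -
  obtain n :: nat and e and c :: "nat \<Rightarrow> 'a \<Rightarrow>\<^sub>L real"
    where ec: "\<And>x. (\<Sum>i<n. c i x *\<^sub>R e i) = x"
    by (rule finite_dimensionalE[OF assms(1)]) blast
  have "a = (\<Sum>i<n. c i a *\<^sub>R e i)" by (simp add: ec)
  also have "\<dots> = (\<Sum>i<n. c i b *\<^sub>R e i)" by (simp add: assms(2))
  also have "\<dots> = b" by (simp add: ec)
  finally show ?thesis .
qed

lemma partial_frechet_derivative:
  assumes "(W has_derivative D) (at (P x))" "(P has_derivative l) (at x)"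
  shows "frechet_derivative (\<lambda>y. W (P y)) (at x) = (\<lambda>v. D (l v))"
  by (rule frechet_derivative_at[symmetric], rule has_derivative_compose[OF assms(2,1)])

lemma linear_partial:
  fixes l :: "'b::real_vector \<Rightarrow> 'a::real_vector"
  assumes "linear D" "linear l"
  shows "linear (\<lambda>v. D (l v))"
  using linear_compose[OF assms(2,1)] by (simp only: o_def)

context
  fixes n :: nat and e :: "nat \<Rightarrow> 'a::real_normed_vector" and c :: "nat \<Rightarrow> 'a dual"
  assumes ec: "\<And>x. (\<Sum>i<n. blinfun_apply (c i) x *\<^sub>R e i) = x"
begin

lemma finite_dimensional_of_basis: "finite_dimensional TYPE('a)"
  by (rule finite_dimensionalI[where n = n and c = c and e = e]) (simp add: ec)

lemma dual_basis: "(\<Sum>i<n. blinfun_apply \<sigma> (e i) *\<^sub>R c i) = \<sigma>"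
proof (rule blinfun_eqI)
  fix x
  have "blinfun_apply (\<Sum>i<n. \<sigma> (e i) *\<^sub>R c i) x = \<sigma> (\<Sum>i<n. c i x *\<^sub>R e i)"
    by (simp add: blinfun.sum_left blinfun.sum_right blinfun.scaleR_left blinfun.scaleR_right mult.commute)
  then show "blinfun_apply (\<Sum>i<n. \<sigma> (e i) *\<^sub>R c i) x = \<sigma> x" by (simp add: ec)
qed

text \<open>The identification of the bidual with the space, made explicit: a functional
  \<open>l\<close> on the dual is evaluation at the vector with coordinates \<open>l (c i)\<close>,
  and functionals separate points.\<close>

lemma the_bidual_basis:
  assumes l: "linear l"
  shows "(THE a. \<forall>\<sigma>. l \<sigma> = blinfun_apply \<sigma> a) = (\<Sum>i<n. l (c i) *\<^sub>R e i)"
    and "blinfun_apply \<sigma> (\<Sum>i<n. l (c i) *\<^sub>R e i) = l \<sigma>"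
proof -
  have eq: "l \<sigma> = blinfun_apply \<sigma> (\<Sum>i<n. l (c i) *\<^sub>R e i)" for \<sigma>
  proof -
    have "l (\<Sum>i<n. \<sigma> (e i) *\<^sub>R c i) = (\<Sum>i<n. \<sigma> (e i) *\<^sub>R l (c i))"
      by (simp only: linear_sum[OF l] linear_cmul[OF l])
    then show ?thesis by (simp add: dual_basis blinfun.sum_right blinfun.scaleR_right mult.commute)
  qed
  then show "blinfun_apply \<sigma> (\<Sum>i<n. l (c i) *\<^sub>R e i) = l \<sigma>" by (rule sym)
  show "(THE a. \<forall>\<sigma>. l \<sigma> = blinfun_apply \<sigma> a) = (\<Sum>i<n. l (c i) *\<^sub>R e i)"
  proof (rule the_equality)
    show "a = (\<Sum>i<n. l (c i) *\<^sub>R e i)" if "\<forall>\<sigma>. l \<sigma> = blinfun_apply \<sigma> a" for a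
      by (rule dual_separates[OF finite_dimensional_of_basis], rule trans[OF that[rule_format, symmetric] eq])
  qed (simp add: eq[symmetric])
qed

end

context
  fixes W :: "'a::banach reduced \<Rightarrow> real"
  assumes W: "smooth_on UNIV W" and fd: "finite_dimensional TYPE('a)"
begin

lemma reduced_derivative: "(W has_derivative frechet_derivative W (at w)) (at w)"
  by (rule smooth_on_has_derivative[OF W UNIV_I])

lemma linear_reduced_derivative: "linear (frechet_derivative W (at w))"
  by (rule has_derivative_linear[OF reduced_derivative])

text \<open>The partial map is the total one after the affine embedding of the first dual factor, so
  its derivative is the total derivative on vectors \<open>(\<sigma>, 0, 0)\<close>.\<close>

lemma d_mu_eq: "d_mu W w = (THE a. \<forall>\<sigma>. frechet_derivative W (at w) (\<sigma>, 0, 0) = blinfun_apply \<sigma> a)"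
proof -
  obtain \<mu> \<xi> \<nu> where w: "w = (\<mu>, \<xi>, \<nu>)" by (cases w)
  have "((\<lambda>m. (m, \<xi>, \<nu>)) has_derivative (\<lambda>\<sigma>. (\<sigma>, 0, 0))) (at \<mu>)"
    by (intro has_derivative_Pair has_derivative_ident has_derivative_const)
  from partial_frechet_derivative[OF reduced_derivative this] show ?thesis
    by (simp add: w d_mu_def)
qed

lemma d_nu_eq: "d_nu W w = (THE a. \<forall>\<sigma>. frechet_derivative W (at w) (0, 0, \<sigma>) = blinfun_apply \<sigma> a)"
proof -
  obtain \<mu> \<xi> \<nu> where w: "w = (\<mu>, \<xi>, \<nu>)" by (cases w)
  have "((\<lambda>m. (\<mu>, \<xi>, m)) has_derivative (\<lambda>\<sigma>. (0, 0, \<sigma>))) (at \<nu>)"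
    by (intro has_derivative_Pair has_derivative_ident has_derivative_const)
  from partial_frechet_derivative[OF reduced_derivative this] show ?thesis
    by (simp add: w d_nu_def)
qed

lemma linear_embeddings:
  "linear (\<lambda>\<sigma>. (\<sigma>, 0, 0) :: 'a reduced)" "linear (\<lambda>\<sigma>. (0, 0, \<sigma>) :: 'a reduced)"
  "linear (\<lambda>x. (0, x, 0) :: 'a reduced)"
  by (simp_all add: linear_iff)

lemma d_xi_apply: "blinfun_apply (d_xi W w) x = frechet_derivative W (at w) (0, x, 0)"
proof -
  obtain \<mu> \<xi> \<nu> where w: "w = (\<mu>, \<xi>, \<nu>)" by (cases w)
  have "((\<lambda>m. (\<mu>, m, \<nu>)) has_derivative (\<lambda>\<sigma>. (0, \<sigma>, 0))) (at \<xi>)"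
    by (intro has_derivative_Pair has_derivative_ident has_derivative_const)
  from partial_frechet_derivative[OF reduced_derivative this]
  have "d_xi W w = Blinfun (\<lambda>x. frechet_derivative W (at w) (0, x, 0))"
    by (simp add: w d_xi_def)
  moreover have "bounded_linear (\<lambda>x. frechet_derivative W (at w) (0, x, 0))"
    by (rule finite_dimensional_bounded_linear[OF fd linear_partial[OF linear_reduced_derivative linear_embeddings(3)]])
  ultimately show ?thesis by (simp add: bounded_linear_Blinfun_apply)
qed

lemma d_mu_apply: "blinfun_apply \<sigma> (d_mu W w) = frechet_derivative W (at w) (\<sigma>, 0, 0)"
proof -
  obtain n :: nat and e and c :: "nat \<Rightarrow> 'a \<Rightarrow>\<^sub>L real"
    where ec: "\<And>x. (\<Sum>i<n. c i x *\<^sub>R e i) = x"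
    by (rule finite_dimensionalE[OF fd]) blast
  show ?thesis
    unfolding d_mu_eq the_bidual_basis(1)[OF ec linear_partial[OF linear_reduced_derivative linear_embeddings(1)]]
    by (rule the_bidual_basis(2)[OF ec linear_partial[OF linear_reduced_derivative linear_embeddings(1)]])
qed

lemma d_nu_apply: "blinfun_apply \<sigma> (d_nu W w) = frechet_derivative W (at w) (0, 0, \<sigma>)"
proof -
  obtain n :: nat and e and c :: "nat \<Rightarrow> 'a \<Rightarrow>\<^sub>L real"
    where ec: "\<And>x. (\<Sum>i<n. c i x *\<^sub>R e i) = x"
    by (rule finite_dimensionalE[OF fd]) blast
  show ?thesis
    unfolding d_nu_eq the_bidual_basis(1)[OF ec linear_partial[OF linear_reduced_derivative linear_embeddings(2)]]
    by (rule the_bidual_basis(2)[OF ec linear_partial[OF linear_reduced_derivative linear_embeddings(2)]])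
qed

lemma reduced_derivative_split:
  "frechet_derivative W (at w) (\<sigma>, x, \<tau>) = \<sigma> (d_mu W w) + d_xi W w x + \<tau> (d_nu W w)"
proof -
  have "(\<sigma>, x, \<tau>) = (\<sigma>, 0, 0) + ((0, x, 0) + (0, 0, \<tau>))" by simp
  then have "frechet_derivative W (at w) (\<sigma>, x, \<tau>) = frechet_derivative W (at w) (\<sigma>, 0, 0)
      + (frechet_derivative W (at w) (0, x, 0) + frechet_derivative W (at w) (0, 0, \<tau>))"
    by (simp only: linear_add[OF linear_reduced_derivative])
  then show ?thesis by (simp add: d_mu_apply d_xi_apply d_nu_apply)
qed

text \<open>The coordinates of each partial derivative are derivatives of \<open>W\<close> in fixed
  directions, and these are smooth by the very definition of smoothness.\<close>

lemma smooth_on_partial_derivatives: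
  "smooth_on UNIV (d_mu W)" "smooth_on UNIV (d_xi W)" "smooth_on UNIV (d_nu W)"
proof -
  obtain n :: nat and e and c :: "nat \<Rightarrow> 'a \<Rightarrow>\<^sub>L real"
    where ec: "\<And>x. (\<Sum>i<n. c i x *\<^sub>R e i) = x"
    by (rule finite_dimensionalE[OF fd]) blast
  have "d_mu W = (\<lambda>w. \<Sum>i<n. c i (d_mu W w) *\<^sub>R e i)" by (simp add: ec)
  then have "d_mu W = (\<lambda>w. \<Sum>i<n. frechet_derivative W (at w) (c i, 0, 0) *\<^sub>R e i)"
    by (simp only: d_mu_apply)
  moreover have "smooth_on UNIV (\<lambda>w. \<Sum>i<n. frechet_derivative W (at w) (c i, 0, 0) *\<^sub>R e i)"
    by (intro smooth_on_sum smooth_on_scaleR smooth_on_frechet_derivative W smooth_on_const open_UNIV)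
  ultimately show "smooth_on UNIV (d_mu W)" by simp
  have "d_nu W = (\<lambda>w. \<Sum>i<n. c i (d_nu W w) *\<^sub>R e i)" by (simp add: ec)
  then have "d_nu W = (\<lambda>w. \<Sum>i<n. frechet_derivative W (at w) (0, 0, c i) *\<^sub>R e i)"
    by (simp only: d_nu_apply)
  moreover have "smooth_on UNIV (\<lambda>w. \<Sum>i<n. frechet_derivative W (at w) (0, 0, c i) *\<^sub>R e i)"
    by (intro smooth_on_sum smooth_on_scaleR smooth_on_frechet_derivative W smooth_on_const open_UNIV)
  ultimately show "smooth_on UNIV (d_nu W)" by simp
  have "d_xi W = (\<lambda>w. \<Sum>i<n. blinfun_apply (d_xi W w) (e i) *\<^sub>R c i)"
    by (simp add: dual_basis[OF ec])
  then have "d_xi W = (\<lambda>w. \<Sum>i<n. frechet_derivative W (at w) (0, e i, 0) *\<^sub>R c i)"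
    by (simp only: d_xi_apply)
  moreover have "smooth_on UNIV (\<lambda>w. \<Sum>i<n. frechet_derivative W (at w) (0, e i, 0) *\<^sub>R c i)"
    by (intro smooth_on_sum smooth_on_scaleR smooth_on_frechet_derivative W smooth_on_const open_UNIV)
  ultimately show "smooth_on UNIV (d_xi W)" by simp
qed

end

subsection \<open>Hamiltonian vector fields\<close>

context lie_group
begin

lemma ad_star_apply: "blinfun_apply (ad_star \<xi> \<mu>) \<eta> = blinfun_apply \<mu> (lie_bracket \<xi> \<eta>)"
proof -
  have "bounded_linear (\<lambda>\<eta>. blinfun_apply \<mu> (lie_bracket \<xi> \<eta>))"
    by (rule bounded_linear_compose[OF blinfun.bounded_linear_right lie_bracket.bounded_linear_right])
  then show ?thesis by (simp add: ad_star_def bounded_linear_Blinfun_apply)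
qed

section \<open>The frame of the fields X and nondegeneracy of Omega\<close>

lemma inj_vfield: "inj (\<lambda>a. vfield a p)"
proof (rule injI)
  fix a b assume ab: "vfield a p = vfield b p"
  obtain g \<mu> \<xi> \<nu> where p: "p = (g, \<mu>, \<xi>, \<nu>)" by (cases p)
  obtain a1 a2 a3 a4 where a: "a = (a1, a2, a3, a4)" by (cases a)
  obtain b1 b2 b3 b4 where b: "b = (b1, b2, b3, b4)" by (cases b)
  have "TR g a1 = TR g b1" using ab by (simp add: p a b)
  then have 1: "a1 = b1" by (metis TR_inverse_left)
  then have 2: "a2 = b2" using ab by (simp add: p a b)
  then show "a = b" using ab 1 by (simp add: p a b)
qed

text \<open>The system is triangular: the first component is solved by translating back to the unit,
  the second then gives \<open>\<nu>2\<close>, which has to be known before the fourth, where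
  \<open>ad_star \<xi> \<nu>2\<close> enters.\<close>

lemma surj_vfield: "\<exists>a. u = vfield a p"
proof -
  obtain g \<mu> \<xi> \<nu> where p: "p = (g, \<mu>, \<xi>, \<nu>)" by (cases p)
  obtain u1 u2 u3 u4 where u: "u = (u1, u2, u3, u4)" by (cases u)
  define a1 where "a1 = tangent_map ch ch (\<lambda>h. h \<cdot> ginv g) g u1"
  define a2 where "a2 = u2 - ad_star a1 \<mu>"
  have "u = vfield (a1, a2, u3 - lie_bracket \<xi> a1, u4 - ad_star a1 \<nu> + ad_star \<xi> a2) p"
    by (simp add: p u a2_def) (simp add: a1_def TR_inverse_right)
  then show ?thesis by blast
qed

lemma Omega_vfield: "Omega p (vfield a p) (vfield b p) = Omega_coeff p a b"
  by (simp add: Omega_def the_inv_f_f[OF inj_vfield])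

text \<open>Testing against the two dual slots kills all brackets and isolates \<open>a1\<close> and
  \<open>a3\<close>. With these known the bracket terms agree on both sides, so the slots in the Lie
  algebra isolate \<open>a2\<close> and finally \<open>a4\<close>.\<close>

lemma Omega_coeff_nondegenerate:
  assumes "\<And>b. Omega_coeff p a b = Omega_coeff p a' b"
  shows "a = a'"
proof -
  obtain g \<mu> \<xi> \<nu> where p: "p = (g, \<mu>, \<xi>, \<nu>)" by (cases p)
  obtain a1 a2 a3 a4 where a: "a = (a1, a2, a3, a4)" by (cases a)
  obtain b1 b2 b3 b4 where b: "a' = (b1, b2, b3, b4)" by (cases a')
  note eq = assms[unfolded p a b Omega_coeff.simps]
  have "blinfun_apply \<sigma> a1 = blinfun_apply \<sigma> b1" for \<sigma> :: "'a dual"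
    using eq[of "(0, 0, 0, \<sigma>)"] by (simp add: lie_bracket.zero_right blinfun.zero_right)
  then have 1: "a1 = b1" by (rule dual_separates[OF finite_dimensional_model])
  have "blinfun_apply \<sigma> a3 = blinfun_apply \<sigma> b3" for \<sigma> :: "'a dual"
    using eq[of "(0, \<sigma>, 0, 0)"] by (simp add: lie_bracket.zero_right blinfun.zero_right)
  then have 3: "a3 = b3" by (rule dual_separates[OF finite_dimensional_model])
  have 2: "a2 = b2"
  proof (rule blinfun_eqI)
    show "blinfun_apply a2 x = blinfun_apply b2 x" for x
      using eq[of "(0, 0, x, 0)"] by (simp add: 1 3 lie_bracket.zero_right blinfun.zero_right)
  qed
  have 4: "a4 = b4"
  proof (rule blinfun_eqI)
    show "blinfun_apply a4 x = blinfun_apply b4 x" for x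
      using eq[of "(x, 0, 0, 0)"] by (simp add: 1 2 3)
  qed
  show ?thesis by (simp add: a b 1 2 3 4)
qed

text \<open>The solution of \<open>i\<^bsub>X\<^esub> \<Omega> = - dE\<close> when \<open>dE\<close> has the components \<open>\<alpha>\<close> (along the right invariant
  fields on \<open>G\<close>), \<open>a = \<delta>E/\<delta>\<mu>\<close>, \<open>x = \<delta>E/\<delta>\<xi>\<close> and \<open>n = \<delta>E/\<delta>\<nu>\<close>.\<close>

fun hamiltonian_coeff :: "'a dual \<Rightarrow> 'a \<Rightarrow> 'a dual \<Rightarrow> 'a \<Rightarrow> ('g, 'a) tulczyjew \<Rightarrow> 'a \<times> 'a dual \<times> 'a \<times> 'a dual" where
  "hamiltonian_coeff \<alpha> a x n (g, \<mu>, \<xi>, \<nu>) =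
     (n, - x - ad_star n \<mu>, a - lie_bracket \<xi> n, - \<alpha> - ad_star \<xi> x - ad_star \<xi> (ad_star n \<mu>))"

text \<open>Comparing the coefficients of \<open>\<nu>3\<close>, \<open>\<nu>2\<close>,
  \<open>\<xi>3\<close> and \<open>\<xi>2\<close> yields the four components. Only the last
  comparison uses the Jacobi identity: it contracts [[\<xi>, n], .] - [\<xi>, [n, .]] to -[n,
  [\<xi>, .]], which produces the double \<open>ad_star\<close> term.\<close>

lemma Omega_hamiltonian_coeff:
  "Omega_coeff (g, \<mu>, \<xi>, \<nu>) (hamiltonian_coeff \<alpha> a x n (g, \<mu>, \<xi>, \<nu>)) (\<xi>2, \<nu>2, \<xi>3, \<nu>3) =
    - (blinfun_apply \<alpha> \<xi>2 + blinfun_apply (\<nu>2 + ad_star \<xi>2 \<mu>) a + blinfun_apply x (\<xi>3 + lie_bracket \<xi> \<xi>2)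
       + blinfun_apply (\<nu>3 + ad_star \<xi>2 \<nu> - ad_star \<xi> \<nu>2) n)"
  using lie_bracket_antisym[of \<xi>2 a] lie_bracket_antisym[of \<xi>2 n] lie_bracket_jacobi[of \<xi> n \<xi>2]
  by (simp add: blinfun.add_left blinfun.add_right blinfun.diff_left blinfun.diff_right
      blinfun.minus_left blinfun.minus_right ad_star_apply lie_bracket.diff_left)

text \<open>The preceding identity is evaluated on a second solution. The fibre part of the field of
  that solution is (- x', a', - \<alpha>' + ad_star n' \<nu>): all terms in \<mu> and \<xi> have
  cancelled.\<close>

lemma Omega_hamiltonian_coeff_pair:
  "Omega_coeff (g, \<mu>, \<xi>, \<nu>) (hamiltonian_coeff \<alpha> a x n (g, \<mu>, \<xi>, \<nu>)) (hamiltonian_coeff \<alpha>' a' x' n' (g, \<mu>, \<xi>, \<nu>)) =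
    blinfun_apply \<alpha>' n - blinfun_apply \<alpha> n' + (blinfun_apply x' a - blinfun_apply x a' + blinfun_apply \<nu> (lie_bracket n n'))"
  unfolding hamiltonian_coeff.simps[of \<alpha>' a' x' n'] Omega_hamiltonian_coeff
  using lie_bracket_antisym[of n' n]
  by (simp add: blinfun.add_left blinfun.add_right blinfun.diff_left blinfun.diff_right
      blinfun.minus_left blinfun.minus_right ad_star_apply)

section \<open>Differentials on the trivialised phase space\<close>

lemma finite_dimensional_reduced: "finite_dimensional TYPE('a reduced)"
  by (intro finite_dimensional_prod finite_dimensional_dual finite_dimensional_model)

lemma atlas_reduced: "atlas (vector_charts :: 'a reduced \<Rightarrow> _)"
  by (rule atlas_vector_charts[OF finite_dimensional_reduced])

lemma atlas_tulczyjew: "atlas tulczyjew_charts"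
  unfolding tulczyjew_charts_def by (rule atlas_prod_charts[OF atlas_ch atlas_reduced])

lemma smooth_fun_tulczyjew_iff:
  "smooth_fun tulczyjew_charts E \<longleftrightarrow> (\<forall>p. smooth_near tulczyjew_charts vector_charts E p)"
  unfolding smooth_fun_def
  using smooth_map_imp_smooth_near[OF atlas_tulczyjew atlas_real]
    smooth_near_imp_smooth_map[OF atlas_tulczyjew atlas_real] by blast

lemma smooth_fun_reduced_iff:
  fixes W :: "'a reduced \<Rightarrow> real"
  shows "smooth_fun vector_charts W \<longleftrightarrow> (\<forall>w. smooth_near vector_charts vector_charts W w)"
  unfolding smooth_fun_def
  using smooth_map_imp_smooth_near[OF atlas_reduced atlas_real]
    smooth_near_imp_smooth_map[OF atlas_reduced atlas_real] by blast

lemma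
  shows smooth_near_orbit: "smooth_near ch tulczyjew_charts (\<lambda>k. (k \<cdot> g, w)) gunit"
    and tangent_map_orbit: "tangent_map ch tulczyjew_charts (\<lambda>k. (k \<cdot> g, w)) gunit z = (TR g z, 0)"
  unfolding tulczyjew_charts_def
   apply (rule smooth_near_Pair[OF atlas_ch atlas_ch atlas_reduced smooth_near_right_mult
        smooth_near_const[OF atlas_ch atlas_reduced]])
  using tangent_map_Pair[OF atlas_ch atlas_ch atlas_reduced smooth_near_right_mult
      smooth_near_const[OF atlas_ch atlas_reduced]] tangent_map_const[OF atlas_ch atlas_reduced]
  by (simp add: TR_def)

lemma
  shows smooth_near_fibre: "smooth_near vector_charts tulczyjew_charts (\<lambda>w. (g, w)) w"
    and tangent_map_fibre: "tangent_map vector_charts tulczyjew_charts (\<lambda>w. (g, w)) w s = (0, s)"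
  unfolding tulczyjew_charts_def
   apply (rule smooth_near_Pair[OF atlas_reduced atlas_ch atlas_reduced
        smooth_near_const[OF atlas_reduced atlas_ch] smooth_near_ident[OF atlas_reduced]])
  using tangent_map_Pair[OF atlas_reduced atlas_ch atlas_reduced
        smooth_near_const[OF atlas_reduced atlas_ch] smooth_near_ident[OF atlas_reduced]]
      tangent_map_const[OF atlas_reduced atlas_ch] tangent_map_ident[OF atlas_reduced]
  by simp

text \<open>The group part of the differential, moved to the Lie algebra by right translation. As it
  differentiates along the products \<open>k \<cdot> g\<close>, replacing \<open>E\<close> by its
  right translate under \<open>h\<close> only replaces \<open>g\<close> by
  \<open>g \<cdot> h\<close>.\<close>

definition right_derivative :: "(('g, 'a) tulczyjew \<Rightarrow> real) \<Rightarrow> 'g \<Rightarrow> 'a reduced \<Rightarrow> 'a \<Rightarrow> real" where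
  "right_derivative E g w = tangent_map ch vector_charts (\<lambda>k. E (k \<cdot> g, w)) gunit"

context
  fixes E :: "('g, 'a) tulczyjew \<Rightarrow> real"
  assumes E: "smooth_fun tulczyjew_charts E"
begin

lemma smooth_fun_imp_smooth_near: "smooth_near tulczyjew_charts vector_charts E p"
  using E smooth_fun_tulczyjew_iff by blast

lemma smooth_on_fibre: "smooth_on UNIV (\<lambda>w. E (g, w))"
proof -
  have "smooth_near vector_charts vector_charts (\<lambda>w. E (g, w)) w" for w
    by (rule smooth_near_compose[OF atlas_reduced atlas_tulczyjew smooth_near_fibre smooth_fun_imp_smooth_near])
  then show ?thesis
    using smooth_fun_reduced_iff smooth_fun_vector_charts_iff by blast
qed

lemma linear_right_derivative: "linear (right_derivative E g w)"
  unfolding right_derivative_def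
  by (rule tangent_map_linear[OF atlas_ch
        smooth_near_compose[OF atlas_ch atlas_tulczyjew smooth_near_orbit smooth_fun_imp_smooth_near]])

lemma right_derivative_blinfun:
  "blinfun_apply (Blinfun (right_derivative E g w)) z = right_derivative E g w z"
  by (simp add: bounded_linear_Blinfun_apply
      finite_dimensional_bounded_linear[OF finite_dimensional_model linear_right_derivative])

text \<open>The chain rule along two embeddings through the point, the translated group and the
  fibre, whose tangent images together give every vector.\<close>

lemma tangent_map_tulczyjew:
  "tangent_map tulczyjew_charts vector_charts E (g, w) (TR g z, s)
    = right_derivative E g w z + frechet_derivative (\<lambda>w. E (g, w)) (at w) s"
proof -
  have lin: "linear (tangent_map tulczyjew_charts vector_charts E (g, w))"
    by (rule tangent_map_linear[OF atlas_tulczyjew smooth_fun_imp_smooth_near])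
  have 1: "right_derivative E g w z = tangent_map tulczyjew_charts vector_charts E (g, w) (TR g z, 0)"
    unfolding right_derivative_def
    using tangent_map_compose[OF atlas_ch atlas_tulczyjew smooth_near_orbit smooth_fun_imp_smooth_near, of g w z]
    by (simp add: tangent_map_orbit)
  have 2: "frechet_derivative (\<lambda>w. E (g, w)) (at w) s = tangent_map tulczyjew_charts vector_charts E (g, w) (0, s)"
    using tangent_map_compose[OF atlas_reduced atlas_tulczyjew smooth_near_fibre smooth_fun_imp_smooth_near, of g w s]
    by (simp add: tangent_map_fibre tangent_map_vector_charts)
  have "(TR g z, s) = (TR g z, 0) + (0, s)" by simp
  then show ?thesis by (simp only: 1 2 linear_add[OF lin])
qed

definition hamiltonian_vf_coeff :: "('g, 'a) tulczyjew \<Rightarrow> 'a \<times> 'a dual \<times> 'a \<times> 'a dual" where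
  "hamiltonian_vf_coeff p = hamiltonian_coeff (Blinfun (right_derivative E (fst p) (snd p)))
     (d_mu (\<lambda>w. E (fst p, w)) (snd p)) (d_xi (\<lambda>w. E (fst p, w)) (snd p)) (d_nu (\<lambda>w. E (fst p, w)) (snd p)) p"

lemma Omega_hamiltonian_vf_coeff: "Omega_coeff p (hamiltonian_vf_coeff p) b = - tangent_map tulczyjew_charts vector_charts E p (vfield b p)"
proof -
  obtain g \<mu> \<xi> \<nu> where p: "p = (g, \<mu>, \<xi>, \<nu>)" by (cases p)
  obtain b1 b2 b3 b4 where b: "b = (b1, b2, b3, b4)" by (cases b)
  show ?thesis
    unfolding p b hamiltonian_vf_coeff_def fst_conv snd_conv Omega_hamiltonian_coeff vfield.simps tangent_map_tulczyjew
      reduced_derivative_split[OF smooth_on_fibre finite_dimensional_model] right_derivative_blinfun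
    by simp
qed

lemma hamiltonian_vf_eq: "hamiltonian_vf E p = vfield (hamiltonian_vf_coeff p) p"
  unfolding hamiltonian_vf_def
proof (rule the_equality)
  show "\<forall>v. Omega p (vfield (hamiltonian_vf_coeff p) p) v = - tangent_map tulczyjew_charts vector_charts E p v"
  proof
    fix v
    obtain b where "v = vfield b p" using surj_vfield by blast
    then show "Omega p (vfield (hamiltonian_vf_coeff p) p) v = - tangent_map tulczyjew_charts vector_charts E p v"
      by (simp only: Omega_vfield Omega_hamiltonian_vf_coeff)
  qed
  fix u assume u: "\<forall>v. Omega p u v = - tangent_map tulczyjew_charts vector_charts E p v"
  obtain a where a: "u = vfield a p" using surj_vfield by blast
  have "Omega_coeff p a b = Omega_coeff p (hamiltonian_vf_coeff p) b" for b
    using u[rule_format, of "vfield b p"] by (simp only: a Omega_vfield Omega_hamiltonian_vf_coeff)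
  then have "a = hamiltonian_vf_coeff p" by (rule Omega_coeff_nondegenerate)
  then show "u = vfield (hamiltonian_vf_coeff p) p" by (simp only: a)
qed

end

section \<open>The bracket on the phase space and its equivariance\<close>

lemma poisson_bracket_eq:
  assumes E: "smooth_fun tulczyjew_charts E" and F: "smooth_fun tulczyjew_charts F"
  shows "poisson_bracket E F (g, w) =
    right_derivative F g w (d_nu (\<lambda>w. E (g, w)) w) - right_derivative E g w (d_nu (\<lambda>w. F (g, w)) w)
    + reduced_bracket (\<lambda>w. E (g, w)) (\<lambda>w. F (g, w)) w"
proof -
  obtain \<mu> \<xi> \<nu> where w: "w = (\<mu>, \<xi>, \<nu>)" by (cases w)
  show ?thesis
    unfolding poisson_bracket_def hamiltonian_vf_eq[OF E] hamiltonian_vf_eq[OF F] Omega_vfield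
      hamiltonian_vf_coeff_def[OF E] hamiltonian_vf_coeff_def[OF F] w fst_conv snd_conv Omega_hamiltonian_coeff_pair
      right_derivative_blinfun[OF E] right_derivative_blinfun[OF F]
    by (simp add: reduced_bracket_def)
qed

lemma right_derivative_invariant:
  assumes "\<And>g h. E (g, w) = E (h, w)"
  shows "right_derivative E g w z = 0"
proof -
  have "(\<lambda>k. E (k \<cdot> g, w)) = (\<lambda>_. E (g, w))" using assms by blast
  then show ?thesis by (simp add: right_derivative_def tangent_map_const[OF atlas_ch atlas_real])
qed

lemma poisson_bracket_right_action:
  assumes E: "smooth_fun tulczyjew_charts E" and F: "smooth_fun tulczyjew_charts F"
  shows "poisson_bracket (\<lambda>q. E (right_action q h)) (\<lambda>q. F (right_action q h)) p
    = poisson_bracket E F (right_action p h)"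
proof -
  obtain g w where p: "p = (g, w)" by (cases p)
  have act: "smooth_near tulczyjew_charts tulczyjew_charts (\<lambda>q. right_action q h) q" for q
  proof -
    have "(\<lambda>q. right_action q h) = (\<lambda>q. (fst q \<cdot> h, snd q))" by auto
    then show ?thesis
      unfolding tulczyjew_charts_def
      by (simp only:) (intro smooth_near_Pair smooth_near_mult smooth_near_fst smooth_near_snd
          smooth_near_ch_const atlas_prod_charts atlas_ch atlas_reduced)
  qed
  have s: "smooth_fun tulczyjew_charts (\<lambda>q. D (right_action q h))" if "smooth_fun tulczyjew_charts D" for D
    using smooth_near_compose[OF atlas_tulczyjew atlas_tulczyjew act smooth_fun_imp_smooth_near[OF that]]
    by (simp add: smooth_fun_tulczyjew_iff)
  \<comment> \<open>Associativity alone: moving by \<open>k\<close> on the left commutes with the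
    right translation by \<open>h\<close>.\<close>
  have r: "right_derivative (\<lambda>q. D (right_action q h)) g w = right_derivative D (g \<cdot> h) w" for D
    by (simp add: right_derivative_def assoc)
  show ?thesis by (simp add: p poisson_bracket_eq s E F r)
qed

subsection \<open>The Poisson structure on the reduced space\<close>

text \<open>The Hamiltonian vector field on the reduced space: the fibre part of the field upstairs
  when the group part of the differential vanishes.\<close>

definition reduced_vf :: "('a reduced \<Rightarrow> real) \<Rightarrow> 'a reduced \<Rightarrow> 'a reduced" where
  "reduced_vf E w = (- d_xi E w, d_mu E w, ad_star (d_nu E w) (snd (snd w)))"

lemma reduced_bracket_eq_split:
  "reduced_bracket E F w = blinfun_apply (d_xi F w) (d_mu E w) - blinfun_apply (d_xi E w) (d_mu F w)
     + blinfun_apply (snd (snd w)) (lie_bracket (d_nu E w) (d_nu F w))"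
  by (cases w) (simp add: reduced_bracket_def)

lemma reduced_bracket_eq_derivative:
  assumes "smooth_on UNIV F"
  shows "reduced_bracket E F w = frechet_derivative F (at w) (reduced_vf E w)"
  unfolding reduced_vf_def reduced_derivative_split[OF assms finite_dimensional_model] reduced_bracket_eq_split
  by (simp add: ad_star_apply blinfun.minus_left)

lemma reduced_bracket_antisym: "reduced_bracket E F w = - reduced_bracket F E w"
  unfolding reduced_bracket_eq_split using lie_bracket_antisym[of "d_nu E w" "d_nu F w"]
  by (simp add: blinfun.minus_right)

text \<open>The vectors \<open>reduced_vf F w0\<close> and \<open>reduced_vf H w0\<close> are frozen
  at the base point. The derivatives of the partial derivatives thereby become second derivatives
  along constant directions, the form to which symmetry applies.\<close>

lemma reduced_bracket_derivative:
  assumes F: "smooth_on UNIV F" and H: "smooth_on UNIV H"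
  shows "(reduced_bracket F H has_derivative (\<lambda>v.
      frechet_derivative (\<lambda>w. frechet_derivative H (at w) (reduced_vf F w0)) (at w0) v
    - frechet_derivative (\<lambda>w. frechet_derivative F (at w) (reduced_vf H w0)) (at w0) v
    + blinfun_apply (snd (snd v)) (lie_bracket (d_nu F w0) (d_nu H w0)))) (at w0)"
proof -
  note fd = finite_dimensional_model
  define D where "D f = frechet_derivative f (at w0)" for f :: "'a reduced \<Rightarrow> 'a"
  define D' where "D' f = frechet_derivative f (at w0)" for f :: "'a reduced \<Rightarrow> 'a dual"
  have d: "(d_mu W has_derivative D (d_mu W)) (at w0)" "(d_nu W has_derivative D (d_nu W)) (at w0)"
    "(d_xi W has_derivative D' (d_xi W)) (at w0)" if "smooth_on UNIV W" for W
    unfolding D_def D'_def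
    by (rule smooth_on_has_derivative[OF _ UNIV_I], rule smooth_on_partial_derivatives[OF that fd])+
  have d2: "frechet_derivative (\<lambda>w. frechet_derivative W (at w) (\<sigma>, x, \<tau>)) (at w0) v
      = blinfun_apply \<sigma> (D (d_mu W) v) + blinfun_apply (D' (d_xi W) v) x + blinfun_apply \<tau> (D (d_nu W) v)"
    if W: "smooth_on UNIV W" for W \<sigma> x \<tau> v
  proof -
    have eq: "(\<lambda>w. frechet_derivative W (at w) (\<sigma>, x, \<tau>)) = (\<lambda>w. \<sigma> (d_mu W w) + d_xi W w x + \<tau> (d_nu W w))"
      by (rule ext) (rule reduced_derivative_split[OF W fd])
    have "((\<lambda>w. \<sigma> (d_mu W w) + d_xi W w x + \<tau> (d_nu W w)) has_derivative
        (\<lambda>v. \<sigma> (D (d_mu W) v) + D' (d_xi W) v x + \<tau> (D (d_nu W) v))) (at w0)"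
      by (intro has_derivative_add bounded_linear.has_derivative[OF blinfun.bounded_linear_right]
          bounded_linear.has_derivative[OF blinfun.bounded_linear_left] d W)
    from frechet_derivative_at[OF this] show ?thesis unfolding eq by metis
  qed
  have snd2: "((\<lambda>w::'a reduced. snd (snd w)) has_derivative (\<lambda>v. snd (snd v))) (at w0)"
    by (intro has_derivative_snd has_derivative_ident)
  have "((\<lambda>w. blinfun_apply (d_xi H w) (d_mu F w) - blinfun_apply (d_xi F w) (d_mu H w)
     + blinfun_apply (snd (snd w)) (lie_bracket (d_nu F w) (d_nu H w))) has_derivative
     (\<lambda>v. (blinfun_apply (d_xi H w0) (D (d_mu F) v) + blinfun_apply (D' (d_xi H) v) (d_mu F w0))
        - (blinfun_apply (d_xi F w0) (D (d_mu H) v) + blinfun_apply (D' (d_xi F) v) (d_mu H w0))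
        + (blinfun_apply (snd (snd w0)) (lie_bracket (d_nu F w0) (D (d_nu H) v) + lie_bracket (D (d_nu F) v) (d_nu H w0))
           + blinfun_apply (snd (snd v)) (lie_bracket (d_nu F w0) (d_nu H w0))))) (at w0)"
    by (intro has_derivative_add has_derivative_diff blinfun.FDERIV lie_bracket.FDERIV d snd2 F H)
  then show ?thesis
    unfolding reduced_bracket_eq_split[abs_def] reduced_vf_def d2[OF H] d2[OF F]
  proof (rule has_derivative_eq_rhs)
    \<comment> \<open>A regrouping of the product rule: antisymmetry puts the undifferentiated
      bracket argument first, so that both terms with a derivative of \<open>d_nu\<close> become
      \<open>ad_star\<close> pairings, the last components of the two frozen vectors.\<close>
    show "(\<lambda>v. (blinfun_apply (d_xi H w0) (D (d_mu F) v) + blinfun_apply (D' (d_xi H) v) (d_mu F w0))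
        - (blinfun_apply (d_xi F w0) (D (d_mu H) v) + blinfun_apply (D' (d_xi F) v) (d_mu H w0))
        + (blinfun_apply (snd (snd w0)) (lie_bracket (d_nu F w0) (D (d_nu H) v) + lie_bracket (D (d_nu F) v) (d_nu H w0))
           + blinfun_apply (snd (snd v)) (lie_bracket (d_nu F w0) (d_nu H w0))))
      = (\<lambda>v. blinfun_apply (- d_xi F w0) (D (d_mu H) v) + blinfun_apply (D' (d_xi H) v) (d_mu F w0)
          + blinfun_apply (ad_star (d_nu F w0) (snd (snd w0))) (D (d_nu H) v)
        - (blinfun_apply (- d_xi H w0) (D (d_mu F) v) + blinfun_apply (D' (d_xi F) v) (d_mu H w0)
          + blinfun_apply (ad_star (d_nu H w0) (snd (snd w0))) (D (d_nu F) v))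
        + blinfun_apply (snd (snd v)) (lie_bracket (d_nu F w0) (d_nu H w0)))"
    proof
      fix v
      show "(blinfun_apply (d_xi H w0) (D (d_mu F) v) + blinfun_apply (D' (d_xi H) v) (d_mu F w0))
        - (blinfun_apply (d_xi F w0) (D (d_mu H) v) + blinfun_apply (D' (d_xi F) v) (d_mu H w0))
        + (blinfun_apply (snd (snd w0)) (lie_bracket (d_nu F w0) (D (d_nu H) v) + lie_bracket (D (d_nu F) v) (d_nu H w0))
           + blinfun_apply (snd (snd v)) (lie_bracket (d_nu F w0) (d_nu H w0)))
      = blinfun_apply (- d_xi F w0) (D (d_mu H) v) + blinfun_apply (D' (d_xi H) v) (d_mu F w0)
          + blinfun_apply (ad_star (d_nu F w0) (snd (snd w0))) (D (d_nu H) v)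
        - (blinfun_apply (- d_xi H w0) (D (d_mu F) v) + blinfun_apply (D' (d_xi F) v) (d_mu H w0)
          + blinfun_apply (ad_star (d_nu H w0) (snd (snd w0))) (D (d_nu F) v))
        + blinfun_apply (snd (snd v)) (lie_bracket (d_nu F w0) (d_nu H w0))"
        using lie_bracket_antisym[of "D (d_nu F) v" "d_nu H w0"]
        by (simp add: ad_star_apply blinfun.minus_left blinfun.minus_right blinfun.add_right blinfun.diff_right)
    qed
  qed
qed

text \<open>In coordinates the pairing and the Lie bracket are finite sums of products of scalar
  functions, with the brackets of the \<open>e i\<close> as constant coefficients.\<close>

lemma smooth_on_reduced_bracket:
  assumes E: "smooth_on UNIV E" and F: "smooth_on UNIV F"
  shows "smooth_on UNIV (reduced_bracket E F)"
proof -
  note fd = finite_dimensional_model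
  obtain n :: nat and e and c :: "nat \<Rightarrow> 'a \<Rightarrow>\<^sub>L real"
    where ec: "\<And>x. (\<Sum>i<n. c i x *\<^sub>R e i) = x"
    by (rule finite_dimensionalE[OF fd]) blast
  have pair: "blinfun_apply \<sigma> a = (\<Sum>i<n. blinfun_apply \<sigma> (e i) * c i a)" for \<sigma> a
  proof -
    have "blinfun_apply \<sigma> a = blinfun_apply \<sigma> (\<Sum>i<n. c i a *\<^sub>R e i)" by (simp only: ec)
    then show ?thesis by (simp add: blinfun.sum_right blinfun.scaleR_right mult.commute)
  qed
  have br: "lie_bracket a b = (\<Sum>i<n. \<Sum>j<n. (c i a * c j b) *\<^sub>R lie_bracket (e i) (e j))" for a b
  proof -
    have "lie_bracket a b = lie_bracket (\<Sum>i<n. c i a *\<^sub>R e i) (\<Sum>j<n. c j b *\<^sub>R e j)" by (simp only: ec)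
    also have "\<dots> = (\<Sum>j<n. \<Sum>i<n. (c i a * c j b) *\<^sub>R lie_bracket (e i) (e j))"
      by (simp add: lie_bracket.sum_left lie_bracket.sum_right lie_bracket.scaleR_left lie_bracket.scaleR_right
          scaleR_sum_right mult.commute)
    finally show ?thesis by (subst sum.swap)
  qed
  have eval: "bounded_linear (\<lambda>\<sigma>. blinfun_apply \<sigma> x)" for x :: 'a by (rule blinfun.bounded_linear_left)
  have nu: "smooth_on UNIV (\<lambda>w::'a reduced. snd (snd w))"
    by (rule smooth_on_bounded_linear[OF open_UNIV bounded_linear_compose[OF bounded_linear_snd bounded_linear_snd]
          smooth_on_ident])
  have coord: "smooth_on UNIV (\<lambda>w. c i (u w))" if "smooth_on UNIV u" for u :: "'a reduced \<Rightarrow> 'a" and i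
    by (rule smooth_on_bounded_linear[OF open_UNIV blinfun.bounded_linear_right that])
  have ap: "smooth_on UNIV (\<lambda>w. blinfun_apply (s w) (u w))"
    if s: "smooth_on UNIV s" and u: "smooth_on UNIV u" for s :: "'a reduced \<Rightarrow> 'a dual" and u
    unfolding pair[of "s _" "u _"]
    by (intro smooth_on_sum smooth_on_mult open_UNIV coord u smooth_on_bounded_linear[OF open_UNIV eval s])
  have lb: "smooth_on UNIV (\<lambda>w. lie_bracket (u w) (v w))"
    if u: "smooth_on UNIV u" and v: "smooth_on UNIV v" for u v :: "'a reduced \<Rightarrow> 'a"
    unfolding br[of "u _" "v _"]
    by (intro smooth_on_sum smooth_on_mult smooth_on_scaleR open_UNIV coord u v smooth_on_const)
  show ?thesis
    unfolding reduced_bracket_eq_split[abs_def]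
    by (intro smooth_on_add smooth_on_diff ap lb nu open_UNIV smooth_on_partial_derivatives[OF E fd]
        smooth_on_partial_derivatives[OF F fd])
qed

text \<open>The last component of \<open>reduced_vf E w\<close> is \<open>ad_star (d_nu E w)\<close>
  applied to the third coordinate of \<open>w\<close>; paired with the bracket of \<open>F\<close>
  and \<open>H\<close> it produces the nested Lie bracket.\<close>

lemma reduced_bracket_nested:
  assumes E: "smooth_on UNIV E" and F: "smooth_on UNIV F" and H: "smooth_on UNIV H"
  shows "reduced_bracket E (reduced_bracket F H) w =
      frechet_derivative (\<lambda>w'. frechet_derivative H (at w') (reduced_vf F w)) (at w) (reduced_vf E w)
    - frechet_derivative (\<lambda>w'. frechet_derivative F (at w') (reduced_vf H w)) (at w) (reduced_vf E w)
    + blinfun_apply (snd (snd w)) (lie_bracket (d_nu E w) (lie_bracket (d_nu F w) (d_nu H w)))"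
  unfolding reduced_bracket_eq_derivative[OF smooth_on_reduced_bracket[OF F H]]
    frechet_derivative_at[OF reduced_bracket_derivative[OF F H], symmetric]
  by (simp add: reduced_vf_def[of E] ad_star_apply)

lemma reduced_bracket_jacobi:
  assumes E: "smooth_on UNIV E" and F: "smooth_on UNIV F" and H: "smooth_on UNIV H"
  shows "reduced_bracket E (reduced_bracket F H) w + reduced_bracket F (reduced_bracket H E) w
    + reduced_bracket H (reduced_bracket E F) w = 0"
proof -
  let ?e = "d_nu E w" and ?f = "d_nu F w" and ?h = "d_nu H w"
  have "lie_bracket ?e (lie_bracket ?f ?h) + lie_bracket ?f (lie_bracket ?h ?e) + lie_bracket ?h (lie_bracket ?e ?f) = 0"
    using lie_bracket_jacobi[of ?e ?f ?h] lie_bracket_antisym[of "lie_bracket ?e ?f" ?h] lie_bracket_antisym[of ?h ?e]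
    by (simp add: lie_bracket.minus_right)
  then have "blinfun_apply (snd (snd w)) (lie_bracket ?e (lie_bracket ?f ?h) + lie_bracket ?f (lie_bracket ?h ?e)
      + lie_bracket ?h (lie_bracket ?e ?f)) = 0" by (simp only: blinfun.zero_right)
  \<comment> \<open>The second derivative of each of the three functions occurs twice, with opposite
    signs and with its two directions exchanged.\<close>
  then show ?thesis
    unfolding reduced_bracket_nested[OF E F H] reduced_bracket_nested[OF F H E] reduced_bracket_nested[OF H E F]
    using second_derivative_symmetric[OF E, of "reduced_vf F w" w "reduced_vf H w"]
      second_derivative_symmetric[OF F, of "reduced_vf H w" w "reduced_vf E w"]
      second_derivative_symmetric[OF H, of "reduced_vf E w" w "reduced_vf F w"]
    by (simp add: blinfun.add_right)
qed

lemma poisson_structure_reduced: "poisson_structure vector_charts reduced_bracket"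
  unfolding poisson_structure_def smooth_fun_vector_charts_iff
proof (intro conjI allI impI; (elim conjE)?)
  fix E F :: "'a reduced \<Rightarrow> real" and p
  assume "smooth_on UNIV E" "smooth_on UNIV F"
  then show "smooth_on UNIV (reduced_bracket E F)" by (rule smooth_on_reduced_bracket)
  show "reduced_bracket E F p = - reduced_bracket F E p" by (rule reduced_bracket_antisym)
next
  fix E F H :: "'a reduced \<Rightarrow> real" and c p
  assume E: "smooth_on UNIV E" and F: "smooth_on UNIV F" and H: "smooth_on UNIV H"
  note d = reduced_derivative[OF E finite_dimensional_model] reduced_derivative[OF F finite_dimensional_model]
  \<comment> \<open>Antisymmetry exhibits the bracket as a derivative of its first argument along
    \<open>reduced_vf H p\<close>, so linearity and the Leibniz rule are inherited from
    differentiation.\<close>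
  have br: "reduced_bracket D H p = - frechet_derivative D (at p) (reduced_vf H p)" if "smooth_on UNIV D" for D
    using reduced_bracket_antisym[of D H p] reduced_bracket_eq_derivative[OF that, of H p] by simp
  show "reduced_bracket (\<lambda>q. c * E q + F q) H p = c * reduced_bracket E H p + reduced_bracket F H p"
  proof -
    have "smooth_on UNIV (\<lambda>q. c * E q + F q)"
      by (intro smooth_on_add smooth_on_mult smooth_on_const open_UNIV E F)
    moreover have "((\<lambda>q. c * E q + F q) has_derivative
        (\<lambda>v. c * frechet_derivative E (at p) v + frechet_derivative F (at p) v)) (at p)"
      by (intro has_derivative_add has_derivative_mult_right d)
    ultimately show ?thesis by (simp add: br E F frechet_derivative_at[symmetric])
  qed
  show "reduced_bracket (\<lambda>q. E q * F q) H p = E p * reduced_bracket F H p + reduced_bracket E H p * F p"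
  proof -
    have "smooth_on UNIV (\<lambda>q. E q * F q)" by (intro smooth_on_mult open_UNIV E F)
    moreover have "((\<lambda>q. E q * F q) has_derivative
        (\<lambda>v. E p * frechet_derivative F (at p) v + frechet_derivative E (at p) v * F p)) (at p)"
      by (intro has_derivative_mult d)
    ultimately show ?thesis by (simp add: br E F frechet_derivative_at[symmetric])
  qed
  show "reduced_bracket E (reduced_bracket F H) p + reduced_bracket F (reduced_bracket H E) p
      + reduced_bracket H (reduced_bracket E F) p = 0"
    by (rule reduced_bracket_jacobi[OF E F H])
qed

section \<open>The orbit projection and the reduction\<close>

lemma smooth_map_right_action:
  "smooth_map (prod_charts tulczyjew_charts ch) tulczyjew_charts (\<lambda>(p, h). right_action p h)"
proof -
  note prod = atlas_prod_charts[OF atlas_tulczyjew atlas_ch]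
  have "smooth_near (prod_charts tulczyjew_charts ch) tulczyjew_charts (\<lambda>z. (fst (fst z) \<cdot> snd z, snd (fst z))) z" for z
    unfolding tulczyjew_charts_def
    by (intro smooth_near_Pair[OF prod[unfolded tulczyjew_charts_def] atlas_ch atlas_reduced]
        smooth_near_mult[OF prod[unfolded tulczyjew_charts_def]]
        smooth_near_snd[OF atlas_tulczyjew[unfolded tulczyjew_charts_def] atlas_ch]
        smooth_near_compose[OF prod[unfolded tulczyjew_charts_def] atlas_tulczyjew[unfolded tulczyjew_charts_def]
          smooth_near_fst[OF atlas_tulczyjew[unfolded tulczyjew_charts_def] atlas_ch]
          smooth_near_fst[OF atlas_ch atlas_reduced]]
        smooth_near_compose[OF prod[unfolded tulczyjew_charts_def] atlas_tulczyjew[unfolded tulczyjew_charts_def]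
          smooth_near_fst[OF atlas_tulczyjew[unfolded tulczyjew_charts_def] atlas_ch]
          smooth_near_snd[OF atlas_ch atlas_reduced]])
  moreover have "(\<lambda>z. (fst (fst z) \<cdot> snd z, snd (fst z))) = (\<lambda>(p, h). right_action p h)" by auto
  ultimately show ?thesis
    using smooth_near_imp_smooth_map[OF prod atlas_tulczyjew] by simp
qed

text \<open>One direction restricts to a fibre, the other composes with the smooth projection. Thus
  the smooth structure on the reduced space is the quotient structure.\<close>

lemma smooth_fun_comp_snd_iff:
  fixes W :: "'a reduced \<Rightarrow> real"
  shows "smooth_fun tulczyjew_charts (W \<circ> snd) \<longleftrightarrow> smooth_fun vector_charts W"
proof
  assume "smooth_fun tulczyjew_charts (W \<circ> snd)"
  from smooth_on_fibre[OF this] show "smooth_fun vector_charts W"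
    by (simp add: smooth_fun_vector_charts_iff)
next
  assume W: "smooth_fun vector_charts W"
  have near: "smooth_near tulczyjew_charts vector_charts snd p" for p
    unfolding tulczyjew_charts_def by (rule smooth_near_snd[OF atlas_ch atlas_reduced])
  have "smooth_near tulczyjew_charts vector_charts (\<lambda>p. W (snd p)) p" for p
    by (rule smooth_near_compose[OF atlas_tulczyjew atlas_reduced near])
       (use W smooth_fun_reduced_iff in blast)
  then show "smooth_fun tulczyjew_charts (W \<circ> snd)"
    by (simp add: smooth_fun_tulczyjew_iff o_def)
qed

lemma poisson_bracket_comp_snd:
  assumes E: "smooth_fun vector_charts E" and F: "smooth_fun vector_charts F"
  shows "poisson_bracket (E \<circ> snd) (F \<circ> snd) = reduced_bracket E F \<circ> snd"
proof (rule ext)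
  fix p :: "('g, 'a) tulczyjew"
  obtain g w where p: "p = (g, w)" by (cases p)
  show "poisson_bracket (E \<circ> snd) (F \<circ> snd) p = (reduced_bracket E F \<circ> snd) p"
    using E F unfolding p
    by (subst poisson_bracket_eq) (simp_all add: smooth_fun_comp_snd_iff right_derivative_invariant)
qed

lemma poisson_reduction_tulczyjew:
  "poisson_reduction (\<cdot>) gunit ch tulczyjew_charts poisson_bracket right_action
     vector_charts reduced_bracket snd"
  unfolding poisson_reduction_def
proof (intro conjI allI impI; (elim conjE)?)
  show "smooth_map (prod_charts tulczyjew_charts ch) tulczyjew_charts (\<lambda>(p, h). right_action p h)"
    by (rule smooth_map_right_action)
  show "right_action p gunit = p" for p by (cases p) simp
  show "right_action (right_action p h) k = right_action p (h \<cdot> k)" for p h k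
    by (cases p) (simp add: assoc)
  show "surj (snd :: ('g, 'a) tulczyjew \<Rightarrow> 'a reduced)" by (rule surjI[of _ "\<lambda>w. (gunit, w)"]) simp
  show "snd p = snd q \<longleftrightarrow> (\<exists>h. q = right_action p h)" for p q :: "('g, 'a) tulczyjew"
  proof -
    obtain g w where p: "p = (g, w)" by (cases p)
    obtain g' w' where q: "q = (g', w')" by (cases q)
    have "g \<cdot> (ginv g \<cdot> g') = g'" by (simp flip: assoc)
    then have "\<exists>h. g' = g \<cdot> h" by metis
    then show ?thesis by (auto simp: p q)
  qed
  show "poisson_structure vector_charts reduced_bracket" by (rule poisson_structure_reduced)
  show "smooth_fun vector_charts W \<longleftrightarrow> smooth_fun tulczyjew_charts (W \<circ> snd)" for W :: "'a reduced \<Rightarrow> real"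
    by (simp add: smooth_fun_comp_snd_iff)
qed (simp_all add: poisson_bracket_right_action poisson_bracket_comp_snd)

lemma poisson_bracket_invariant:
  assumes E: "smooth_fun tulczyjew_charts E" and F: "smooth_fun tulczyjew_charts F"
    and inv: "\<And>g h w. E (g, w) = E (h, w)" "\<And>g h w. F (g, w) = F (h, w)"
  shows "smooth_fun tulczyjew_charts (poisson_bracket E F)"
    and "poisson_bracket E F (g, w) = reduced_bracket (\<lambda>w. E (k, w)) (\<lambda>w. F (k, w)) w"
proof -
  \<comment> \<open>Invariant functions are read off at an arbitrary base point \<open>k\<close>,
    which exhibits them as pullbacks under the projection.\<close>
  have eq: "E = (\<lambda>w. E (k, w)) \<circ> snd" "F = (\<lambda>w. F (k, w)) \<circ> snd"
    using inv(1)[of _ _ k] inv(2)[of _ _ k] by (auto simp: fun_eq_iff)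
  have sm: "smooth_on UNIV (\<lambda>w. E (k, w))" "smooth_on UNIV (\<lambda>w. F (k, w))"
    by (rule smooth_on_fibre[OF E], rule smooth_on_fibre[OF F])
  have br: "poisson_bracket E F = reduced_bracket (\<lambda>w. E (k, w)) (\<lambda>w. F (k, w)) \<circ> snd"
    using poisson_bracket_comp_snd[of "\<lambda>w. E (k, w)" "\<lambda>w. F (k, w)"] sm
    unfolding eq[symmetric] by (simp add: smooth_fun_vector_charts_iff)
  show "poisson_bracket E F (g, w) = reduced_bracket (\<lambda>w. E (k, w)) (\<lambda>w. F (k, w)) w"
    by (simp add: br)
  show "smooth_fun tulczyjew_charts (poisson_bracket E F)"
    unfolding br smooth_fun_comp_snd_iff smooth_fun_vector_charts_iff
    by (rule smooth_on_reduced_bracket[OF sm])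
qed

end

theorem mainTheorem16:
  fixes gmult :: "'g::{t2_space, second_countable_topology} \<Rightarrow> 'g \<Rightarrow> 'g"
    and gunit :: 'g and ginv :: "'g \<Rightarrow> 'g"
    and ch :: "'g \<Rightarrow> ('g, 'a::banach) chart"
  assumes "lie_group gmult gunit ginv ch"
  shows
    "poisson_reduction gmult gunit ch
       (lie_group.tulczyjew_charts ch) (lie_group.poisson_bracket gmult gunit ginv ch)
       (lie_group.right_action gmult)
       vector_charts (lie_group.reduced_bracket gmult gunit ginv ch) snd
     \<and>
     (\<forall>E F :: ('g, 'a) tulczyjew \<Rightarrow> real.
        smooth_fun (lie_group.tulczyjew_charts ch) E \<and>
        smooth_fun (lie_group.tulczyjew_charts ch) F \<and>
        (\<forall>g h w. E (g, w) = E (h, w)) \<and> (\<forall>g h w. F (g, w) = F (h, w)) \<longrightarrow>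
        smooth_fun (lie_group.tulczyjew_charts ch)
          (lie_group.poisson_bracket gmult gunit ginv ch E F) \<and>
        (\<forall>g h w. lie_group.poisson_bracket gmult gunit ginv ch E F (g, w) =
                 lie_group.poisson_bracket gmult gunit ginv ch E F (h, w)) \<and>
        (\<forall>g \<mu> \<xi> \<nu>.
           lie_group.poisson_bracket gmult gunit ginv ch E F (g, \<mu>, \<xi>, \<nu>) =
             blinfun_apply (d_xi (\<lambda>w. F (g, w)) (\<mu>, \<xi>, \<nu>)) (d_mu (\<lambda>w. E (g, w)) (\<mu>, \<xi>, \<nu>))
             - blinfun_apply (d_xi (\<lambda>w. E (g, w)) (\<mu>, \<xi>, \<nu>)) (d_mu (\<lambda>w. F (g, w)) (\<mu>, \<xi>, \<nu>))
             + blinfun_apply \<nu>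
                 (lie_group.lie_bracket gmult gunit ginv ch
                    (d_nu (\<lambda>w. E (g, w)) (\<mu>, \<xi>, \<nu>)) (d_nu (\<lambda>w. F (g, w)) (\<mu>, \<xi>, \<nu>)))))"
proof -
  interpret lie_group gmult gunit ginv ch by (rule assms)
  show ?thesis
  proof (intro conjI allI impI; (elim conjE)?)
    show "poisson_reduction gmult gunit ch tulczyjew_charts poisson_bracket right_action
       vector_charts reduced_bracket snd"
      by (rule poisson_reduction_tulczyjew)
  next
    fix E F :: "('g, 'a) tulczyjew \<Rightarrow> real" and g h w \<mu> \<xi> \<nu>
    assume E: "smooth_fun tulczyjew_charts E" and F: "smooth_fun tulczyjew_charts F"
      and inv: "\<forall>g h w. E (g, w) = E (h, w)" "\<forall>g h w. F (g, w) = F (h, w)"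
    note br = poisson_bracket_invariant[OF E F inv(1)[rule_format] inv(2)[rule_format]]
    show "smooth_fun tulczyjew_charts (poisson_bracket E F)" by (rule br(1))
    \<comment> \<open>Both values are expressed through the reduced bracket of the functions read at
      the same base point \<open>g\<close>.\<close>
    show "poisson_bracket E F (g, w) = poisson_bracket E F (h, w)"
      by (rule trans[OF br(2)[of g w g] br(2)[of h w g, symmetric]])
    show "poisson_bracket E F (g, \<mu>, \<xi>, \<nu>) =
        blinfun_apply (d_xi (\<lambda>w. F (g, w)) (\<mu>, \<xi>, \<nu>)) (d_mu (\<lambda>w. E (g, w)) (\<mu>, \<xi>, \<nu>))
        - blinfun_apply (d_xi (\<lambda>w. E (g, w)) (\<mu>, \<xi>, \<nu>)) (d_mu (\<lambda>w. F (g, w)) (\<mu>, \<xi>, \<nu>))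
        + blinfun_apply \<nu> (lie_bracket (d_nu (\<lambda>w. E (g, w)) (\<mu>, \<xi>, \<nu>)) (d_nu (\<lambda>w. F (g, w)) (\<mu>, \<xi>, \<nu>)))"
      using br(2)[of g "(\<mu>, \<xi>, \<nu>)" g] by (simp add: reduced_bracket_eq_split)
  qed
qed

end
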